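(* Let $0<s<1$ and $\eta>0$. Suppose $\Gamma\subset\mathbb{E}$ is a lattice completely irrational with respect to $\mathbb{E}_\triangleleft$, $\mathbf s\in\mathbb{E}$, $\Omega_\triangleleft\subset\mathbb{E}_\triangleleft$ is an $s$-regular window, and the dual lattice $\Gamma^\dagger$ is $\psi$-repellent for $\psi(t)=\log(1+t)^{(1+\eta)/s}$. Then the cut-and-project set $\Lambda(\Gamma+\mathbf s;\Omega_\triangleleft)$ is biLipschitz equivalent to $\mathbb{Z}^{d_\triangledown}$, i.e. there is a bijection $\phi:\Lambda(\Gamma+\mathbf s;\Omega_\triangleleft)\to\mathbb{Z}^{d_\triangledown}$ with $\phi$ and $\phi^{-1}$ Lipschitz.
   Context: $\mathbb{E}=\mathbb{R}^d$ with an orthogonal decomposition $\mathbb{E}=\mathbb{E}_\triangledown\oplus\mathbb{E}_\triangleleft$ (identify $\mathbb{E}_\triangledown\cong\mathbb{R}^{d_\triangledown}$), $d_\triangledown,d_\triangleleft\ge1$, orthogonal projections $\pi_\triangledown,\pi_\triangleleft$; $\mathbf x_\bullet=\pi_\bullet\mathbf x$. A lattice is a discrete cocompact subgroup $\Gamma\subset\mathbb{E}$; the dual lattice is $\Gamma^\dagger=\{y: y\cdot\gamma\in\mathbb{Z}\ \forall\gamma\in\Gamma\}$. $\Gamma$ is completely irrational with respect to $\mathbb{E}_\triangleleft$ if $\Gamma\cap\mathbb{E}_\triangleleft=\{0\}=\Gamma^\dagger\cap\mathbb{E}_\triangleleft$. For increasing $\psi:(0,\infty)\to(0,\infty)$ with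 $\psi\to\infty$, a lattice $\Theta$ is $\psi$-repellent if there is $r_0>0$ such that every $\theta\in\Theta\setminus\{0\}$ with $|\theta_\triangledown|<r_0$ satisfies $|\theta_\triangleleft|>\psi(|\theta_\triangledown|^{-1})$. The $s$-codimensional upper Minkowski content of bounded $\Upsilon\subset\mathbb F$ is $\limsup_{r\to0}r^{-s}\mathrm{vol}(\Upsilon_r)$ ($\Upsilon_r$ the $r$-neighbourhood). An $s$-regular window is a bounded nonempty open $\Omega_\triangleleft\subset\mathbb{E}_\triangleleft$ with $\partial\Omega_\triangleleft$ of measure zero and finite $s$-codimensional upper Minkowski content in $\mathbb{E}_\triangleleft$. The cut-and-project set is $\Lambda(\Gamma+\mathbf s;\Omega_\triangleleft)=\pi_\triangledown\big((\Gamma+\mathbf s)\cap\pi_\triangleleft^{-1}(\Omega_\triangleleft)\big)\subset\mathbb{E}_\triangledown$. *)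

theory Defs
  imports "HOL-Analysis.Analysis"
begin

text \<open>Ambient space E = E_down x E_left, modelled as a product type
  real^'n x real^'m: first component = E_down (identified with R^{d_down}),
  second component = E_left. fst / snd are the orthogonal projections.\<close>

definition is_lattice :: "('a::euclidean_space) set \<Rightarrow> bool" where
  "is_lattice G \<longleftrightarrow>
     0 \<in> G \<and> (\<forall>x\<in>G. \<forall>y\<in>G. x - y \<in> G) \<and>
     (\<exists>e>0. \<forall>g\<in>G. g \<noteq> 0 \<longrightarrow> e \<le> norm g) \<and>
     (\<exists>K. compact K \<and> (\<forall>x. \<exists>g\<in>G. \<exists>k\<in>K. x = g + k))"

definition dual_lattice :: "('a::euclidean_space) set \<Rightarrow> 'a set" where
  "dual_lattice G = {y. \<forall>g\<in>G. inner y g \<in> \<int>}"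

definition completely_irrational ::
  "((real^'n) \<times> (real^'m)) set \<Rightarrow> bool" where
  "completely_irrational G \<longleftrightarrow>
     G \<inter> {x. fst x = 0} = {0} \<and> dual_lattice G \<inter> {x. fst x = 0} = {0}"

text \<open>psi-repellent. Since psi(|theta_down|^{-1}) is read as +infinity when
  theta_down = 0, such nonzero theta violate the condition.\<close>
definition psi_repellent ::
  "(real \<Rightarrow> real) \<Rightarrow> ((real^'n) \<times> (real^'m)) set \<Rightarrow> bool" where
  "psi_repellent \<psi> T \<longleftrightarrow>
     (\<exists>r0>0. \<forall>\<theta>\<in>T. \<theta> \<noteq> 0 \<and> norm (fst \<theta>) < r0 \<longrightarrow>
        fst \<theta> \<noteq> 0 \<and> norm (snd \<theta>) > \<psi> (1 / norm (fst \<theta>)))"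

definition nbhd :: "('a::metric_space) set \<Rightarrow> real \<Rightarrow> 'a set" where
  "nbhd U r = {x. \<exists>y\<in>U. dist x y < r}"

definition upper_minkowski_content :: "real \<Rightarrow> ('a::euclidean_space) set \<Rightarrow> ereal" where
  "upper_minkowski_content s U =
     Limsup (at_right 0) (\<lambda>r. ereal (measure lborel (nbhd U r) / r powr s))"

definition s_regular_window :: "real \<Rightarrow> ('a::euclidean_space) set \<Rightarrow> bool" where
  "s_regular_window s W \<longleftrightarrow>
     bounded W \<and> W \<noteq> {} \<and> open W \<and> frontier W \<in> null_sets lborel \<and>
     upper_minkowski_content s (frontier W) < \<infinity>"

definition cut_and_project ::
  "((real^'n) \<times> (real^'m)) set \<Rightarrow> (real^'n) \<times> (real^'m) \<Rightarrow> (real^'m) set \<Rightarrow> (real^'n) set" where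
  "cut_and_project G v W = fst ` {x \<in> (\<lambda>g. g + v) ` G. snd x \<in> W}"

definition integer_lattice :: "(real^'n) set" where
  "integer_lattice = {x. \<forall>i. x $ i \<in> \<int>}"

definition bilipschitz_equivalent :: "('a::metric_space) set \<Rightarrow> ('b::metric_space) set \<Rightarrow> bool" where
  "bilipschitz_equivalent A B \<longleftrightarrow>
     (\<exists>\<phi>. bij_betw \<phi> A B \<and> (\<exists>C. C-lipschitz_on A \<phi>) \<and>
          (\<exists>C. C-lipschitz_on B (inv_into A \<phi>)))"

end

theory Submission
  imports Defs "HOL-Complex_Analysis.Great_Picard" "HOL-Real_Asymp.Real_Asymp"
begin

text \<open>
  Rescaling the dual lattice by \<open>T = \<surd>L\<close> and \<open>r = log (1 + T)\<^sup>-\<^sup>(\<^sup>1\<^sup>+\<^sup>\<eta>\<^sup>)\<^sup>/\<^sup>s\<close>, repellence says that it has no short nonzero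
  vector, so by transference every point lies within \<open>O(T)\<close> and \<open>O(r)\<close> (in the two factors) of the lattice.
  Hence a kernel of width \<open>L\<close> counts the points of the cut-and-project set up to a relative error
  \<open>O(T/L + r\<^sup>s)\<close>, which is summable over \<open>L = 2\<^sup>i\<close>.

  Smoothing the counting measure at scale \<open>2\<^sup>i\<close> gives densities \<open>f\<^sub>i\<close> that tend to a constant. Doubling the
  scale in one coordinate changes the density by a derivative in that direction, so it can be realised by a
  shear along that coordinate, biLipschitz with constant \<open>1 + O(\<epsilon>\<^sub>i)\<close>, where \<open>\<epsilon>\<^sub>i\<close> is the error at scale \<open>2\<^sup>i\<close>.
  Composing the shears (as in the theorem of Burago and Kleiner, but with convolutions instead of dyadic
  cubes) yields uniformly biLipschitz maps that push the smoothed counting measure to a nearly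
  constant density, and Hall's theorem turns their limit into a bijection with a rescaled integer lattice.
\<close>

section \<open>Perfect matchings in locally finite bipartite graphs\<close>

text \<open>A shear distorts distances by 1 + O(\<epsilon>) only if its displacement varies slowly
  in every direction, not just along the sheared coordinate. At scale L the displacement has size
  O(\<epsilon> L), so a gradient O(\<epsilon>) has to be earned: the counting estimate is applied
  also to the difference of a kernel and its translate by h. This difference has integral zero and
  amplitude O(|h| / L), and it is again a test function at scale L if the kernel has a Lipschitz
  gradient; hence smooth kernels and the class \<open>C11\<close>. The exponent: boxes of height r
  around the lattice points misjudge a proportion O(\<open>r powr s\<close>) near the boundary of
  the window. For the given r this is a power -(1 + \<eta>) of log L, at L = 2^i a convergent series
  because \<eta> > 0. Taking T as the square root of L keeps log T comparable to log L and makes T /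
  L negligible. No limit of the maps is taken on the whole space. They share a biLipschitz constant
  and fix the origin, so a subsequence converges on the countable point set, and as the volume error
  tends to 0 Hall's inequalities become exact.\<close>

definition hall_cond :: "'a set \<Rightarrow> ('a \<Rightarrow> 'b set) \<Rightarrow> bool" where
  "hall_cond X N \<longleftrightarrow> (\<forall>x\<in>X. finite (N x)) \<and>
     (\<forall>A\<subseteq>X. finite A \<longrightarrow> card A \<le> card (\<Union>(N ` A)))"

lemma hall_condD: "hall_cond X N \<Longrightarrow> A \<subseteq> X \<Longrightarrow> finite A \<Longrightarrow> card A \<le> card (\<Union>(N ` A))"
  by (simp add: hall_cond_def)

text \<open>If \<open>N x\<close> had two elements, removing either one would break the condition
  and yield finite sets A and B that are tight next to x. The condition for A \<union> B with x
  added and the one for A \<inter> B then contradict card P + card Q = card (P \<union> Q) + card (P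
  \<inter> Q); since the removed points differ, P \<union> Q contains all of
  \<open>N x\<close>.\<close>

lemma hall_cond_minimal_singleton:
  assumes hall: "hall_cond X N"
    and min: "\<And>N'. hall_cond X N' \<Longrightarrow> (\<And>y. N' y \<subseteq> N y) \<Longrightarrow> N' = N"
    and x: "x \<in> X" and a: "a \<in> N x" and b: "b \<in> N x"
  shows "a = b"
proof (rule ccontr)
  assume "a \<noteq> b"
  have fin: "\<And>y. y \<in> X \<Longrightarrow> finite (N y)"
    using hall by (simp add: hall_cond_def)
  \<comment> \<open>A violating set must contain x, since nothing was removed elsewhere; taking x
    out of it turns the strict inequality into the weak one claimed.\<close>
  have key: "\<exists>A. A \<subseteq> X - {x} \<and> finite A \<and> card (\<Union>(N ` A) \<union> (N x - {c})) \<le> card A"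
    if c: "c \<in> N x" for c
  proof -
    define N' where "N' = N(x := N x - {c})"
    have "N' \<noteq> N" using c by (auto simp: N'_def fun_eq_iff)
    moreover have "\<And>y. N' y \<subseteq> N y" by (auto simp: N'_def)
    ultimately have "\<not> hall_cond X N'" using min by blast
    moreover have "\<forall>y\<in>X. finite (N' y)" using fin by (auto simp: N'_def)
    ultimately obtain A where A: "A \<subseteq> X" "finite A" "card (\<Union>(N' ` A)) < card A"
      by (auto simp: hall_cond_def not_le)
    have "x \<in> A"
    proof (rule ccontr)
      assume "x \<notin> A"
      then have "N' ` A = N ` A" by (auto simp: N'_def intro!: image_cong)
      with A hall_condD[OF hall A(1,2)] show False by simp
    qed
    have "\<Union>(N' ` A) = \<Union>(N ` (A - {x})) \<union> (N x - {c})"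
      using \<open>x \<in> A\<close> by (auto simp: N'_def split: if_splits)
    with A \<open>x \<in> A\<close> show ?thesis
      by (intro exI[of _ "A - {x}"]) auto
  qed
  obtain A where A: "A \<subseteq> X - {x}" "finite A" "card (\<Union>(N ` A) \<union> (N x - {a})) \<le> card A"
    using key[OF a] by blast
  obtain B where B: "B \<subseteq> X - {x}" "finite B" "card (\<Union>(N ` B) \<union> (N x - {b})) \<le> card B"
    using key[OF b] by blast
  let ?P = "\<Union>(N ` A) \<union> (N x - {a})" and ?Q = "\<Union>(N ` B) \<union> (N x - {b})"
  have finP: "finite ?P" "finite ?Q" using A B fin x by auto
  have "?P \<union> ?Q = \<Union>(N ` insert x (A \<union> B))" using \<open>a \<noteq> b\<close> by auto
  moreover have "card (insert x (A \<union> B)) \<le> card (\<Union>(N ` insert x (A \<union> B)))"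
    using A B x by (intro hall_condD[OF hall]) auto
  moreover have "card (insert x (A \<union> B)) = Suc (card (A \<union> B))"
    using A B by (intro card_insert_disjoint) auto
  ultimately have 1: "Suc (card (A \<union> B)) \<le> card (?P \<union> ?Q)" by simp
  have "card (A \<inter> B) \<le> card (\<Union>(N ` (A \<inter> B)))"
    using A B by (intro hall_condD[OF hall]) auto
  also have "\<dots> \<le> card (?P \<inter> ?Q)"
    using finP by (intro card_mono) auto
  finally have 2: "card (A \<inter> B) \<le> card (?P \<inter> ?Q)" .
  have "card ?P + card ?Q = card (?P \<union> ?Q) + card (?P \<inter> ?Q)"
    using finP by (rule card_Un_Int)
  moreover have "card A + card B = card (A \<union> B) + card (A \<inter> B)"
    using A B by (intro card_Un_Int) auto
  ultimately show False using 1 2 A(3) B(3) by linarith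
qed

lemma finite_chain_minimum:
  fixes G :: "'i \<Rightarrow> 'b set"
  assumes "I \<noteq> {}" "\<And>i. i \<in> I \<Longrightarrow> finite (G i)"
    and chain: "\<And>i j. i \<in> I \<Longrightarrow> j \<in> I \<Longrightarrow> G i \<subseteq> G j \<or> G j \<subseteq> G i"
  shows "\<exists>i\<in>I. \<forall>j\<in>I. G i \<subseteq> G j"
proof -
  obtain i where i: "i \<in> I" "\<And>j. j \<in> I \<Longrightarrow> card (G i) \<le> card (G j)"
    using ex_has_least_nat[of "\<lambda>i. i \<in> I" _ "\<lambda>i. card (G i)"] assms(1) by blast
  have "G i \<subseteq> G j" if "j \<in> I" for j
    using chain[OF i(1) that] i(2)[OF that] assms(2)[OF i(1)] card_seteq by blast
  with i(1) show ?thesis by blast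
qed

text \<open>A neighbourhood assignment that is minimal among those satisfying Hall's condition has only
  singleton values, so it is a matching; minimal assignments exist by Zorn's lemma.\<close>

theorem hall_locally_finite:
  assumes hall: "hall_cond X N"
  obtains f where "inj_on f X" "\<And>x. x \<in> X \<Longrightarrow> f x \<in> N x"
proof -
  define \<N> where "\<N> = {N'. hall_cond X N' \<and> (\<forall>y. N' y \<subseteq> N y)}"
  have ne: "N \<in> \<N>" using hall by (auto simp: \<N>_def)
  have "\<exists>M\<in>\<N>. \<forall>N'\<in>\<N>. (\<lambda>a b. \<forall>y. b y \<subseteq> a y) M N' \<longrightarrow> N' = M"
  proof (rule predicate_Zorn)
    show "partial_order_on \<N> (relation_of (\<lambda>a b. \<forall>y. b y \<subseteq> a y) \<N>)"
      by (rule partial_order_on_relation_ofI) (auto simp: fun_eq_iff)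
  next
    fix C assume C: "C \<in> Chains (relation_of (\<lambda>a b. \<forall>y. b y \<subseteq> a y) \<N>)"
    then have CN: "C \<subseteq> \<N>" by (rule Chains_relation_of)
    show "\<exists>U\<in>\<N>. \<forall>a\<in>C. \<forall>y. U y \<subseteq> a y"
    proof (cases "C = {}")
      case True then show ?thesis using ne by auto
    next
      case False
      have ch: "(\<forall>y. M y \<subseteq> M' y) \<or> (\<forall>y. M' y \<subseteq> M y)" if "M \<in> C" "M' \<in> C" for M M'
        using C that by (auto simp: Chains_def relation_of_def)
      define U where "U y = (\<Inter>M\<in>C. M y)" for y
      have UM: "U y \<subseteq> M y" if "M \<in> C" for M y using that by (auto simp: U_def)
      have finM: "finite (M y)" if "M \<in> C" "y \<in> X" for M y
        using that CN by (auto simp: \<N>_def hall_cond_def)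
      have "card A \<le> card (\<Union>(U ` A))" if A: "A \<subseteq> X" "finite A" for A
      proof -
        \<comment> \<open>Over a finite A the members of the chain have finite graphs, so one of
          them is least there and coincides with the intersection \<open>U\<close> on A. Hall's
          condition for A is inherited from that single member.\<close>
        have "\<exists>M\<in>C. \<forall>M'\<in>C. (SIGMA y:A. M y) \<subseteq> (SIGMA y:A. M' y)"
        proof (rule finite_chain_minimum)
          fix M assume "M \<in> C"
          then show "finite (SIGMA y:A. M y)" using A finM by (intro finite_SigmaI) auto
        next
          fix M M' assume "M \<in> C" "M' \<in> C"
          with ch show "(SIGMA y:A. M y) \<subseteq> (SIGMA y:A. M' y) \<or> (SIGMA y:A. M' y) \<subseteq> (SIGMA y:A. M y)"
            by blast
        qed fact
        then obtain M where M: "M \<in> C" "\<And>M'. M' \<in> C \<Longrightarrow> (SIGMA y:A. M y) \<subseteq> (SIGMA y:A. M' y)"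
          by blast
        have "U y = M y" if "y \<in> A" for y
          using M that by (fastforce simp: U_def)
        then have "\<Union>(U ` A) = \<Union>(M ` A)" by auto
        moreover have "hall_cond X M" using M(1) CN by (auto simp: \<N>_def)
        ultimately show ?thesis using hall_condD A by metis
      qed
      moreover have "\<forall>y\<in>X. finite (U y)"
        using False UM finM by (metis ex_in_conv finite_subset)
      moreover have "U y \<subseteq> N y" for y
        using False CN UM by (fastforce simp: \<N>_def)
      ultimately have "U \<in> \<N>" by (auto simp: \<N>_def hall_cond_def)
      with UM show ?thesis by blast
    qed
  qed
  then obtain M where M: "M \<in> \<N>" and Mmin: "\<And>N'. N' \<in> \<N> \<Longrightarrow> (\<And>y. N' y \<subseteq> M y) \<Longrightarrow> N' = M"
    by blast
  have hM: "hall_cond X M" and MN: "\<And>y. M y \<subseteq> N y" using M by (auto simp: \<N>_def)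
  have sing: "a = b" if "x \<in> X" "a \<in> M x" "b \<in> M x" for x a b
  proof (rule hall_cond_minimal_singleton[OF hM _ that])
    fix N' assume "hall_cond X N'" "\<And>y. N' y \<subseteq> M y"
    then show "N' = M" using MN by (intro Mmin) (auto simp: \<N>_def)
  qed
  have "\<exists>a. a \<in> M x" if "x \<in> X" for x
    using hall_condD[OF hM, of "{x}"] that by (cases "M x = {}") auto
  then obtain f where f: "\<And>x. x \<in> X \<Longrightarrow> f x \<in> M x" by metis
  have "inj_on f X"
  proof (rule inj_onI, rule ccontr)
    fix x y assume xy: "x \<in> X" "y \<in> X" "f x = f y" "x \<noteq> y"
    have "M x = {f x}" "M y = {f x}" using xy f sing by (metis insertI1 subsetI subset_antisym singletonD equalityI)+
    then have "\<Union>(M ` {x,y}) = {f x}" by auto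
    with hall_condD[OF hM, of "{x,y}"] xy show False by simp
  qed
  with f MN that show ?thesis by blast
qed

text \<open>The two injections are merged as in the Schroeder-Bernstein theorem. The construction is
  carried out explicitly because the bijection must run along edges: on \<open>S\<close> it is
  \<open>a\<close>, elsewhere the inverse of \<open>b\<close>, and both are matchings.\<close>

lemma hall_perfect_matching:
  assumes "hall_cond X (\<lambda>x. {y\<in>Y. E x y})" and "hall_cond Y (\<lambda>y. {x\<in>X. E x y})"
  obtains f where "bij_betw f X Y" "\<And>x. x \<in> X \<Longrightarrow> E x (f x)"
proof -
  obtain a where a: "inj_on a X" "\<And>x. x \<in> X \<Longrightarrow> a x \<in> {y\<in>Y. E x y}"
    using hall_locally_finite[OF assms(1)] by blast
  obtain b where b: "inj_on b Y" "\<And>y. y \<in> Y \<Longrightarrow> b y \<in> {x\<in>X. E x y}"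
    using hall_locally_finite[OF assms(2)] by blast
  define \<Phi> where "\<Phi> S = X - b ` (Y - a ` S)" for S
  have "mono \<Phi>"
    unfolding \<Phi>_def by (intro monoI Diff_mono image_mono order_refl)
  then have fp: "lfp \<Phi> = \<Phi> (lfp \<Phi>)" by (rule lfp_unfold)
  define S where "S = lfp \<Phi>"
  have S: "S = X - b ` (Y - a ` S)" using fp unfolding S_def \<Phi>_def .
  have XS: "X - S = b ` (Y - a ` S)" using S b(2) by auto
  define f where "f x = (if x \<in> S then a x else the_inv_into Y b x)" for x
  have SX: "S \<subseteq> X" using S by auto
  have inv: "the_inv_into Y b (b y) = y" if "y \<in> Y" for y
    using b(1) that by (rule the_inv_into_f_f)
  have "bij_betw f (S \<union> (X - S)) (a ` S \<union> (Y - a ` S))"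
  proof (rule bij_betw_combine)
    show "bij_betw f S (a ` S)"
      using a(1) SX by (auto simp: bij_betw_def f_def inj_on_def)
    show "bij_betw f (X - S) (Y - a ` S)"
    proof (rule bij_betw_imageI)
      show "inj_on f (X - S)"
        using XS inv by (auto simp: f_def inj_on_def)
      have "f ` (X - S) = (\<lambda>x. the_inv_into Y b x) ` b ` (Y - a ` S)"
        unfolding XS[symmetric] by (auto simp: f_def)
      also have "\<dots> = Y - a ` S" using inv by (auto simp: image_image)
      finally show "f ` (X - S) = Y - a ` S" .
    qed
  qed auto
  moreover have "S \<union> (X - S) = X" "a ` S \<union> (Y - a ` S) = Y" using SX a(2) by auto
  ultimately have "bij_betw f X Y" by simp
  moreover have "E x (f x)" if "x \<in> X" for x
  proof (cases "x \<in> S")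
    case True then show ?thesis using a(2)[OF that] by (simp add: f_def)
  next
    case False
    then have "x \<in> b ` (Y - a ` S)" using XS that by blast
    then obtain y where "y \<in> Y" "x = b y" by blast
    then show ?thesis using b(2) inv False by (auto simp: f_def)
  qed
  ultimately show ?thesis using that by blast
qed

section \<open>From volume-preserving maps to bijections\<close>

text \<open>Convolution of K with the counting measure of Y. The sum ranges over the nonzero terms
  only, since a sum over an infinite index set has the value 0.\<close>

definition smear :: "'a::ab_group_add set \<Rightarrow> ('a \<Rightarrow> real) \<Rightarrow> 'a \<Rightarrow> real" where
  "smear Y K x = (\<Sum>y\<in>{y\<in>Y. K (x - y) \<noteq> 0}. K (x - y))"

lemma smear_eq:
  assumes "finite F" "F \<subseteq> Y" "\<And>y. y \<in> Y \<Longrightarrow> y \<notin> F \<Longrightarrow> K (x - y) = 0"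
  shows "smear Y K x = (\<Sum>y\<in>F. K (x - y))"
  unfolding smear_def using assms by (intro sum.mono_neutral_left) auto

definition separated :: "real \<Rightarrow> 'a::metric_space set \<Rightarrow> bool" where
  "separated \<delta> Y \<longleftrightarrow> 0 < \<delta> \<and> (\<forall>x\<in>Y. \<forall>y\<in>Y. x \<noteq> y \<longrightarrow> \<delta> \<le> dist x y)"

lemma separated_finite:
  fixes Y :: "'a::heine_borel set"
  assumes sep: "separated \<delta> Y" and "X \<subseteq> Y" "bounded X"
  shows "finite X"
proof (rule ccontr)
  assume inf: "infinite X"
  obtain x where "x islimpt X"
    using bounded_infinite_imp_islimpt[OF subset_refl \<open>bounded X\<close> inf] by blast
  then have "infinite (X \<inter> ball x (\<delta>/2))"
    using sep by (auto simp: islimpt_eq_infinite_ball separated_def)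
  then obtain a where a: "a \<in> X \<inter> ball x (\<delta>/2)"
    by (metis finite.emptyI ex_in_conv)
  then obtain b where b: "b \<in> X \<inter> ball x (\<delta>/2)" "b \<noteq> a"
    using \<open>infinite (X \<inter> ball x (\<delta>/2))\<close>
    by (metis finite.emptyI finite_insert insert_iff subsetI finite_subset)
  have "dist a b < \<delta>"
    using a b dist_triangle_half_r[of x a \<delta> b] by auto
  with a b sep \<open>X \<subseteq> Y\<close> show False by (fastforce simp: separated_def)
qed

lemma separated_countable:
  fixes Y :: "'a::euclidean_space set"
  assumes "separated \<delta> Y"
  shows "countable Y"
proof -
  have "Y = (\<Union>n::nat. Y \<inter> cball 0 (real n))"
    using real_arch_simple by fastforce
  moreover have "countable (Y \<inter> cball 0 (real n))" for n
    by (intro countable_finite separated_finite[OF assms]) (auto simp: bounded_subset[of "cball 0 (real n)"])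
  ultimately show ?thesis by (metis countable_UN countableI_type)
qed

section \<open>The integer lattice and its grid of cells\<close>

lemma separated_integer_lattice: "separated 1 (integer_lattice :: (real^'n) set)"
  unfolding separated_def
proof (intro conjI ballI impI)
  fix x y :: "real^'n" assume xy: "x \<in> integer_lattice" "y \<in> integer_lattice" "x \<noteq> y"
  then obtain i where i: "x $ i \<noteq> y $ i" by (auto simp: vec_eq_iff)
  have "x $ i - y $ i \<in> \<int>" using xy by (auto simp: integer_lattice_def)
  then have "1 \<le> \<bar>x $ i - y $ i\<bar>" using i Ints_nonzero_abs_ge1 by fastforce
  also have "\<dots> \<le> norm (x - y)" using component_le_norm_cart[of "x - y" i] by simp
  finally show "1 \<le> dist x y" by (simp add: dist_norm)
qed simp

text \<open>Half-open, so that the cells indexed by the integer lattice partition the space. The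
  index z is not the corner, which is \<open>h *\<^sub>R z\<close>.\<close>

definition grid_cell :: "real \<Rightarrow> real^'n \<Rightarrow> (real^'n) set" where
  "grid_cell h z = {x. \<forall>i. h * z $ i \<le> x $ i \<and> x $ i < h * (z $ i + 1)}"

lemma grid_cell_norm:
  assumes "0 < h" "x \<in> grid_cell h (z :: real^'n)"
  shows "norm (x - h *\<^sub>R z) \<le> h * CARD('n)"
proof -
  have "norm (x - h *\<^sub>R z) \<le> (\<Sum>i\<in>UNIV. \<bar>(x - h *\<^sub>R z) $ i\<bar>)" by (rule norm_le_l1_cart)
  also have "\<dots> \<le> (\<Sum>i\<in>(UNIV::'n set). h)"
  proof (rule sum_mono)
    fix i
    have "h * z $ i \<le> x $ i \<and> x $ i < h * (z $ i + 1)" using assms(2) by (simp add: grid_cell_def)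
    then show "\<bar>(x - h *\<^sub>R z) $ i\<bar> \<le> h" using \<open>0 < h\<close> by (auto simp: algebra_simps)
  qed
  finally show ?thesis by (simp add: mult.commute)
qed

lemma ex_grid_cell:
  assumes "0 < h"
  shows "\<exists>z\<in>integer_lattice. x \<in> grid_cell h z"
proof
  let ?z = "\<chi> i. of_int \<lfloor>x $ i / h\<rfloor>"
  show "?z \<in> integer_lattice" by (simp add: integer_lattice_def)
  have "h * of_int \<lfloor>x $ i / h\<rfloor> \<le> x $ i \<and> x $ i < h * (of_int \<lfloor>x $ i / h\<rfloor> + 1)" for i
  proof -
    have "of_int \<lfloor>x $ i / h\<rfloor> * h \<le> x $ i" "x $ i < (of_int \<lfloor>x $ i / h\<rfloor> + 1) * h"
      using assms by (simp_all add: pos_le_divide_eq[symmetric] pos_divide_less_eq[symmetric])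
    then show ?thesis by (simp add: mult.commute)
  qed
  then show "x \<in> grid_cell h ?z" by (simp add: grid_cell_def)
qed

lemma grid_cell_disjoint:
  assumes "0 < h" "z \<in> integer_lattice" "w \<in> integer_lattice" "z \<noteq> w"
  shows "grid_cell h z \<inter> grid_cell h w = {}"
proof (rule ccontr)
  assume "grid_cell h z \<inter> grid_cell h w \<noteq> {}"
  then obtain x where x: "x \<in> grid_cell h z" "x \<in> grid_cell h w" by auto
  have "z $ i = w $ i" for i
  proof -
    have "h * z $ i < h * (w $ i + 1)" "h * w $ i < h * (z $ i + 1)"
      using x by (auto simp: grid_cell_def intro: le_less_trans)
    then have "\<bar>z $ i - w $ i\<bar> < 1" using \<open>0 < h\<close> by (simp add: abs_if)
    moreover have "z $ i - w $ i \<in> \<int>" using assms by (auto simp: integer_lattice_def)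
    ultimately show ?thesis using Ints_nonzero_abs_less1 by fastforce
  qed
  with \<open>z \<noteq> w\<close> show False by (simp add: vec_eq_iff)
qed

lemma grid_cell_measurable [measurable]: "grid_cell h z \<in> sets borel"
proof -
  have "grid_cell h z = (\<Inter>i. {x. h * z $ i \<le> x $ i} \<inter> {x. x $ i < h * (z $ i + 1)})"
    by (auto simp: grid_cell_def)
  also have "\<dots> \<in> sets borel"
    by (intro sets.countable_INT'' sets.Int borel_closed borel_open
        closed_Collect_le open_Collect_less continuous_intros) auto
  finally show ?thesis .
qed

lemma emeasure_grid_cell:
  assumes "0 < h"
  shows "emeasure lborel (grid_cell h (z :: real^'n)) = ennreal (h ^ CARD('n))"
proof -
  let ?l = "h *\<^sub>R z" and ?u = "h *\<^sub>R (z + 1)"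
  have diff: "(?u - ?l) \<bullet> b = h" if "b \<in> Basis" for b
    using that by (auto simp: Basis_vec_def inner_axis algebra_simps)
  have le: "?l \<bullet> b \<le> ?u \<bullet> b" if "b \<in> Basis" for b
    using diff[OF that] assms unfolding inner_diff_left by linarith
  have pr: "(\<Prod>b\<in>Basis. (?u - ?l) \<bullet> b) = h ^ CARD('n)"
    using diff by simp
  have "box ?l ?u \<subseteq> grid_cell h z"
    by (auto simp: grid_cell_def mem_box_cart less_imp_le)
  then have "emeasure lborel (box ?l ?u) \<le> emeasure lborel (grid_cell h z)"
    by (rule emeasure_mono) simp
  moreover have "emeasure lborel (box ?l ?u) = ennreal (h ^ CARD('n))"
    using le pr by (subst emeasure_lborel_box) auto
  moreover have "grid_cell h z \<subseteq> cbox ?l ?u"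
    by (auto simp: grid_cell_def mem_box_cart less_imp_le)
  then have "emeasure lborel (grid_cell h z) \<le> emeasure lborel (cbox ?l ?u)"
    by (rule emeasure_mono) simp
  moreover have "emeasure lborel (cbox ?l ?u) = ennreal (h ^ CARD('n))"
    using le pr by (subst emeasure_lborel_cbox) auto
  ultimately show ?thesis by simp
qed

lemma emeasure_grid_cells:
  fixes h :: real
  assumes "0 < h" "finite B" "B \<subseteq> (integer_lattice :: (real^'n) set)"
  shows "emeasure lborel (\<Union>z\<in>B. grid_cell h z) = ennreal (card B * h ^ CARD('n))"
proof -
  have "disjoint_family_on (grid_cell h) B"
    unfolding disjoint_family_on_def using grid_cell_disjoint[OF assms(1)] assms(3) by blast
  then have "emeasure lborel (\<Union>z\<in>B. grid_cell h z) = (\<Sum>z\<in>B. emeasure lborel (grid_cell h z))"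
    using assms(2) by (intro sum_emeasure[symmetric]) auto
  also have "\<dots> = ennreal (card B * h ^ CARD('n))"
    using assms(1) by (simp add: emeasure_grid_cell ennreal_of_nat_eq_real_of_nat ennreal_mult)
  finally show ?thesis .
qed

lemma nn_integral_lborel_translate:
  fixes f :: "'a::euclidean_space \<Rightarrow> ennreal"
  assumes "f \<in> borel_measurable borel"
  shows "(\<integral>\<^sup>+x. f (x - y) \<partial>lborel) = (\<integral>\<^sup>+x. f x \<partial>lborel)"
proof -
  have "(\<integral>\<^sup>+x. f (x - y) \<partial>lborel) = (\<integral>\<^sup>+x. f x \<partial>distr lborel borel ((+) (- y)))"
    using assms by (subst nn_integral_distr) (auto simp: ac_simps)
  also have "distr lborel borel ((+) (- y)) = (lborel :: 'a measure)"
    by (rule lborel_distr_plus)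
  finally show ?thesis .
qed

lemma norm_triangle3:
  fixes a b c :: "'a::real_normed_vector"
  shows "norm (a + b + c) \<le> norm a + norm b + norm c"
  by (rule order_trans[OF norm_triangle_ineq add_right_mono[OF norm_triangle_ineq]])

text \<open>The measure with density f, pushed forward by S, agrees with \<rho> times Lebesgue
  measure up to e on bounded sets. Fixing the origin keeps the images of each point bounded along a
  sequence of such maps with the same C, which gives the compactness used below.\<close>

definition nearly_volume_preserving ::
  "real \<Rightarrow> real \<Rightarrow> real \<Rightarrow> ('a::euclidean_space \<Rightarrow> real) \<Rightarrow> ('a \<Rightarrow> 'a) \<Rightarrow> bool" where
  "nearly_volume_preserving C \<rho> e f S \<longleftrightarrow> S 0 = 0 \<and>
     (\<forall>x y. norm (S x - S y) \<le> C * norm (x - y) \<and> norm (x - y) \<le> C * norm (S x - S y)) \<and>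
     (\<forall>B\<in>sets borel. bounded B \<longrightarrow>
        ennreal (\<rho> - e) * emeasure lborel B \<le> (\<integral>\<^sup>+x. ennreal (f x) * indicator B (S x) \<partial>lborel) \<and>
        (\<integral>\<^sup>+x. ennreal (f x) * indicator B (S x) \<partial>lborel) \<le> ennreal (\<rho> + e) * emeasure lborel B)"

text \<open>Each point of Y carries one unit of mass in the ball of radius R around it, and each
  cell of side h holds one unit in the limit. Counting masses shows that finitely many points have
  at least as many cells nearby, and conversely. The resulting matching displaces the biLipschitz
  limit map by a bounded amount, which is harmless between separated sets.\<close>

theorem bilipschitz_integer_lattice_if_volume_preserving:
  fixes Y :: "(real^'n) set" and K :: "real^'n \<Rightarrow> real"
  assumes sep: "separated \<delta> Y"
    and K0: "\<And>x. 0 \<le> K x" and Kmeas: "K \<in> borel_measurable borel"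
    and Ksupp: "\<And>x. R < norm x \<Longrightarrow> K x = 0"
    and Kint: "(\<integral>\<^sup>+x. ennreal (K x) \<partial>lborel) = 1"
    and "0 < \<rho>" "0 < C" "0 \<le> R"
    and maps: "\<And>e. 0 < e \<Longrightarrow> \<exists>S. nearly_volume_preserving C \<rho> e (smear Y K) S"
  shows "bilipschitz_equivalent Y (integer_lattice :: (real^'n) set)"
proof -
  let ?Z = "integer_lattice :: (real^'n) set"
  let ?N = "CARD('n)"
  \<comment> \<open>With this side length a cell has mass one with respect to the limit density
    \<rho>.\<close>
  define h where "h = root ?N (1 / \<rho>)"
  have h: "0 < h" "\<rho> * h ^ ?N = 1"
    using \<open>0 < \<rho>\<close> by (auto simp: h_def)
  have sep0: "0 < \<delta>" and sepD: "\<And>x y. x \<in> Y \<Longrightarrow> y \<in> Y \<Longrightarrow> x \<noteq> y \<Longrightarrow> \<delta> \<le> norm (x - y)"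
    using sep by (auto simp: separated_def dist_norm)
  have "\<exists>S. nearly_volume_preserving C \<rho> (1 / real (Suc n)) (smear Y K) S" for n
    by (rule maps) simp
  then obtain S where S: "\<And>n. nearly_volume_preserving C \<rho> (1 / real (Suc n)) (smear Y K) (S n)" by metis
  have S0: "\<And>n. S n 0 = 0"
    and Slip: "\<And>n x y. norm (S n x - S n y) \<le> C * norm (x - y)"
    and Sinv: "\<And>n x y. norm (x - y) \<le> C * norm (S n x - S n y)"
    using S by (simp_all add: nearly_volume_preserving_def)
  have Slow: "ennreal (\<rho> - 1 / real (Suc n)) * emeasure lborel B
      \<le> (\<integral>\<^sup>+x. ennreal (smear Y K x) * indicator B (S n x) \<partial>lborel)"
    and Shigh: "(\<integral>\<^sup>+x. ennreal (smear Y K x) * indicator B (S n x) \<partial>lborel)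
      \<le> ennreal (\<rho> + 1 / real (Suc n)) * emeasure lborel B"
    if "B \<in> sets borel" "bounded B" for n B
    using S[of n] that unfolding nearly_volume_preserving_def by blast+
  have cY: "countable Y" using sep by (rule separated_countable)
  \<comment> \<open>Extracting one subsequence for all points of Y requires a bound uniform in y;
    dividing by 1 + norm y provides it, as \<open>S n 0 = 0\<close> gives norm (S n y) \<le> C norm
    y. The factor is multiplied back afterwards.\<close>
  obtain k where k: "strict_mono (k :: nat \<Rightarrow> nat)"
    and kl: "\<And>y. y \<in> Y \<Longrightarrow> \<exists>l. (\<lambda>n. S (k n) y /\<^sub>R (1 + norm y)) \<longlonglongrightarrow> l"
  proof (rule function_convergent_subsequence[OF cY, of "\<lambda>n y. S n y /\<^sub>R (1 + norm y)" C])
    fix n y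
    have "norm (S n y) \<le> C * norm y" using Slip[of n y 0] S0 by simp
    also have "\<dots> \<le> C * (1 + norm y)" using \<open>0 < C\<close> by simp
    finally show "norm (S n y /\<^sub>R (1 + norm y)) \<le> C"
      by (simp add: divide_inverse[symmetric] pos_divide_le_eq add_pos_nonneg mult.commute)
  qed blast
  have "\<exists>l. (\<lambda>n. S (k n) y) \<longlonglongrightarrow> l" if y: "y \<in> Y" for y
  proof -
    obtain l where "(\<lambda>n. S (k n) y /\<^sub>R (1 + norm y)) \<longlonglongrightarrow> l" using kl[OF y] by blast
    then have "(\<lambda>n. (1 + norm y) *\<^sub>R (S (k n) y /\<^sub>R (1 + norm y))) \<longlonglongrightarrow> (1 + norm y) *\<^sub>R l"
      by (intro tendsto_intros)
    moreover have "1 + norm y \<noteq> 0" using norm_ge_zero[of y] by linarith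
    ultimately show ?thesis by auto
  qed
  then obtain \<sigma> where \<sigma>: "\<And>y. y \<in> Y \<Longrightarrow> (\<lambda>n. S (k n) y) \<longlonglongrightarrow> \<sigma> y" by metis
  have \<sigma>lip: "norm (\<sigma> x - \<sigma> y) \<le> C * norm (x - y)" if "x \<in> Y" "y \<in> Y" for x y
  proof (rule LIMSEQ_le_const2)
    show "(\<lambda>n. norm (S (k n) x - S (k n) y)) \<longlonglongrightarrow> norm (\<sigma> x - \<sigma> y)"
      using \<sigma> that by (intro tendsto_intros)
  qed (use Slip in blast)
  have \<sigma>inv: "norm (x - y) \<le> C * norm (\<sigma> x - \<sigma> y)" if "x \<in> Y" "y \<in> Y" for x y
  proof (rule LIMSEQ_le_const)
    show "(\<lambda>n. C * norm (S (k n) x - S (k n) y)) \<longlonglongrightarrow> C * norm (\<sigma> x - \<sigma> y)"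
      using \<sigma> that by (intro tendsto_intros)
  qed (use Sinv in blast)
  have \<sigma>near: "\<forall>\<^sub>F n in sequentially. \<forall>y\<in>A. norm (S (k n) y - \<sigma> y) \<le> 1" if "finite A" "A \<subseteq> Y" for A
  proof (rule eventually_ball_finite[OF \<open>finite A\<close>], rule ballI)
    fix y assume "y \<in> A"
    then have "(\<lambda>n. S (k n) y) \<longlonglongrightarrow> \<sigma> y" using \<sigma> that by auto
    from tendstoD[OF this zero_less_one]
    show "\<forall>\<^sub>F n in sequentially. norm (S (k n) y - \<sigma> y) \<le> 1"
      by (rule eventually_mono) (simp add: dist_norm)
  qed
  have Scont: "continuous_on UNIV (S n)" for n
  proof (rule lipschitz_on_continuous_on)
    show "C-lipschitz_on UNIV (S n)"
      using Slip \<open>0 < C\<close> by (intro lipschitz_onI) (auto simp: dist_norm)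
  qed
  have [measurable]: "S n \<in> borel_measurable borel" for n
    using Scont by (rule borel_measurable_continuous_onI)
  note [measurable] = Kmeas
  \<comment> \<open>The summands bound the spread under S of a ball of radius R, the size of a cell,
    and the distance between \<open>S (k n)\<close> and its limit \<sigma> on the finitely many
    points considered.\<close>
  define R' where "R' = C * R + h * ?N + 1"
  have R'0: "0 < R'" using h \<open>0 < C\<close> \<open>0 \<le> R\<close> by (auto simp: R'_def intro!: add_nonneg_pos)
  define E where "E y z \<longleftrightarrow> norm (\<sigma> y - h *\<^sub>R z) \<le> R'" for y z
  have klim: "(\<lambda>n. (\<rho> + c * (1 / real (Suc (k n)))) * h ^ ?N) \<longlonglongrightarrow> 1" for c
  proof -
    have "(\<lambda>n. 1 / real (Suc n)) \<longlonglongrightarrow> 0" by (rule lim_1_over_n[THEN LIMSEQ_Suc])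
    from LIMSEQ_subseq_LIMSEQ[OF this k] have "(\<lambda>n. 1 / real (Suc (k n))) \<longlonglongrightarrow> 0" by (simp add: o_def)
    then have "(\<lambda>n. (\<rho> + c * (1 / real (Suc (k n)))) * h ^ ?N) \<longlonglongrightarrow> (\<rho> + c * 0) * h ^ ?N"
      by (intro tendsto_intros)
    then show ?thesis using h by simp
  qed
  have finE: "finite {z\<in>?Z. E y z}" for y
  proof (rule separated_finite[OF separated_integer_lattice])
    show "bounded {z\<in>?Z. E y z}"
      unfolding bounded_iff
    proof (intro exI ballI)
      fix z assume "z \<in> {z\<in>?Z. E y z}"
      then have "norm (h *\<^sub>R z) \<le> norm (\<sigma> y) + R'"
        using norm_triangle_sub[of "h *\<^sub>R z" "\<sigma> y"] by (auto simp: E_def norm_minus_commute)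
      then show "norm z \<le> (norm (\<sigma> y) + R') / h"
        using h by (simp add: field_simps)
    qed
  qed auto
  have finE': "finite {y\<in>Y. E y z}" for z
  proof (rule separated_finite[OF sep])
    have "norm (x - y) \<le> C * (2 * R')" if "x \<in> {y\<in>Y. E y z}" "y \<in> {y\<in>Y. E y z}" for x y
    proof -
      have "norm (\<sigma> x - \<sigma> y) \<le> 2 * R'"
        using that norm_triangle_ineq4[of "\<sigma> x - h *\<^sub>R z" "\<sigma> y - h *\<^sub>R z"] by (auto simp: E_def)
      moreover have "norm (x - y) \<le> C * norm (\<sigma> x - \<sigma> y)" using that \<sigma>inv by auto
      ultimately show ?thesis using \<open>0 < C\<close> by (meson mult_left_mono less_imp_le order_trans)
    qed
    then show "bounded {y\<in>Y. E y z}"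
      unfolding bounded_two_points dist_norm by blast
  qed auto
  \<comment> \<open>The unit masses around the points of A are carried into the cells indexed by N,
    whose mass under the pushforward exceeds card N by an arbitrarily small proportion. Letting n
    grow makes the inequality exact.\<close>
  have card1: "card A \<le> card (\<Union>y\<in>A. {z\<in>?Z. E y z})" if A: "A \<subseteq> Y" "finite A" for A
  proof -
    define N where "N = (\<Union>y\<in>A. {z\<in>?Z. E y z})"
    have N: "finite N" "N \<subseteq> ?Z" using A finE by (auto simp: N_def)
    have "\<forall>\<^sub>F n in sequentially. real (card A) \<le> (\<rho> + 1 * (1 / real (Suc (k n)))) * h ^ ?N * real (card N)"
      using \<sigma>near[OF A(2,1)]
    proof eventually_elim
      case (elim n)
      let ?S = "S (k n)"
      define U where "U = (\<Union>y\<in>A. cball y R)"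
      have "compact U" unfolding U_def using A by (intro compact_UN) auto
      then have cW: "compact (?S ` U)"
        by (intro compact_continuous_image continuous_on_subset[OF Scont]) auto
      then have W: "?S ` U \<in> sets borel" "bounded (?S ` U)"
        by (auto intro: borel_closed compact_imp_closed compact_imp_bounded)
      have sub: "?S ` U \<subseteq> (\<Union>z\<in>N. grid_cell h z)"
      proof (clarify)
        fix u assume "u \<in> U"
        then obtain y where y: "y \<in> A" "norm (y - u) \<le> R" by (auto simp: U_def dist_norm)
        obtain z where z: "z \<in> ?Z" "?S u \<in> grid_cell h z" using ex_grid_cell[OF h(1)] by blast
        have 1: "norm (?S u - h *\<^sub>R z) \<le> h * ?N" using grid_cell_norm[OF h(1) z(2)] .
        have "norm (?S y - ?S u) \<le> C * norm (y - u)" by (rule Slip)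
        also have "\<dots> \<le> C * R" using y \<open>0 < C\<close> by simp
        finally have 2: "norm (?S y - ?S u) \<le> C * R" .
        have 3: "norm (\<sigma> y - ?S y) \<le> 1" using elim y by (simp add: norm_minus_commute)
        have "\<sigma> y - h *\<^sub>R z = (\<sigma> y - ?S y) + (?S y - ?S u) + (?S u - h *\<^sub>R z)" by simp
        then have "norm (\<sigma> y - h *\<^sub>R z) \<le> norm (\<sigma> y - ?S y) + norm (?S y - ?S u) + norm (?S u - h *\<^sub>R z)"
          by (metis norm_triangle3)
        then have "E y z" using 1 2 3 by (simp add: E_def R'_def)
        then show "?S u \<in> (\<Union>z\<in>N. grid_cell h z)" using y z by (auto simp: N_def)
      qed
      have "ennreal (card A) = (\<Sum>y\<in>A. \<integral>\<^sup>+x. ennreal (K (x - y)) \<partial>lborel)"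
        using Kint by (simp add: nn_integral_lborel_translate[of "\<lambda>x. ennreal (K x)"] ennreal_of_nat_eq_real_of_nat)
      also have "\<dots> = (\<integral>\<^sup>+x. (\<Sum>y\<in>A. ennreal (K (x - y))) \<partial>lborel)"
        by (subst nn_integral_sum) auto
      also have "\<dots> \<le> (\<integral>\<^sup>+x. ennreal (smear Y K x) * indicator (?S ` U) (?S x) \<partial>lborel)"
      proof (rule nn_integral_mono)
        fix x
        show "(\<Sum>y\<in>A. ennreal (K (x - y))) \<le> ennreal (smear Y K x) * indicator (?S ` U) (?S x)"
        proof (cases "x \<in> U")
          case True
          have "finite {y\<in>Y. K (x - y) \<noteq> 0}"
          proof (rule separated_finite[OF sep])
            have "{y\<in>Y. K (x - y) \<noteq> 0} \<subseteq> cball x R"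
              using Ksupp by (auto simp: dist_norm) (meson not_le)
            then show "bounded {y\<in>Y. K (x - y) \<noteq> 0}" by (rule bounded_subset[OF bounded_cball])
          qed auto
          then have "(\<Sum>y\<in>{y\<in>A. K (x - y) \<noteq> 0}. K (x - y)) \<le> smear Y K x"
            unfolding smear_def using A K0 by (intro sum_mono2) auto
          also have "(\<Sum>y\<in>{y\<in>A. K (x - y) \<noteq> 0}. K (x - y)) = (\<Sum>y\<in>A. K (x - y))"
            using A by (intro sum.mono_neutral_left) auto
          finally show ?thesis using True K0 by (simp add: sum_ennreal ennreal_leI)
        next
          case False
          then have "K (x - y) = 0" if "y \<in> A" for y
            using that by (intro Ksupp) (auto simp: U_def dist_norm norm_minus_commute not_le)
          then show ?thesis by simp
        qed
      qed
      also have "\<dots> \<le> ennreal (\<rho> + 1 / real (Suc (k n))) * emeasure lborel (?S ` U)"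
        using W by (rule Shigh)
      also have "\<dots> \<le> ennreal (\<rho> + 1 / real (Suc (k n))) * emeasure lborel (\<Union>z\<in>N. grid_cell h z)"
        using N sub by (intro mult_left_mono emeasure_mono) auto
      also have "\<dots> = ennreal ((\<rho> + 1 / real (Suc (k n))) * (card N * h ^ ?N))"
        using N h \<open>0 < \<rho>\<close> by (subst emeasure_grid_cells) (auto simp: ennreal_mult)
      finally show ?case using \<open>0 < \<rho>\<close> h
        by (subst (asm) ennreal_le_iff) (auto simp: mult_ac)
    qed
    moreover have "(\<lambda>n. (\<rho> + 1 * (1 / real (Suc (k n)))) * h ^ ?N * real (card N)) \<longlonglongrightarrow> 1 * real (card N)"
      by (intro tendsto_mult klim tendsto_const)
    ultimately have "real (card A) \<le> 1 * real (card N)"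
      by (intro tendsto_lowerbound) auto
    then show ?thesis by (simp add: N_def)
  qed
  \<comment> \<open>Conversely, only the points of N contribute mass to the cells indexed by B, and
    by the lower volume bound these receive almost card B in total.\<close>
  have card2: "card B \<le> card (\<Union>z\<in>B. {y\<in>Y. E y z})" if B: "B \<subseteq> ?Z" "finite B" for B
  proof -
    define N where "N = (\<Union>z\<in>B. {y\<in>Y. E y z})"
    have N: "finite N" "N \<subseteq> Y" using B finE' by (auto simp: N_def)
    define V where "V = (\<Union>z\<in>B. grid_cell h z)"
    have V [measurable]: "V \<in> sets borel" using B by (auto simp: V_def)
    define b where "b = Max (insert 0 ((\<lambda>z. norm (h *\<^sub>R z)) ` B)) + h * ?N"
    have Vb: "norm v \<le> b" if v: "v \<in> V" for v
    proof -
      obtain z where z: "z \<in> B" "v \<in> grid_cell h z" using v by (auto simp: V_def)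
      have "norm v \<le> norm (h *\<^sub>R z) + norm (v - h *\<^sub>R z)" using norm_triangle_sub[of v "h *\<^sub>R z"] .
      also have "\<dots> \<le> b" unfolding b_def
        using B z grid_cell_norm[OF h(1) z(2)]
        by (intro add_mono Max_ge) (auto simp del: norm_scaleR)
      finally show ?thesis .
    qed
    then have bV: "bounded V" by (auto simp: bounded_iff)
    \<comment> \<open>Points of Y outside this ball are too far away to send mass into V, so
      closeness of \<open>S (k n)\<close> to \<sigma> is only needed on the finite set G.\<close>
    define G where "G = Y \<inter> cball 0 (C * b + R)"
    have G: "finite G" "G \<subseteq> Y"
      unfolding G_def by (intro separated_finite[OF sep]) (auto intro: bounded_subset[of "cball 0 (C * b + R)"])
    have "\<forall>\<^sub>F n in sequentially. (\<rho> + (-1) * (1 / real (Suc (k n)))) * h ^ ?N * real (card B) \<le> real (card N)"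
      using \<sigma>near[OF G]
    proof eventually_elim
      case (elim n)
      let ?S = "S (k n)"
      have far: "K (x - y) = 0" if x: "?S x \<in> V" and y: "y \<in> Y" "y \<notin> N" for x y
      proof (rule ccontr)
        assume "K (x - y) \<noteq> 0"
        then have xy: "norm (x - y) \<le> R" using Ksupp by (meson not_le)
        have "norm x \<le> C * norm (?S x)" using Sinv[of x 0 "k n"] S0 by simp
        also have "\<dots> \<le> C * b" using Vb[OF x] \<open>0 < C\<close> by simp
        finally have "norm y \<le> C * b + R" using xy norm_triangle_sub[of y x] by (simp add: norm_minus_commute)
        then have 3: "norm (\<sigma> y - ?S y) \<le> 1" using elim y by (simp add: G_def norm_minus_commute)
        obtain z where z: "z \<in> B" "?S x \<in> grid_cell h z" using x by (auto simp: V_def)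
        have 1: "norm (?S x - h *\<^sub>R z) \<le> h * ?N" using grid_cell_norm[OF h(1) z(2)] .
        have "norm (?S y - ?S x) \<le> C * norm (y - x)" by (rule Slip)
        also have "\<dots> \<le> C * R" using xy \<open>0 < C\<close> by (simp add: norm_minus_commute)
        finally have 2: "norm (?S y - ?S x) \<le> C * R" .
        have "\<sigma> y - h *\<^sub>R z = (\<sigma> y - ?S y) + (?S y - ?S x) + (?S x - h *\<^sub>R z)" by simp
        then have "norm (\<sigma> y - h *\<^sub>R z) \<le> norm (\<sigma> y - ?S y) + norm (?S y - ?S x) + norm (?S x - h *\<^sub>R z)"
          by (metis norm_triangle3)
        then have "E y z" using 1 2 3 by (simp add: E_def R'_def)
        then show False using y z by (auto simp: N_def)
      qed
      have "ennreal (\<rho> - 1 / real (Suc (k n))) * ennreal (card B * h ^ ?N)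
          = ennreal (\<rho> - 1 / real (Suc (k n))) * emeasure lborel V"
        unfolding V_def using B h by (subst emeasure_grid_cells) auto
      also have "\<dots> \<le> (\<integral>\<^sup>+x. ennreal (smear Y K x) * indicator V (?S x) \<partial>lborel)"
        using V bV by (rule Slow)
      also have "\<dots> \<le> (\<integral>\<^sup>+x. (\<Sum>y\<in>N. ennreal (K (x - y))) \<partial>lborel)"
      proof (rule nn_integral_mono)
        fix x
        have "smear Y K x = (\<Sum>y\<in>N. K (x - y))" if "?S x \<in> V"
          using N far[OF that] by (intro smear_eq) auto
        then show "ennreal (smear Y K x) * indicator V (?S x) \<le> (\<Sum>y\<in>N. ennreal (K (x - y)))"
          using K0 by (auto simp: indicator_def sum_ennreal)
      qed
      also have "\<dots> = (\<Sum>y\<in>N. \<integral>\<^sup>+x. ennreal (K (x - y)) \<partial>lborel)"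
        by (subst nn_integral_sum) auto
      also have "\<dots> = ennreal (card N)"
        using Kint by (simp add: nn_integral_lborel_translate[of "\<lambda>x. ennreal (K x)"] ennreal_of_nat_eq_real_of_nat)
      finally have *: "ennreal (\<rho> - 1 / real (Suc (k n))) * ennreal (card B * h ^ ?N) \<le> ennreal (card N)" .
      \<comment> \<open>\<open>ennreal\<close> cuts negative numbers off at 0, so the real
        inequality can be read off only when \<rho> - 1 / Suc (k n) is nonnegative; otherwise its
        left-hand side is nonpositive anyway.\<close>
      show ?case
      proof (cases "\<rho> - 1 / real (Suc (k n)) \<ge> 0")
        case True
        with * h show ?thesis
          by (subst (asm) ennreal_mult[symmetric]) (auto simp: mult_ac)
      next
        case False
        then have "(\<rho> + (-1) * (1 / real (Suc (k n)))) * h ^ ?N * real (card B) \<le> 0"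
          using h by (intro mult_nonpos_nonneg) auto
        then show ?thesis by (rule order_trans) simp
      qed
    qed
    moreover have "(\<lambda>n. (\<rho> + (-1) * (1 / real (Suc (k n)))) * h ^ ?N * real (card B)) \<longlonglongrightarrow> 1 * real (card B)"
      by (intro tendsto_mult klim tendsto_const)
    ultimately have "1 * real (card B) \<le> real (card N)"
      by (intro tendsto_upperbound) auto
    then show ?thesis by (simp add: N_def)
  qed
  have "hall_cond Y (\<lambda>y. {z\<in>?Z. E y z})" "hall_cond ?Z (\<lambda>z. {y\<in>Y. E y z})"
    using finE finE' card1 card2 by (auto simp: hall_cond_def)
  then obtain \<phi> where bij: "bij_betw \<phi> Y ?Z" and \<phi>: "\<And>y. y \<in> Y \<Longrightarrow> E y (\<phi> y)"
    by (rule hall_perfect_matching) blast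
  \<comment> \<open>The additive error 2 R' is absorbed into a multiple of norm (x - y), which is at
    least \<delta> for distinct points. For the inverse map the separation of the integer lattice
    serves the same purpose.\<close>
  have "norm (\<phi> x - \<phi> y) \<le> (C + 2 * R' / \<delta>) / h * norm (x - y)" if xy: "x \<in> Y" "y \<in> Y" for x y
  proof (cases "x = y")
    case False
    have "h *\<^sub>R (\<phi> x - \<phi> y) = (\<sigma> x - \<sigma> y) + (h *\<^sub>R \<phi> x - \<sigma> x) + (\<sigma> y - h *\<^sub>R \<phi> y)"
      by (simp add: algebra_simps)
    then have "norm (h *\<^sub>R (\<phi> x - \<phi> y)) \<le> norm (\<sigma> x - \<sigma> y) + norm (h *\<^sub>R \<phi> x - \<sigma> x) + norm (\<sigma> y - h *\<^sub>R \<phi> y)"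
      by (metis norm_triangle3)
    also have "\<dots> \<le> C * norm (x - y) + R' + R'"
      using \<sigma>lip \<phi> xy by (intro add_mono) (auto simp: E_def norm_minus_commute)
    also have "\<dots> \<le> C * norm (x - y) + 2 * R' / \<delta> * norm (x - y)"
      using sepD[OF xy False] sep0 R'0 by (simp add: field_simps)
    finally have "h * norm (\<phi> x - \<phi> y) \<le> (C + 2 * R' / \<delta>) * norm (x - y)"
      using h by (simp add: distrib_right)
    then show ?thesis using h by (simp add: field_simps)
  qed simp
  then have "\<exists>C. C-lipschitz_on Y \<phi>"
    using h R'0 sep0 \<open>0 < C\<close>
    by (intro exI[of _ "(C + 2 * R' / \<delta>) / h"] lipschitz_onI) (auto simp: dist_norm)
  moreover have "norm (inv_into Y \<phi> z - inv_into Y \<phi> w) \<le> C * (h + 2 * R') * norm (z - w)"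
    if zw: "z \<in> ?Z" "w \<in> ?Z" for z w
  proof (cases "z = w")
    case False
    define x y where "x = inv_into Y \<phi> z" and "y = inv_into Y \<phi> w"
    have xy: "x \<in> Y" "y \<in> Y" "\<phi> x = z" "\<phi> y = w"
      using bij zw unfolding x_def y_def by (auto simp: bij_betw_def inv_into_into f_inv_into_f)
    have zw1: "1 \<le> norm (z - w)"
      using separated_integer_lattice zw False by (auto simp: separated_def dist_norm)
    have "\<sigma> x - \<sigma> y = h *\<^sub>R (z - w) + (\<sigma> x - h *\<^sub>R z) + (h *\<^sub>R w - \<sigma> y)"
      by (simp add: algebra_simps)
    then have "norm (\<sigma> x - \<sigma> y) \<le> norm (h *\<^sub>R (z - w)) + norm (\<sigma> x - h *\<^sub>R z) + norm (h *\<^sub>R w - \<sigma> y)"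
      by (metis norm_triangle3)
    also have "\<dots> \<le> h * norm (z - w) + R' + R'"
      using \<phi> xy h by (intro add_mono) (auto simp: E_def norm_minus_commute)
    also have "\<dots> \<le> (h + 2 * R') * norm (z - w)"
      using zw1 R'0 by (simp add: algebra_simps)
    finally have "C * norm (\<sigma> x - \<sigma> y) \<le> C * ((h + 2 * R') * norm (z - w))"
      using \<open>0 < C\<close> by simp
    with \<sigma>inv[OF xy(1,2)] show ?thesis by (simp add: x_def y_def mult.assoc)
  qed simp
  then have "\<exists>C. C-lipschitz_on ?Z (inv_into Y \<phi>)"
    using h R'0 \<open>0 < C\<close>
    by (intro exI[of _ "C * (h + 2 * R')"] lipschitz_onI) (auto simp: dist_norm)
  ultimately show ?thesis using bij by (auto simp: bilipschitz_equivalent_def)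
qed

section \<open>Transport of densities by shears\<close>

lemma ex_primitive_real:
  fixes f :: "real \<Rightarrow> real"
  assumes "continuous_on UNIV f"
  shows "\<exists>F. F 0 = 0 \<and> (\<forall>t. (F has_real_derivative f t) (at t))"
proof -
  have "\<exists>F. \<forall>x::real. -\<infinity> < ereal x \<longrightarrow> ereal x < \<infinity> \<longrightarrow> (F has_vector_derivative f x) (at x)"
    using assms by (intro einterval_antiderivative) (auto simp: continuous_on_eq_continuous_at)
  then obtain F where F: "\<And>x. (F has_real_derivative f x) (at x)"
    by (auto simp: has_real_derivative_iff_has_vector_derivative)
  show ?thesis
    by (rule exI[of _ "\<lambda>t. F t - F 0"]) (auto intro!: derivative_eq_intros F)
qed

lemma DERIV_imp_continuous_on:
  "(\<And>t. (F has_real_derivative f t) (at t)) \<Longrightarrow> continuous_on S F"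
  by (meson DERIV_isCont continuous_at_imp_continuous_on)

lemma increment_ge:
  fixes F :: "real \<Rightarrow> real"
  assumes "\<And>t. (F has_real_derivative f t) (at t)" "\<And>t. m \<le> f t" "s \<le> t"
  shows "m * (t - s) \<le> F t - F s"
proof -
  have "F s - m * s \<le> F t - m * t"
    using assms by (intro DERIV_nonneg_imp_nondecreasing[of s t "\<lambda>t. F t - m * t"])
      (auto intro!: derivative_eq_intros exI)
  then show ?thesis by (simp add: algebra_simps)
qed

lemma surj_if_derivative_ge:
  fixes F :: "real \<Rightarrow> real"
  assumes F: "\<And>t. (F has_real_derivative f t) (at t)" and f: "\<And>t. m \<le> f t" and "0 < m"
  shows "surj F"
proof -
  have "\<exists>t. F t = y" for y
  proof -
    define s where "s = \<bar>y - F 0\<bar> / m"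
    have s: "0 \<le> s" "m * s = \<bar>y - F 0\<bar>" using \<open>0 < m\<close> by (auto simp: s_def)
    have 1: "y \<le> F s" using increment_ge[OF F f s(1)] s by simp
    have 2: "F (- s) \<le> y" using increment_ge[OF F f, of "- s" 0] s by simp
    have "continuous_on {- s..s} F"
      using F by (rule DERIV_imp_continuous_on)
    with IVT'[of F "- s" y s] 1 2 s show ?thesis by auto
  qed
  then show ?thesis by (metis surjI)
qed

lemma strict_mono_if_derivative_ge:
  fixes F :: "real \<Rightarrow> real"
  assumes F: "\<And>t. (F has_real_derivative f t) (at t)" and f: "\<And>t. m \<le> f t" and "0 < m"
  shows "strict_mono F"
proof (rule strict_monoI)
  fix s t :: real assume "s < t"
  then have "0 < m * (t - s)" using \<open>0 < m\<close> by simp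
  with increment_ge[OF F f, of s t] \<open>s < t\<close> show "F s < F t" by simp
qed

text \<open>F is an increasing bijection of the line, and by the fundamental theorem of calculus the
  measure with density f gives the preimage of the interval from F a to F b the mass F b - F a.
  Hence its image under F is Lebesgue measure.\<close>

lemma nn_integral_substitution_real_line:
  fixes F f :: "real \<Rightarrow> real"
  assumes F: "\<And>t. (F has_real_derivative f t) (at t)" and f: "\<And>t. m \<le> f t" and "0 < m"
    and fmeas [measurable]: "f \<in> borel_measurable borel"
    and [measurable]: "g \<in> borel_measurable borel"
  shows "(\<integral>\<^sup>+t. g (F t) * ennreal (f t) \<partial>lborel) = (\<integral>\<^sup>+u. g u \<partial>lborel)"
proof -
  have surj: "surj F" using surj_if_derivative_ge[OF F f \<open>0 < m\<close>] .
  have sm: "strict_mono F" using strict_mono_if_derivative_ge[OF F f \<open>0 < m\<close>] .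
  have [measurable]: "F \<in> borel_measurable borel"
    using sm by (intro borel_measurable_mono strict_mono_mono)
  have "lborel = distr (density lborel (\<lambda>t. ennreal (f t))) borel F"
  proof (rule lborel_eqI)
    fix l u :: real assume "\<And>b. b \<in> Basis \<Longrightarrow> l \<bullet> b \<le> u \<bullet> b"
    then have lu: "l \<le> u" by auto
    obtain a b where ab: "F a = l" "F b = u" using surj by (metis surjD)
    have "a \<le> b" using lu sm ab by (metis strict_mono_less_eq)
    have vim: "F -` {l<..<u} = {a<..<b}"
      using sm ab by (auto simp: strict_mono_less)
    have "emeasure (distr (density lborel (\<lambda>t. ennreal (f t))) borel F) (box l u)
        = (\<integral>\<^sup>+t. ennreal (f t) * indicator {a<..<b} t \<partial>lborel)"
      by (simp add: emeasure_distr vim emeasure_density)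
    also have "\<dots> = (\<integral>\<^sup>+t. ennreal (f t) * indicator {a..b} t \<partial>lborel)"
    proof (rule nn_integral_cong_AE)
      show "AE t in lborel. ennreal (f t) * indicator {a<..<b} t = ennreal (f t) * indicator {a..b} t"
        using AE_lborel_singleton[of a] AE_lborel_singleton[of b]
        by eventually_elim (auto simp: indicator_def)
    qed
    also have "\<dots> = ennreal (F b - F a)"
      using F f \<open>0 < m\<close> \<open>a \<le> b\<close> by (intro nn_integral_FTC_Icc) (auto intro: order_trans[of 0 m])
    finally show "emeasure (distr (density lborel (\<lambda>t. ennreal (f t))) borel F) (box l u)
        = (\<Prod>b\<in>Basis. (u - l) \<bullet> b)" using ab by simp
  qed simp
  then have "(\<integral>\<^sup>+u. g u \<partial>lborel) = (\<integral>\<^sup>+u. g u \<partial>distr (density lborel (\<lambda>t. ennreal (f t))) borel F)"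
    by simp
  also have "\<dots> = (\<integral>\<^sup>+t. g (F t) * ennreal (f t) \<partial>lborel)"
    by (simp add: nn_integral_distr nn_integral_density mult.commute)
  finally show ?thesis ..
qed

text \<open>Fubini along the lines in direction b, on each of which a shear acts separately.\<close>

lemma nn_integral_lborel_lines:
  fixes g :: "'a::euclidean_space \<Rightarrow> ennreal"
  assumes [measurable]: "g \<in> borel_measurable borel" and b: "b \<in> Basis"
  shows "(\<integral>\<^sup>+x. g x \<partial>lborel) =
    (\<integral>\<^sup>+y. (\<integral>\<^sup>+t. g ((\<Sum>c\<in>Basis - {b}. y c *\<^sub>R c) + t *\<^sub>R b) \<partial>lborel) \<partial>(\<Pi>\<^sub>M c\<in>Basis - {b}. lborel))"
proof -
  interpret product_sigma_finite "\<lambda>_::'a. lborel :: real measure" ..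
  have ins: "insert b (Basis - {b}) = Basis" using b by auto
  have [measurable]: "(\<lambda>y. g (\<Sum>c\<in>Basis. y c *\<^sub>R c)) \<in> borel_measurable (\<Pi>\<^sub>M c\<in>Basis. (lborel :: real measure))"
    by measurable
  have "(\<integral>\<^sup>+x. g x \<partial>lborel) = (\<integral>\<^sup>+y. g (\<Sum>c\<in>Basis. y c *\<^sub>R c) \<partial>(\<Pi>\<^sub>M c\<in>insert b (Basis - {b}). lborel))"
    unfolding ins by (subst lborel_eq) (simp add: nn_integral_distr)
  also have "\<dots> = (\<integral>\<^sup>+y. (\<integral>\<^sup>+t. g (\<Sum>c\<in>Basis. (y(b := t)) c *\<^sub>R c) \<partial>lborel) \<partial>(\<Pi>\<^sub>M c\<in>Basis - {b}. lborel))"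
    by (subst product_nn_integral_insert) (auto simp: ins)
  also have "\<dots> = (\<integral>\<^sup>+y. (\<integral>\<^sup>+t. g ((\<Sum>c\<in>Basis - {b}. y c *\<^sub>R c) + t *\<^sub>R b) \<partial>lborel) \<partial>(\<Pi>\<^sub>M c\<in>Basis - {b}. lborel))"
  proof (intro nn_integral_cong arg_cong[of _ _ g])
    fix y :: "'a \<Rightarrow> real" and t :: real
    have "(\<Sum>c\<in>Basis. (y(b := t)) c *\<^sub>R c) = t *\<^sub>R b + (\<Sum>c\<in>Basis - {b}. (y(b := t)) c *\<^sub>R c)"
      using b by (subst sum.remove[of _ b]) auto
    also have "(\<Sum>c\<in>Basis - {b}. (y(b := t)) c *\<^sub>R c) = (\<Sum>c\<in>Basis - {b}. y c *\<^sub>R c)"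
      by (intro sum.cong) auto
    finally show "(\<Sum>c\<in>Basis. (y(b := t)) c *\<^sub>R c) = (\<Sum>c\<in>Basis - {b}. y c *\<^sub>R c) + t *\<^sub>R b"
      by simp
  qed
  finally show ?thesis .
qed

lemma bounded_derivative_increment:
  fixes F :: "real \<Rightarrow> real"
  assumes "\<And>t. (F has_real_derivative f t) (at t)" "\<And>t. \<bar>f t\<bar> \<le> K"
  shows "\<bar>F t - F s\<bar> \<le> K * \<bar>t - s\<bar>"
  using field_differentiable_bound[of UNIV F f K t s] assms by (simp add: has_field_derivative_at_within)

text \<open>Solving \<open>\<integral>\<^sub>0\<^sup>D f' (x + \<tau> b) d\<tau> = v x\<close> for the displacement \<open>D x\<close> transports the density
  \<open>f = f' + \<partial>\<^sub>b v\<close> to \<open>f'\<close> along each line in direction \<open>b\<close>.\<close>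

lemma shear_transport:
  fixes f f' v :: "'a::euclidean_space \<Rightarrow> real"
  assumes b: "b \<in> Basis" and "0 < m"
    and cont: "continuous_on UNIV f" "continuous_on UNIV f'"
    and low: "\<And>x. m \<le> f x" "\<And>x. m \<le> f' x"
    and vd: "\<And>x t. ((\<lambda>t. v (x + t *\<^sub>R b)) has_real_derivative (f (x + t *\<^sub>R b) - f' (x + t *\<^sub>R b))) (at t)"
    and v: "\<And>x. \<bar>v x\<bar> \<le> V" and vlip: "\<And>x y. \<bar>v x - v y\<bar> \<le> \<kappa> * norm (x - y)"
    and flip: "\<And>x y. \<bar>f' x - f' y\<bar> \<le> \<sigma> * norm (x - y)"
    and \<delta>: "\<delta> = (\<kappa> + V / m * \<sigma>) / m"
  obtains T where "\<And>x y. norm (T x - T y) \<le> (1 + \<delta>) * norm (x - y)"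
    and "\<And>x y. (1 - \<delta>) * norm (x - y) \<le> norm (T x - T y)"
    and "\<And>g. g \<in> borel_measurable borel \<Longrightarrow>
      (\<integral>\<^sup>+x. g (T x) * ennreal (f x) \<partial>lborel) = (\<integral>\<^sup>+x. g x * ennreal (f' x) \<partial>lborel)"
proof -
  have [measurable]: "f \<in> borel_measurable borel" "f' \<in> borel_measurable borel"
    using cont by (auto intro: borel_measurable_continuous_onI)
  have "0 \<le> V" using v[of 0] by linarith
  have nb: "norm b = 1" using b by simp
  have line: "continuous_on UNIV (\<lambda>s. x + s *\<^sub>R b)" for x by (intro continuous_intros)
  have cl: "continuous_on UNIV (\<lambda>s. f' (x + s *\<^sub>R b))" for x
    by (rule continuous_on_compose2[OF cont(2) line]) auto
  have cl': "continuous_on UNIV (\<lambda>s. f (x + s *\<^sub>R b))" for x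
    by (rule continuous_on_compose2[OF cont(1) line]) auto
  \<comment> \<open>\<open>P x s\<close> is the signed integral of f' over the segment from x to x +
    s b, so the equation for the displacement reads P x (D x) = v x.\<close>
  have "\<forall>x. \<exists>F. F 0 = 0 \<and> (\<forall>s. (F has_real_derivative f' (x + s *\<^sub>R b)) (at s))"
    by (intro allI ex_primitive_real cl)
  from choice[OF this] obtain P where P0: "\<And>x. P x 0 = 0"
    and P: "\<And>x s. (P x has_real_derivative f' (x + s *\<^sub>R b)) (at s)" by auto
  have Pge: "m * (t - s) \<le> P x t - P x s" if "s \<le> t" for x s t
    by (rule increment_ge[OF P _ that]) (rule low)
  \<comment> \<open>Since f' \<ge> m, the values of \<open>P x\<close> at - V / m and V / m enclose
    \<open>v x\<close>, and the intermediate value theorem applies.\<close>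
  have "\<exists>s. \<bar>s\<bar> \<le> V / m \<and> P x s = v x" for x
  proof -
    have "V \<le> P x (V / m)" using Pge[of 0 "V / m" x] P0 \<open>0 < m\<close> \<open>0 \<le> V\<close> by simp
    then have 1: "v x \<le> P x (V / m)" using v[of x] by linarith
    have "P x (- (V / m)) \<le> - V" using Pge[of "- (V / m)" 0 x] P0 \<open>0 < m\<close> \<open>0 \<le> V\<close> by simp
    then have 2: "P x (- (V / m)) \<le> v x" using v[of x] by linarith
    have "continuous_on {- (V / m)..V / m} (P x)"
      using P by (rule DERIV_imp_continuous_on)
    moreover have "- (V / m) \<le> V / m" using \<open>0 < m\<close> \<open>0 \<le> V\<close> by simp
    ultimately obtain s where "- (V / m) \<le> s" "s \<le> V / m" "P x s = v x"
      using IVT'[of "P x" "- (V / m)" "v x" "V / m"] 1 2 by blast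
    then show ?thesis by (intro exI[of _ s]) linarith
  qed
  then have "\<forall>x. \<exists>s. \<bar>s\<bar> \<le> V / m \<and> P x s = v x" by blast
  from choice[OF this] obtain D where D: "\<And>x. \<bar>D x\<bar> \<le> V / m" "\<And>x. P x (D x) = v x" by blast
  have Pinj: "m * \<bar>t - s\<bar> \<le> \<bar>P x t - P x s\<bar>" for x s t
  proof (cases "s \<le> t")
    case True
    then have "m * (t - s) \<le> P x t - P x s" by (rule Pge)
    then show ?thesis using True by (simp add: abs_of_nonneg)
  next
    case False
    then have "m * (s - t) \<le> P x s - P x t" by (intro Pge) simp
    then show ?thesis using False by (simp add: abs_of_neg)
  qed
  \<comment> \<open>Moving the base point changes the equation for D twice: its right-hand side by
    at most \<kappa> norm (x - y), and its primitive, whose derivative changes by at most \<sigma>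
    norm (x - y) on a segment of length at most V / m. Dividing by the slope m gives
    \<delta>.\<close>
  have Dlip: "\<bar>D x - D y\<bar> \<le> \<delta> * norm (x - y)" for x y
  proof -
    have "\<bar>(P y (D y) - P x (D y)) - (P y 0 - P x 0)\<bar> \<le> \<sigma> * norm (y - x) * \<bar>D y - 0\<bar>"
    proof (rule bounded_derivative_increment)
      fix t
      show "((\<lambda>s. P y s - P x s) has_real_derivative f' (y + t *\<^sub>R b) - f' (x + t *\<^sub>R b)) (at t)"
        by (intro derivative_intros P)
      show "\<bar>f' (y + t *\<^sub>R b) - f' (x + t *\<^sub>R b)\<bar> \<le> \<sigma> * norm (y - x)"
        using flip[of "y + t *\<^sub>R b" "x + t *\<^sub>R b"] by simp
    qed
    then have "\<bar>P y (D y) - P x (D y)\<bar> \<le> \<sigma> * norm (y - x) * \<bar>D y\<bar>" by (simp add: P0)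
    also have "\<dots> \<le> \<sigma> * norm (y - x) * (V / m)"
      using D(1)[of y] flip[of x y] flip[of y x]
      by (intro mult_left_mono) (auto simp: norm_minus_commute intro: order_trans[OF abs_ge_zero])
    finally have 1: "\<bar>P y (D y) - P x (D y)\<bar> \<le> V / m * \<sigma> * norm (x - y)"
      by (simp add: norm_minus_commute mult_ac)
    have "m * \<bar>D x - D y\<bar> \<le> \<bar>P x (D x) - P x (D y)\<bar>" by (rule Pinj)
    also have "\<dots> \<le> \<bar>v x - v y\<bar> + \<bar>P y (D y) - P x (D y)\<bar>" using D(2) by simp
    also have "\<dots> \<le> \<kappa> * norm (x - y) + V / m * \<sigma> * norm (x - y)"
      using vlip 1 by (rule add_mono)
    also have "\<dots> = m * \<delta> * norm (x - y)"
      using \<open>0 < m\<close> by (simp add: \<delta> distrib_right)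
    finally have "m * \<bar>D x - D y\<bar> \<le> m * (\<delta> * norm (x - y))" by (simp only: mult.assoc)
    then show ?thesis using \<open>0 < m\<close> by simp
  qed
  define T where "T x = x + D x *\<^sub>R b" for x
  have Tdiff: "T x - T y = (x - y) + (D x - D y) *\<^sub>R b" for x y
    by (simp add: T_def algebra_simps)
  have nD: "norm ((D x - D y) *\<^sub>R b) = \<bar>D x - D y\<bar>" for x y using nb by simp
  have T1: "norm (T x - T y) \<le> (1 + \<delta>) * norm (x - y)" for x y
    using norm_triangle_ineq[of "x - y" "(D x - D y) *\<^sub>R b"] Dlip[of x y] nD[of x y]
    unfolding Tdiff distrib_right by linarith
  have T2: "(1 - \<delta>) * norm (x - y) \<le> norm (T x - T y)" for x y
    using norm_diff_ineq[of "x - y" "(D x - D y) *\<^sub>R b"] Dlip[of x y] nD[of x y]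
    unfolding Tdiff left_diff_distrib by linarith
  have Tcont: "continuous_on UNIV T"
  proof (rule lipschitz_on_continuous_on)
    show "(1 + \<bar>\<delta>\<bar>)-lipschitz_on UNIV T"
    proof (rule lipschitz_onI)
      fix x y
      have "norm (T x - T y) \<le> (1 + \<delta>) * norm (x - y)" by (rule T1)
      also have "\<dots> \<le> (1 + \<bar>\<delta>\<bar>) * norm (x - y)" by (intro mult_right_mono) auto
      finally show "dist (T x) (T y) \<le> (1 + \<bar>\<delta>\<bar>) * dist x y" by (simp add: dist_norm)
    qed simp
  qed
  then have [measurable]: "T \<in> borel_measurable borel" by (rule borel_measurable_continuous_onI)
  have push: "(\<integral>\<^sup>+x. g (T x) * ennreal (f x) \<partial>lborel) = (\<integral>\<^sup>+x. g x * ennreal (f' x) \<partial>lborel)"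
    if [measurable]: "g \<in> borel_measurable borel" for g
  proof -
    have "(\<integral>\<^sup>+t. g (T (z + t *\<^sub>R b)) * ennreal (f (z + t *\<^sub>R b)) \<partial>lborel)
        = (\<integral>\<^sup>+t. g (z + t *\<^sub>R b) * ennreal (f' (z + t *\<^sub>R b)) \<partial>lborel)" for z
    proof -
      \<comment> \<open>On the line through z, R is a primitive of f and \<open>P z\<close> one of
        f'. The change of base point \<open>shift\<close> turns the equation for D into P z (F t) =
        R t. So F is R followed by the inverse G of \<open>P z\<close>, and both sides of the claim
        are substitutions into one integral over the variable u = R t = P z (F t).\<close>
      define R where "R t = P z t + v (z + t *\<^sub>R b)" for t
      define F where "F t = t + D (z + t *\<^sub>R b)" for t
      define G where "G = inv (P z)"
      have shift: "P z (t + s) - P z t = P (z + t *\<^sub>R b) s" for s t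
      proof -
        have "((\<lambda>s. P z (t + s) - P (z + t *\<^sub>R b) s) has_real_derivative 0) (at s)" for s
        proof -
          have "((\<lambda>s. P z (t + s)) has_real_derivative f' (z + (t + s) *\<^sub>R b)) (at s)"
            using P[of z "t + s"] by (simp add: DERIV_shift add.commute)
          from DERIV_diff[OF this P[of "z + t *\<^sub>R b" s]] show ?thesis
            by (simp add: algebra_simps)
        qed
        then have "P z (t + s) - P (z + t *\<^sub>R b) s = P z (t + 0) - P (z + t *\<^sub>R b) 0"
          using DERIV_isconst_all[of "\<lambda>s. P z (t + s) - P (z + t *\<^sub>R b) s" s 0] by blast
        then show ?thesis by (simp add: P0)
      qed
      have QF: "P z (F t) = R t" for t
        using shift[of t "D (z + t *\<^sub>R b)"] D(2) by (simp add: F_def R_def)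
      have sm: "strict_mono (P z)" "surj (P z)"
        using strict_mono_if_derivative_ge[OF P low(2) \<open>0 < m\<close>] surj_if_derivative_ge[OF P low(2) \<open>0 < m\<close>]
        by blast+
      have GP: "G (P z t) = t" for t
        using sm by (simp add: G_def strict_mono_imp_inj_on inv_f_f)
      have PG: "P z (G u) = u" for u
        using sm by (simp add: G_def surj_f_inv_f)
      have "mono G"
        using sm PG by (intro monoI) (metis strict_mono_less_eq)
      then have [measurable]: "G \<in> borel_measurable borel" by (rule borel_measurable_mono)
      have GR: "G (R t) = F t" for t using GP[of "F t"] QF by simp
      have R': "(R has_real_derivative f (z + t *\<^sub>R b)) (at t)" for t
        unfolding R_def using DERIV_add[OF P[of z t] vd[of z t]] by simp
      have [measurable]: "(\<lambda>t. f (z + t *\<^sub>R b)) \<in> borel_measurable borel"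
        "(\<lambda>t. f' (z + t *\<^sub>R b)) \<in> borel_measurable borel"
        using cl cl' by (auto intro: borel_measurable_continuous_onI)
      have [measurable]: "(\<lambda>u. g (z + G u *\<^sub>R b)) \<in> borel_measurable borel"
        by measurable
      have "(\<integral>\<^sup>+t. g (T (z + t *\<^sub>R b)) * ennreal (f (z + t *\<^sub>R b)) \<partial>lborel)
        = (\<integral>\<^sup>+t. g (z + G (R t) *\<^sub>R b) * ennreal (f (z + t *\<^sub>R b)) \<partial>lborel)"
        by (simp add: GR T_def F_def algebra_simps)
      also have "\<dots> = (\<integral>\<^sup>+u. g (z + G u *\<^sub>R b) \<partial>lborel)"
        by (rule nn_integral_substitution_real_line[OF R' low(1) \<open>0 < m\<close>]) measurable
      also have "\<dots> = (\<integral>\<^sup>+t. g (z + G (P z t) *\<^sub>R b) * ennreal (f' (z + t *\<^sub>R b)) \<partial>lborel)"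
        by (rule nn_integral_substitution_real_line[OF P low(2) \<open>0 < m\<close>, symmetric]) measurable
      finally show ?thesis by (simp add: GP)
    qed
    then show ?thesis
      by (subst (1 2) nn_integral_lborel_lines[OF _ b]) measurable
  qed
  from T1 T2 push show ?thesis by (rule that)
qed

section \<open>Smoothing kernels\<close>

text \<open>Bounded functions with bounded and Lipschitz gradient, expressed through differences so
  that no derivative appears. The third clause says that the h-difference of g is Lipschitz with a
  constant proportional to norm h.\<close>

definition C11 :: "real \<Rightarrow> ('a::real_normed_vector \<Rightarrow> real) \<Rightarrow> bool" where
  "C11 C g \<longleftrightarrow> (\<forall>x. \<bar>g x\<bar> \<le> C) \<and> (\<forall>x y. \<bar>g x - g y\<bar> \<le> C * norm (x - y)) \<and>
     (\<forall>x y h. \<bar>(g (x + h) - g x) - (g (y + h) - g y)\<bar> \<le> C * norm h * norm (x - y))"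

lemma C11_bound: "C11 C g \<Longrightarrow> \<bar>g x\<bar> \<le> C"
  and C11_lipschitz: "C11 C g \<Longrightarrow> \<bar>g x - g y\<bar> \<le> C * norm (x - y)"
  and C11_second_difference: "C11 C g \<Longrightarrow> \<bar>(g (x + h) - g x) - (g (y + h) - g y)\<bar> \<le> C * norm h * norm (x - y)"
  by (auto simp: C11_def)

lemma C11_nonneg: "C11 C g \<Longrightarrow> 0 \<le> C"
  using C11_bound[of C g 0] by linarith

lemma C11_mono:
  assumes "C11 C g" "C \<le> D"
  shows "C11 D g"
proof -
  have "C * norm h * norm (x - y) \<le> D * norm h * norm (x - y)" for x y h :: 'a
    using assms(2) by (intro mult_right_mono) auto
  moreover have "C * norm (x - y) \<le> D * norm (x - y)" for x y :: 'a
    using assms(2) by (intro mult_right_mono) auto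
  ultimately show ?thesis using assms unfolding C11_def by (meson order_trans)
qed

lemma C11_continuous:
  assumes "C11 C g"
  shows "continuous_on S g"
proof (rule lipschitz_on_continuous_on)
  show "C-lipschitz_on S g"
    using C11_lipschitz[OF assms] C11_nonneg[OF assms]
    by (intro lipschitz_onI) (auto simp: dist_norm)
qed

text \<open>For the mixed second difference, the mean value estimate is applied in the variable h to
  g (x + h) - g (y + h), whose derivative is controlled by the Lipschitz bound on g'.\<close>

lemma C11_of_derivative:
  fixes g :: "real \<Rightarrow> real"
  assumes g: "\<And>t. (g has_real_derivative g' t) (at t)" and "\<And>t. \<bar>g t\<bar> \<le> C" "\<And>t. \<bar>g' t\<bar> \<le> C"
    and lip: "\<And>s t. \<bar>g' s - g' t\<bar> \<le> C * \<bar>s - t\<bar>"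
  shows "C11 C g"
  unfolding C11_def
proof (intro conjI allI)
  fix x y h :: real
  show "\<bar>g x - g y\<bar> \<le> C * norm (x - y)"
    using bounded_derivative_increment[of g g' C, OF g] assms(3) by simp
  have "\<bar>(g (x + h) - g (y + h)) - (g (x + 0) - g (y + 0))\<bar> \<le> C * \<bar>x - y\<bar> * \<bar>h - 0\<bar>"
  proof (rule bounded_derivative_increment)
    fix t
    have "((\<lambda>h. g (x + h)) has_real_derivative g' (x + t)) (at t)"
      "((\<lambda>h. g (y + h)) has_real_derivative g' (y + t)) (at t)"
      using g[of "x + t"] g[of "y + t"] by (simp_all add: DERIV_shift add.commute)
    then show "((\<lambda>h. g (x + h) - g (y + h)) has_real_derivative g' (x + t) - g' (y + t)) (at t)"
      by (rule DERIV_diff)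
    show "\<bar>g' (x + t) - g' (y + t)\<bar> \<le> C * \<bar>x - y\<bar>" using lip[of "x + t" "y + t"] by simp
  qed
  then show "\<bar>(g (x + h) - g x) - (g (y + h) - g y)\<bar> \<le> C * norm h * norm (x - y)"
    by (simp add: algebra_simps)
qed (use assms in auto)

text \<open>The 4 is dictated by the second difference, which splits into four products of size at
  most C D norm h norm (x - y).\<close>

lemma C11_mult:
  fixes f g :: "'a::real_normed_vector \<Rightarrow> real"
  assumes f: "C11 C f" and g: "C11 D g"
  shows "C11 (4 * C * D) (\<lambda>x. f x * g x)"
  unfolding C11_def
proof (intro conjI allI)
  have CD: "0 \<le> C" "0 \<le> D" using f g C11_nonneg by auto
  fix x y h :: 'a
  show "\<bar>f x * g x\<bar> \<le> 4 * C * D"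
  proof -
    have "\<bar>f x\<bar> * \<bar>g x\<bar> \<le> C * D"
      using C11_bound[OF f] C11_bound[OF g] CD by (intro mult_mono) auto
    moreover have "0 \<le> C * D" using CD by simp
    ultimately show ?thesis by (simp add: abs_mult)
  qed
  let ?N = "norm (x - y)" and ?h = "norm h"
  show "\<bar>f x * g x - f y * g y\<bar> \<le> 4 * C * D * ?N"
  proof -
    have "f x * g x - f y * g y = f x * (g x - g y) + (f x - f y) * g y"
      by (simp add: algebra_simps)
    also have "\<bar>\<dots>\<bar> \<le> \<bar>f x\<bar> * \<bar>g x - g y\<bar> + \<bar>f x - f y\<bar> * \<bar>g y\<bar>"
      by (rule order_trans[OF abs_triangle_ineq]) (simp add: abs_mult)
    also have "\<dots> \<le> C * (D * ?N) + (C * ?N) * D"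
      using C11_bound[OF f] C11_bound[OF g] C11_lipschitz[OF f] C11_lipschitz[OF g] CD
      by (intro add_mono mult_mono) auto
    also have "\<dots> = 2 * (C * D * ?N)" by simp
    also have "\<dots> \<le> 4 * (C * D * ?N)" using CD by (intro mult_right_mono) auto
    finally show ?thesis by (simp add: mult_ac)
  qed
  let ?df = "\<lambda>x. f (x + h) - f x" and ?dg = "\<lambda>x. g (x + h) - g x"
  have lf: "\<bar>?df x\<bar> \<le> C * ?h" for x using C11_lipschitz[OF f, of "x + h" x] by simp
  have lg: "\<bar>?dg x\<bar> \<le> D * ?h" for x using C11_lipschitz[OF g, of "x + h" x] by simp
  have "(f (x + h) * g (x + h) - f x * g x) - (f (y + h) * g (y + h) - f y * g y)
    = (f (x + h) * (?dg x - ?dg y) + (f (x + h) - f (y + h)) * ?dg y)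
      + (g x * (?df x - ?df y) + (g x - g y) * ?df y)"
    by (simp add: algebra_simps)
  also have "\<bar>\<dots>\<bar> \<le> (\<bar>f (x + h)\<bar> * \<bar>?dg x - ?dg y\<bar> + \<bar>f (x + h) - f (y + h)\<bar> * \<bar>?dg y\<bar>)
      + (\<bar>g x\<bar> * \<bar>?df x - ?df y\<bar> + \<bar>g x - g y\<bar> * \<bar>?df y\<bar>)"
    unfolding abs_mult[symmetric] by (intro order_trans[OF abs_triangle_ineq] add_mono abs_triangle_ineq)
  also have "\<dots> \<le> (C * (D * ?h * ?N) + (C * ?N) * (D * ?h)) + (D * (C * ?h * ?N) + (D * ?N) * (C * ?h))"
    using C11_bound[OF f] C11_bound[OF g] C11_lipschitz[OF f, of "x + h" "y + h"] C11_lipschitz[OF g, of x y]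
      C11_second_difference[OF f, of x h y] C11_second_difference[OF g, of x h y] CD lf lg
    by (intro add_mono mult_mono) auto
  finally show "\<bar>(f (x + h) * g (x + h) - f x * g x) - (f (y + h) * g (y + h) - f y * g y)\<bar>
      \<le> 4 * C * D * ?h * ?N" by (simp add: mult_ac)
qed

lemma C11_const: "C11 \<bar>c\<bar> (\<lambda>_. c)"
  by (auto simp: C11_def)

lemma C11_prod:
  assumes "finite I" "\<And>i. i \<in> I \<Longrightarrow> \<exists>C. C11 C (f i)"
  shows "\<exists>C. C11 C (\<lambda>x. \<Prod>i\<in>I. f i x)"
  using assms
proof (induction I rule: finite_induct)
  case empty
  show ?case using C11_const[of 1] by auto
next
  case (insert i I)
  then obtain C where C: "C11 C (f i)" by auto
  from insert obtain D where "C11 D (\<lambda>x. \<Prod>i\<in>I. f i x)" by auto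
  note C this
  from C11_mult[OF this] insert show ?case by auto
qed

lemma C11_compose_contraction:
  assumes "C11 C g" "linear l" "\<And>x. norm (l x) \<le> norm x"
  shows "C11 C (\<lambda>x. g (l x))"
  unfolding C11_def
proof (intro conjI allI)
  interpret linear l by fact
  have C: "0 \<le> C" using assms C11_nonneg by auto
  fix x y h
  show "\<bar>g (l x)\<bar> \<le> C" by (rule C11_bound[OF assms(1)])
  have "\<bar>g (l x) - g (l y)\<bar> \<le> C * norm (l x - l y)" by (rule C11_lipschitz[OF assms(1)])
  also have "\<dots> \<le> C * norm (x - y)" using C assms(3)[of "x - y"] by (simp add: diff mult_left_mono)
  finally show "\<bar>g (l x) - g (l y)\<bar> \<le> C * norm (x - y)" .
  have "\<bar>(g (l (x + h)) - g (l x)) - (g (l (y + h)) - g (l y))\<bar> \<le> C * norm (l h) * norm (l x - l y)"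
    using C11_second_difference[OF assms(1), of "l x" "l h" "l y"] by (simp add: add)
  also have "\<dots> \<le> C * norm h * norm (x - y)"
    using C assms(3)[of "x - y"] assms(3)[of h] by (intro mult_mono mult_left_mono) (auto simp: diff)
  finally show "\<bar>(g (l (x + h)) - g (l x)) - (g (l (y + h)) - g (l y))\<bar> \<le> C * norm h * norm (x - y)" .
qed

lemma primitive_const_outside:
  fixes F f :: "real \<Rightarrow> real"
  assumes F: "\<And>t. (F has_real_derivative f t) (at t)" and f: "\<And>t. r \<le> \<bar>t\<bar> \<Longrightarrow> f t = 0"
    and st: "r \<le> s \<and> r \<le> t \<or> s \<le> - r \<and> t \<le> - r"
  shows "F s = F t"
proof -
  have "\<exists>d. (F has_real_derivative d) (at u within {min s t..max s t}) \<and> d = 0" if "u \<in> {min s t..max s t}" for u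
  proof -
    have "r \<le> \<bar>u\<bar>" using that st by (auto simp: min_def max_def abs_if split: if_splits)
    with F[of u] f[of u] show ?thesis by (auto intro: has_field_derivative_at_within)
  qed
  then have "\<And>u. u \<in> {min s t..max s t} \<Longrightarrow> (F has_real_derivative 0) (at u within {min s t..max s t})"
    by blast
  then have "\<exists>c. \<forall>u\<in>{min s t..max s t}. F u = c"
    by (intro has_field_derivative_zero_constant) auto
  then show ?thesis by (metis atLeastAtMost_iff max.cobounded1 max.cobounded2 min.cobounded1 min.cobounded2)
qed

text \<open>Up to normalisation, \<open>\<kappa>\<close> is the convolution of a tent function with the indicator of \<open>[-1, 1]\<close>.\<close>

lemma ex_smoothing_kernel:
  obtains \<kappa> w :: "real \<Rightarrow> real" and C where
    "\<And>t. 0 \<le> \<kappa> t" "\<And>t. 4 \<le> \<bar>t\<bar> \<Longrightarrow> \<kappa> t = 0" "\<And>t. 4 \<le> \<bar>t\<bar> \<Longrightarrow> w t = 0"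
    "C11 C \<kappa>" "C11 C w" "\<And>t. (w has_real_derivative (\<kappa> t - \<kappa> (t / 2) / 2)) (at t)"
    "(\<integral>\<^sup>+t. ennreal (\<kappa> t) \<partial>lborel) = 1"
proof -
  define \<Lambda> :: "real \<Rightarrow> real" where "\<Lambda> t = max 0 (1 - \<bar>t\<bar>)" for t
  have "continuous_on UNIV \<Lambda>" unfolding \<Lambda>_def by (intro continuous_intros)
  then obtain P where P: "\<And>t. (P has_real_derivative \<Lambda> t) (at t)" using ex_primitive_real by blast
  have \<Lambda>0: "0 \<le> \<Lambda> t" for t by (simp add: \<Lambda>_def)
  have Pmono: "P s \<le> P t" if "s \<le> t" for s t using increment_ge[OF P \<Lambda>0 that] by simp
  define \<beta> where "\<beta> t = P (t + 1) - P (t - 1)" for t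
  have \<beta>': "(\<beta> has_real_derivative (\<Lambda> (t + 1) - \<Lambda> (t - 1))) (at t)" for t
  proof -
    have "((\<lambda>t. P (t + 1)) has_real_derivative \<Lambda> (t + 1)) (at t)"
      using P[of "t + 1"] by (simp add: DERIV_shift)
    moreover have "((\<lambda>t. P (t - 1)) has_real_derivative \<Lambda> (t - 1)) (at t)"
      using P[of "t - 1"] DERIV_shift[of P "\<Lambda> (t - 1)" t "-1"] by simp
    ultimately show ?thesis unfolding \<beta>_def by (rule DERIV_diff)
  qed
  have \<beta>0: "0 \<le> \<beta> t" for t using Pmono[of "t - 1" "t + 1"] by (simp add: \<beta>_def)
  have \<beta>z: "\<beta> t = 0" if "2 \<le> \<bar>t\<bar>" for t
  proof -
    have "P (t + 1) = P (t - 1)"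
      by (rule primitive_const_outside[OF P, of 1]) (use that in \<open>auto simp: \<Lambda>_def abs_if split: if_splits\<close>)
    then show ?thesis by (simp add: \<beta>_def)
  qed
  have \<Lambda>1: "\<Lambda> t \<le> 1" for t by (simp add: \<Lambda>_def)
  have \<beta>le: "\<beta> t \<le> 2" for t
    using bounded_derivative_increment[OF P, of 1 "t + 1" "t - 1"] \<Lambda>0 \<Lambda>1 by (auto simp: \<beta>_def)
  have \<Lambda>lip: "\<bar>\<Lambda> s - \<Lambda> t\<bar> \<le> \<bar>s - t\<bar>" for s t by (auto simp: \<Lambda>_def abs_if max_def)
  have \<beta>C: "C11 2 \<beta>"
  proof (rule C11_of_derivative[OF \<beta>'])
    fix s t
    show "\<bar>\<beta> t\<bar> \<le> 2" using \<beta>0[of t] \<beta>le[of t] by simp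
    show "\<bar>\<Lambda> (t + 1) - \<Lambda> (t - 1)\<bar> \<le> 2" using \<Lambda>lip[of "t + 1" "t - 1"] by simp
    show "\<bar>\<Lambda> (s + 1) - \<Lambda> (s - 1) - (\<Lambda> (t + 1) - \<Lambda> (t - 1))\<bar> \<le> 2 * \<bar>s - t\<bar>"
      using \<Lambda>lip[of "s + 1" "t + 1"] \<Lambda>lip[of "s - 1" "t - 1"] by (simp add: abs_if split: if_splits)
  qed
  have [measurable]: "\<beta> \<in> borel_measurable borel"
    using C11_continuous[OF \<beta>C] by (rule borel_measurable_continuous_onI)
  define I where "I = (\<integral>\<^sup>+t. ennreal (\<beta> t) \<partial>lborel)"
  have "I \<le> (\<integral>\<^sup>+t. 2 * indicator {-2..2::real} t \<partial>lborel)"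
    unfolding I_def using \<beta>le \<beta>z by (intro nn_integral_mono) (auto simp: indicator_def intro!: ennreal_leI[of _ 2, simplified])
  also have "\<dots> < \<infinity>" by (simp add: nn_integral_cmult ennreal_mult_less_top)
  finally have Ifin: "I < \<infinity>" .
  \<comment> \<open>Guarantees positive total mass before normalising: the interval from t - 1 to t
    + 1 contains that from -1/2 to 1/2, on which the tent is at least 1/2.\<close>
  have \<beta>half: "1 / 2 \<le> \<beta> t" if "\<bar>t\<bar> \<le> 1 / 2" for t
  proof -
    have "P (-1/2) - (-1/2) / 2 \<le> P (1/2) - (1/2) / 2"
    proof (rule DERIV_nonneg_imp_nondecreasing[of "-1/2" "1/2" "\<lambda>t. P t - t / 2"])
      fix x :: real assume "- 1 / 2 \<le> x" "x \<le> 1 / 2"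
      then show "\<exists>y. ((\<lambda>t. P t - t / 2) has_real_derivative y) (at x) \<and> 0 \<le> y"
        by (intro exI[of _ "\<Lambda> x - 1 / 2"] conjI) (auto intro!: derivative_eq_intros P simp: \<Lambda>_def)
    qed simp
    moreover have "P (1/2) \<le> P (t + 1)" "P (t - 1) \<le> P (-1/2)" using that by (auto intro!: Pmono)
    ultimately show ?thesis by (simp add: \<beta>_def)
  qed
  have "ennreal (1 / 2) = (\<integral>\<^sup>+t. ennreal (1 / 2) * indicator {-1/2..1/2::real} t \<partial>lborel)"
    by (subst nn_integral_cmult) auto
  also have "\<dots> \<le> I"
    unfolding I_def using \<beta>half by (intro nn_integral_mono) (auto simp: indicator_def abs_le_iff simp del: ennreal_half intro!: ennreal_leI)
  finally have "ennreal (1 / 2) \<le> I" .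
  define r where "r = enn2real I"
  have Ir: "I = ennreal r" using Ifin by (simp add: r_def less_top)
  have "0 < r"
  proof (rule ccontr)
    assume "\<not> 0 < r"
    then have "I = 0" by (simp add: Ir ennreal_neg)
    with \<open>ennreal (1 / 2) \<le> I\<close> show False by simp
  qed
  define \<kappa> where "\<kappa> t = \<beta> t / r" for t
  have \<kappa>0: "0 \<le> \<kappa> t" for t using \<beta>0 \<open>0 < r\<close> by (simp add: \<kappa>_def)
  have \<kappa>z: "\<kappa> t = 0" if "2 \<le> \<bar>t\<bar>" for t using \<beta>z that by (simp add: \<kappa>_def)
  have \<kappa>C: "C11 (4 * 2 * \<bar>1 / r\<bar>) \<kappa>"
    using C11_mult[OF \<beta>C C11_const[of "1 / r"]] unfolding \<kappa>_def by simp
  have \<kappa>I: "(\<integral>\<^sup>+t. ennreal (\<kappa> t) \<partial>lborel) = 1"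
  proof -
    have "(\<integral>\<^sup>+t. ennreal (\<kappa> t) \<partial>lborel) = (\<integral>\<^sup>+t. ennreal (1 / r) * ennreal (\<beta> t) \<partial>lborel)"
      using \<beta>0 \<open>0 < r\<close> by (intro nn_integral_cong) (auto simp: \<kappa>_def ennreal_mult[symmetric])
    also have "\<dots> = ennreal (1 / r) * I" unfolding I_def by (rule nn_integral_cmult) simp
    also have "\<dots> = 1" using \<open>0 < r\<close> by (simp add: Ir ennreal_mult[symmetric])
    finally show ?thesis .
  qed
  obtain Q where Q: "\<And>t. (Q has_real_derivative \<kappa> t) (at t)"
    using ex_primitive_real[OF C11_continuous[OF \<kappa>C]] by blast
  \<comment> \<open>Q (t / 2) is a primitive of the dilated kernel, so w is one of the difference of
    the two kernels. For \<bar>t\<bar> \<ge> 4 both t and t / 2 lie on the same side beyond the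
    support of \<kappa>, where Q is constant, so w vanishes there.\<close>
  define w where "w t = Q t - Q (t / 2)" for t
  have w': "(w has_real_derivative (\<kappa> t - \<kappa> (t / 2) / 2)) (at t)" for t
  proof -
    have "((\<lambda>t. Q (t / 2)) has_real_derivative \<kappa> (t / 2) * (1 / 2)) (at t)"
      by (rule DERIV_chain2[OF Q]) (auto intro!: derivative_eq_intros)
    from DERIV_diff[OF Q[of t] this] show ?thesis by (simp add: w_def[abs_def])
  qed
  have wz: "w t = 0" if "4 \<le> \<bar>t\<bar>" for t
  proof -
    have "Q t = Q (t / 2)"
      by (rule primitive_const_outside[OF Q, of 2]) (use that \<kappa>z in \<open>auto simp: abs_if split: if_splits\<close>)
    then show ?thesis by (simp add: w_def)
  qed
  define c where "c = 8 / r"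
  have c: "0 < c" using \<open>0 < r\<close> by (simp add: c_def)
  have \<kappa>c: "C11 c \<kappa>" using \<kappa>C \<open>0 < r\<close> by (simp add: c_def)
  have w'le: "\<bar>\<kappa> t - \<kappa> (t / 2) / 2\<bar> \<le> 2 * c" for t
    using C11_bound[OF \<kappa>c, of t] C11_bound[OF \<kappa>c, of "t / 2"] c by (simp add: abs_if split: if_splits)
  have "C11 (16 * c) w"
  proof (rule C11_of_derivative[OF w'])
    fix s t :: real
    show "\<bar>\<kappa> t - \<kappa> (t / 2) / 2\<bar> \<le> 16 * c" using w'le[of t] c by linarith
    \<comment> \<open>The derivative bound 2 c is integrated from the point 4, where w vanishes,
      over a distance of at most 8; hence the constant 16 c.\<close>
    show "\<bar>w t\<bar> \<le> 16 * c"
    proof (cases "4 \<le> \<bar>t\<bar>")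
      case False
      have "\<bar>w t - w 4\<bar> \<le> 2 * c * \<bar>t - 4\<bar>" by (rule bounded_derivative_increment[OF w' w'le])
      also have "\<dots> \<le> 2 * c * 8" using c False by (intro mult_left_mono) auto
      finally show ?thesis using wz[of 4] by simp
    qed (use wz c in auto)
    have "\<bar>\<kappa> s - \<kappa> t\<bar> \<le> c * \<bar>s - t\<bar>" using C11_lipschitz[OF \<kappa>c] by simp
    moreover have "\<bar>\<kappa> (s / 2) - \<kappa> (t / 2)\<bar> \<le> c * \<bar>s - t\<bar> / 2"
      using C11_lipschitz[OF \<kappa>c, of "s / 2" "t / 2"] by (simp add: diff_divide_distrib[symmetric])
    moreover have "0 \<le> c * \<bar>s - t\<bar>" using c by simp
    ultimately show "\<bar>\<kappa> s - \<kappa> (s / 2) / 2 - (\<kappa> t - \<kappa> (t / 2) / 2)\<bar> \<le> 16 * c * \<bar>s - t\<bar>"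
      unfolding abs_le_iff by linarith
  qed
  moreover have "C11 (16 * c) \<kappa>" using c by (intro C11_mono[OF \<kappa>c]) auto
  ultimately show ?thesis using that[of \<kappa> w "16 * c"] \<kappa>0 \<kappa>z wz w' \<kappa>I by simp
qed

section \<open>Discrepancy of smoothed counting functions\<close>

text \<open>One finite index set serves all x in a ball around a, so smeared sums can be subtracted
  and differentiated term by term.\<close>

lemma smear_locally_finite_sum:
  fixes Y :: "'a::euclidean_space set"
  assumes sep: "separated \<delta> Y" and K: "\<And>x. r < norm x \<Longrightarrow> K x = 0" and x: "norm (x - a) \<le> s"
  shows "smear Y K x = (\<Sum>y\<in>Y \<inter> cball a (r + s). K (x - y))"
proof (rule smear_eq)
  show "finite (Y \<inter> cball a (r + s))"
    by (rule separated_finite[OF sep]) (auto intro: bounded_subset[of "cball a (r + s)"])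
  fix y assume "y \<in> Y" "y \<notin> Y \<inter> cball a (r + s)"
  then have "r + s < norm (a - y)" by (simp add: dist_norm)
  also have "norm (a - y) \<le> norm (x - y) + norm (x - a)"
    using norm_triangle_ineq4[of "x - y" "x - a"] by simp
  finally show "K (x - y) = 0" using x by (intro K) simp
qed auto

lemma smear_scale: "c \<noteq> 0 \<Longrightarrow> smear Y (\<lambda>x. c * K x) x = c * smear Y K x"
  by (simp add: smear_def sum_distrib_left)

lemma smear_difference:
  fixes Y :: "'a::euclidean_space set"
  assumes sep: "separated \<delta> Y" and K: "\<And>x. r < norm x \<Longrightarrow> K x = 0"
  shows "smear Y (\<lambda>x. K (x + h) - K x) x = smear Y K (x + h) - smear Y K x"
proof -
  have "smear Y (\<lambda>x. K (x + h) - K x) x = (\<Sum>y\<in>Y \<inter> cball x (r + norm h + norm h). K ((x - y) + h) - K (x - y))"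
  proof (rule smear_locally_finite_sum[OF sep])
    fix z :: 'a assume "r + norm h < norm z"
    moreover have "norm z \<le> norm (z + h) + norm h" using norm_triangle_ineq4[of "z + h" h] by simp
    ultimately have "r < norm (z + h)" "r < norm z"
      using norm_ge_zero[of h] by linarith+
    then show "K (z + h) - K z = 0" using K by simp
  qed simp
  moreover have "smear Y K (x + h) = (\<Sum>y\<in>Y \<inter> cball x (r + (norm h + norm h)). K (x + h - y))"
    by (rule smear_locally_finite_sum[OF sep K]) auto
  moreover have "smear Y K x = (\<Sum>y\<in>Y \<inter> cball x (r + (norm h + norm h)). K (x - y))"
    by (rule smear_locally_finite_sum[OF sep K]) auto
  ultimately show ?thesis by (simp add: sum_subtractf algebra_simps)
qed

lemma integrable_bounded_support:
  fixes K :: "'a::euclidean_space \<Rightarrow> real"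
  assumes [measurable]: "K \<in> borel_measurable borel"
    and "\<And>x. \<bar>K x\<bar> \<le> A" "\<And>x. r < norm x \<Longrightarrow> K x = 0"
  shows "integrable lborel K"
proof (rule Bochner_Integration.integrable_bound)
  show "integrable lborel (\<lambda>x. A * indicator (cball 0 r) x :: real)"
    by (intro integrable_mult_right integrable_real_indicator) (use emeasure_bounded_finite[OF bounded_cball[of 0 r]] in auto)
  have "0 \<le> A" using assms(2)[of 0] by linarith
  then show "AE x in lborel. norm (K x) \<le> norm (A * indicator (cball 0 r) x :: real)"
    using assms(2,3) by (intro AE_I2) (auto simp: indicator_def not_le)
qed measurable

lemma integral_lborel_translate:
  fixes K :: "'a::euclidean_space \<Rightarrow> real"
  assumes [measurable]: "K \<in> borel_measurable borel"
  shows "(\<integral>x. K (x + h) \<partial>lborel) = (\<integral>x. K x \<partial>lborel)"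
proof -
  have "(\<integral>x. K x \<partial>lborel) = (\<integral>x. K x \<partial>distr lborel borel ((+) h))"
    by (simp add: lborel_distr_plus)
  also have "\<dots> = (\<integral>x. K (x + h) \<partial>lborel)"
    by (subst integral_distr) (auto simp: add.commute)
  finally show ?thesis ..
qed

lemma integral_lborel_scale:
  fixes K :: "'a::euclidean_space \<Rightarrow> real"
  assumes [measurable]: "K \<in> borel_measurable borel" and "0 < L"
  shows "(\<integral>x. K (x /\<^sub>R L) \<partial>lborel) = L ^ DIM('a) * (\<integral>x. K x \<partial>lborel)"
proof -
  have "(\<integral>x. K (x /\<^sub>R L) \<partial>lborel)
      = (\<integral>x. K (x /\<^sub>R L) \<partial>density (distr lborel borel (\<lambda>x. 0 + L *\<^sub>R x)) (\<lambda>_. ennreal (\<bar>L\<bar> ^ DIM('a))))"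
    by (subst lborel_affine[of L 0]) (use \<open>0 < L\<close> in \<open>auto simp: ennreal_power\<close>)
  also have "\<dots> = L ^ DIM('a) * (\<integral>x. K x \<partial>lborel)"
    using \<open>0 < L\<close> by (subst integral_density) (auto simp: integral_distr)
  finally show ?thesis .
qed

text \<open>Relative error \<open>e L\<close> in counting Y, of density \<rho>, against test
  functions at scale L: amplitude A, Lipschitz constant A / L, support in a ball of radius c L. The
  bound is linear in A and C does not depend on K, so functions of small amplitude are counted with
  a correspondingly small error.\<close>

definition uniform_discrepancy :: "(real^'n) set \<Rightarrow> real \<Rightarrow> (real \<Rightarrow> real) \<Rightarrow> bool" where
  "uniform_discrepancy Y \<rho> e \<longleftrightarrow>
     (\<forall>c. \<exists>C L0. \<forall>L\<ge>L0. \<forall>A\<ge>0. \<forall>K.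
        (\<forall>x. \<bar>K x\<bar> \<le> A) \<longrightarrow> (\<forall>x y. \<bar>K x - K y\<bar> \<le> A / L * norm (x - y)) \<longrightarrow>
        (\<forall>x. c * L < norm x \<longrightarrow> K x = 0) \<longrightarrow>
        (\<forall>x. \<bar>smear Y K x - \<rho> * (\<integral>x. K x \<partial>lborel)\<bar> \<le> C * A * L ^ CARD('n) * e L))"

text \<open>The second estimate comes from applying the discrepancy bound to the h-difference of the
  rescaled kernel, with h = x - y: its amplitude is at most G norm h / L and its integral is 0, so
  the main term cancels and a factor norm h / L is gained.\<close>

lemma smear_oscillation:
  fixes Y :: "(real^'n) set" and g :: "real^'n \<Rightarrow> real"
  assumes sep: "separated \<delta> Y" and disc: "uniform_discrepancy Y \<rho> e"
    and e0: "\<And>L. 0 \<le> e L"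
    and g: "C11 G g" and supp: "\<And>x. c < norm x \<Longrightarrow> g x = 0"
  shows "\<exists>C\<ge>0. \<exists>L0\<ge>1. \<forall>L\<ge>L0. \<forall>x y.
     \<bar>smear Y (\<lambda>x. g (x /\<^sub>R L)) x / L ^ CARD('n) - \<rho> * (\<integral>x. g x \<partial>lborel)\<bar> \<le> C * e L \<and>
     \<bar>smear Y (\<lambda>x. g (x /\<^sub>R L)) x / L ^ CARD('n) - smear Y (\<lambda>x. g (x /\<^sub>R L)) y / L ^ CARD('n)\<bar>
       \<le> C * e L / L * norm (x - y)"
proof -
  let ?n = "CARD('n)"
  have "0 \<le> G" using g by (rule C11_nonneg)
  \<comment> \<open>The radius c + 1 leaves room for translating the kernel by up to L.\<close>
  obtain C0 L0 where C0: "\<And>L A K x. L0 \<le> L \<Longrightarrow> 0 \<le> A \<Longrightarrow> (\<And>x. \<bar>K x\<bar> \<le> A) \<Longrightarrow>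
      (\<And>x y. \<bar>K x - K y\<bar> \<le> A / L * norm (x - y)) \<Longrightarrow> (\<And>x. (c + 1) * L < norm x \<Longrightarrow> K x = 0) \<Longrightarrow>
      \<bar>smear Y K x - \<rho> * (\<integral>x. K x \<partial>lborel)\<bar> \<le> C0 * A * L ^ ?n * e L"
    using disc unfolding uniform_discrepancy_def by meson
  have [measurable]: "g \<in> borel_measurable borel"
    using C11_continuous[OF g] by (rule borel_measurable_continuous_onI)
  define D where "D = \<bar>C0\<bar> * G"
  \<comment> \<open>Twice D, for the case norm h > L, where both values are compared with the
    mean.\<close>
  define C where "C = 2 * D"
  have "0 \<le> D" using \<open>0 \<le> G\<close> by (simp add: D_def)
  then have "0 \<le> C" by (simp add: C_def)
  have C0D: "C0 * G \<le> D"
    using \<open>0 \<le> G\<close> by (auto simp: D_def intro!: mult_right_mono)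
  then have C0G: "C0 * G \<le> C" using \<open>0 \<le> D\<close> by (simp add: C_def)
  show ?thesis
  proof (rule exI[of _ C], intro conjI exI[of _ "max 1 L0"] allI impI)
    fix L x y assume "max 1 L0 \<le> L"
    then have L: "1 \<le> L" "L0 \<le> L" by auto
    let ?K = "\<lambda>x. g (x /\<^sub>R L)"
    let ?s = "\<lambda>x. smear Y ?K x / L ^ ?n"
    have Lpos: "0 < L ^ ?n" using L by simp
    have Ksupp: "?K x = 0" if "c * L < norm x" for x
      using that L by (intro supp) (simp add: field_simps)
    have Kb: "\<bar>?K x\<bar> \<le> G" for x using C11_bound[OF g] .
    have scale: "norm (x /\<^sub>R L - y /\<^sub>R L) = norm (x - y) / L" for x y
      using L by (simp add: scaleR_diff_right[symmetric] divide_inverse_commute)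
    have Klip: "\<bar>?K x - ?K y\<bar> \<le> G / L * norm (x - y)" for x y
      using C11_lipschitz[OF g, of "x /\<^sub>R L" "y /\<^sub>R L"] by (simp add: scale)
    have b: "\<bar>?s x - \<rho> * (\<integral>x. g x \<partial>lborel)\<bar> \<le> D * e L" for x
    proof -
      have "\<bar>smear Y ?K x - \<rho> * (\<integral>x. ?K x \<partial>lborel)\<bar> \<le> C0 * G * L ^ ?n * e L"
      proof (rule C0[OF L(2) \<open>0 \<le> G\<close> Kb Klip])
        fix x :: "real^'n" assume "(c + 1) * L < norm x"
        then show "?K x = 0" using L by (intro Ksupp) (simp add: algebra_simps)
      qed
      also have "\<dots> \<le> D * L ^ ?n * e L"
        using C0D Lpos e0 by (intro mult_right_mono) (auto simp: less_imp_le)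
      finally have "\<bar>smear Y ?K x - \<rho> * (L ^ ?n * (\<integral>x. g x \<partial>lborel))\<bar> \<le> D * L ^ ?n * e L"
        using L by (simp add: integral_lborel_scale)
      also have "smear Y ?K x - \<rho> * (L ^ ?n * (\<integral>x. g x \<partial>lborel)) = (?s x - \<rho> * (\<integral>x. g x \<partial>lborel)) * L ^ ?n"
        using L by (simp add: left_diff_distrib)
      finally have "\<bar>?s x - \<rho> * (\<integral>x. g x \<partial>lborel)\<bar> * L ^ ?n \<le> (D * e L) * L ^ ?n"
        using Lpos by (simp add: abs_mult mult_ac)
      then show ?thesis using Lpos by (simp only: mult_le_cancel_right_pos)
    qed
    show "\<bar>?s x - \<rho> * (\<integral>x. g x \<partial>lborel)\<bar> \<le> C * e L"
      using b[of x] \<open>0 \<le> D\<close> e0[of L] by (simp add: C_def)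
    define h where "h = x - y"
    show "\<bar>?s x - ?s y\<bar> \<le> C * e L / L * norm (x - y)"
    proof (cases "norm h \<le> L")
      case True
      let ?D = "\<lambda>x. ?K (x + h) - ?K x"
      have "0 \<le> G * norm h / L" using \<open>0 \<le> G\<close> L by simp
      moreover have "\<bar>?D x\<bar> \<le> G * norm h / L" for x using Klip[of "x + h" x] by simp
      moreover have "\<bar>?D x - ?D y\<bar> \<le> G * norm h / L / L * norm (x - y)" for x y
      proof -
        have "norm (h /\<^sub>R L) = norm h / L" using scale[of h 0] by simp
        then show ?thesis
          using C11_second_difference[OF g, of "x /\<^sub>R L" "h /\<^sub>R L" "y /\<^sub>R L"]
          by (simp add: scale scaleR_add_right[symmetric])
      qed
      moreover have "?D x = 0" if "(c + 1) * L < norm x" for x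
      proof -
        have "norm x \<le> norm (x + h) + norm h" using norm_triangle_ineq4[of "x + h" h] by simp
        then have "c * L < norm (x + h)" "c * L < norm x"
          using that True L by (auto simp: distrib_right)
        then show ?thesis using Ksupp by simp
      qed
      ultimately have "\<bar>smear Y ?D y - \<rho> * (\<integral>x. ?D x \<partial>lborel)\<bar> \<le> C0 * (G * norm h / L) * L ^ ?n * e L"
        by (rule C0[OF L(2)])
      moreover have "(\<integral>x. ?D x \<partial>lborel) = 0"
      proof -
        have i: "integrable lborel ?K"
          by (rule integrable_bounded_support[OF _ Kb Ksupp]) measurable
        have "integrable lborel (\<lambda>x. ?K (x + h))"
        proof (rule integrable_bounded_support[OF _ Kb])
          fix x :: "real^'n" assume "c * L + norm h < norm x"
          moreover have "norm x \<le> norm (x + h) + norm h" using norm_triangle_ineq4[of "x + h" h] by simp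
          ultimately show "?K (x + h) = 0" by (intro Ksupp) simp
        qed measurable
        with i show ?thesis
          by (simp add: integral_lborel_translate[of ?K])
      qed
      moreover have "smear Y ?D y = smear Y ?K x - smear Y ?K y"
        using smear_difference[OF sep Ksupp, where h = h and x = y] by (simp add: h_def)
      ultimately have "\<bar>smear Y ?K x - smear Y ?K y\<bar> \<le> (C0 * G) * (norm h / L * L ^ ?n * e L)"
        by (simp add: mult_ac)
      also have "\<dots> \<le> C * (norm h / L * L ^ ?n * e L)"
        using C0G L e0 by (intro mult_right_mono) auto
      finally have "\<bar>?s x - ?s y\<bar> * L ^ ?n \<le> (C * e L / L * norm h) * L ^ ?n"
        using Lpos by (simp add: diff_divide_distrib[symmetric] mult_ac)
      then show ?thesis using Lpos by (simp only: mult_le_cancel_right_pos h_def)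
    next
      case False
      have "\<bar>?s x - ?s y\<bar> \<le> C * e L"
        using b[of x] b[of y] unfolding C_def abs_le_iff by linarith
      also have "\<dots> \<le> C * e L * (norm h / L)"
        using False L \<open>0 \<le> C\<close> e0[of L] mult_left_mono[of 1 "norm h / L" "C * e L"] by simp
      finally show ?thesis by (simp add: h_def)
    qed
  qed (use \<open>0 \<le> C\<close> in auto)
qed

section \<open>Changing the scale of the kernel\<close>

text \<open>T transports the density f to f', and q bounds the distortion of distances both ways.
  Stating the transport through all Borel test functions makes composition immediate.\<close>

definition pushes :: "real \<Rightarrow> ('a::euclidean_space \<Rightarrow> real) \<Rightarrow> ('a \<Rightarrow> real) \<Rightarrow> bool" where
  "pushes q f f' \<longleftrightarrow> (\<exists>T.
     (\<forall>x y. norm (T x - T y) \<le> q * norm (x - y) \<and> norm (x - y) \<le> q * norm (T x - T y)) \<and>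
     (\<forall>g\<in>borel_measurable borel.
        (\<integral>\<^sup>+x. g (T x) * ennreal (f x) \<partial>lborel) = (\<integral>\<^sup>+x. g x * ennreal (f' x) \<partial>lborel)))"

lemma borel_measurable_expansion:
  fixes T :: "'a::euclidean_space \<Rightarrow> 'a"
  assumes "\<And>x y. norm (T x - T y) \<le> q * norm (x - y)"
  shows "T \<in> borel_measurable borel"
proof (intro borel_measurable_continuous_onI lipschitz_on_continuous_on)
  show "\<bar>q\<bar>-lipschitz_on UNIV T"
  proof (rule lipschitz_onI)
    fix x y
    have "norm (T x - T y) \<le> q * norm (x - y)" by (rule assms)
    also have "\<dots> \<le> \<bar>q\<bar> * norm (x - y)" by (intro mult_right_mono) auto
    finally show "dist (T x) (T y) \<le> \<bar>q\<bar> * dist x y" by (simp add: dist_norm)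
  qed simp
qed

lemma pushes_refl: "pushes 1 f f"
  unfolding pushes_def by (rule exI[of _ "\<lambda>x. x"]) auto

lemma pushes_mono:
  assumes "pushes q f f'" "q \<le> r"
  shows "pushes r f f'"
proof -
  have "q * norm z \<le> r * norm z" for z :: 'a using assms(2) by (rule mult_right_mono) simp
  with assms(1) show ?thesis unfolding pushes_def by (meson order_trans)
qed

lemma pushes_trans:
  assumes "pushes q f f'" "pushes r f' f''" "0 \<le> q" "0 \<le> r"
  shows "pushes (q * r) f f''"
proof -
  obtain T where T: "\<And>x y. norm (T x - T y) \<le> q * norm (x - y)" "\<And>x y. norm (x - y) \<le> q * norm (T x - T y)"
    and Tg: "\<And>g. g \<in> borel_measurable borel \<Longrightarrow>
        (\<integral>\<^sup>+x. g (T x) * ennreal (f x) \<partial>lborel) = (\<integral>\<^sup>+x. g x * ennreal (f' x) \<partial>lborel)"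
    using assms(1) unfolding pushes_def by blast
  obtain S where S: "\<And>x y. norm (S x - S y) \<le> r * norm (x - y)" "\<And>x y. norm (x - y) \<le> r * norm (S x - S y)"
    and Sg: "\<And>g. g \<in> borel_measurable borel \<Longrightarrow>
        (\<integral>\<^sup>+x. g (S x) * ennreal (f' x) \<partial>lborel) = (\<integral>\<^sup>+x. g x * ennreal (f'' x) \<partial>lborel)"
    using assms(2) unfolding pushes_def by blast
  have [measurable]: "S \<in> borel_measurable borel" using S(1) by (rule borel_measurable_expansion)
  have a: "norm (S (T x) - S (T y)) \<le> q * r * norm (x - y)" for x y
  proof -
    have "norm (S (T x) - S (T y)) \<le> r * norm (T x - T y)" by (rule S)
    also have "\<dots> \<le> r * (q * norm (x - y))" using T(1) assms by (intro mult_left_mono) auto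
    finally show ?thesis by (simp add: mult_ac)
  qed
  have b: "norm (x - y) \<le> q * r * norm (S (T x) - S (T y))" for x y
  proof -
    have "norm (x - y) \<le> q * norm (T x - T y)" by (rule T)
    also have "\<dots> \<le> q * (r * norm (S (T x) - S (T y)))" using S(2) assms by (intro mult_left_mono) auto
    finally show ?thesis by (simp add: mult_ac)
  qed
  have c: "(\<integral>\<^sup>+x. g (S (T x)) * ennreal (f x) \<partial>lborel) = (\<integral>\<^sup>+x. g x * ennreal (f'' x) \<partial>lborel)"
    if [measurable]: "g \<in> borel_measurable borel" for g
  proof -
    have "(\<lambda>x. g (S x)) \<in> borel_measurable borel" by measurable
    from Tg[OF this] Sg[OF that] show ?thesis by simp
  qed
  show ?thesis unfolding pushes_def
    by (rule exI[of _ "\<lambda>x. S (T x)"]) (use a b c in blast)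
qed

section \<open>Product kernels dilated in some of the coordinates\<close>

locale smoothing_kernel =
  fixes \<kappa> w :: "real \<Rightarrow> real" and B :: real
  assumes kernel_nonneg: "\<And>t. 0 \<le> \<kappa> t"
    and kernel_support: "\<And>t. 4 \<le> \<bar>t\<bar> \<Longrightarrow> \<kappa> t = 0" and w_support: "\<And>t. 4 \<le> \<bar>t\<bar> \<Longrightarrow> w t = 0"
    and kernel_C11: "C11 B \<kappa>" and w_C11: "C11 B w"
    and w_derivative: "\<And>t. (w has_real_derivative (\<kappa> t - \<kappa> (t / 2) / 2)) (at t)"
    and kernel_mass: "(\<integral>\<^sup>+t. ennreal (\<kappa> t) \<partial>lborel) = 1"
begin

definition dil :: "'n set \<Rightarrow> 'n \<Rightarrow> real \<Rightarrow> real" where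
  "dil A k t = (if k \<in> A then \<kappa> (t / 2) / 2 else \<kappa> t)"

text \<open>As A grows from {} to UNIV one coordinate at a time, this interpolates between the
  product kernel and its copy at twice the scale, always with mass one.\<close>

definition pkern :: "'n set \<Rightarrow> real^'n \<Rightarrow> real" where
  "pkern A x = (\<Prod>k\<in>UNIV. dil A k (x $ k))"

text \<open>For J outside A, a primitive in direction J of the change of \<open>pkern\<close> when J
  joins A; the shear in direction J is built from it.\<close>

definition wkern :: "'n set \<Rightarrow> 'n \<Rightarrow> real^'n \<Rightarrow> real" where
  "wkern A J x = w (x $ J) * (\<Prod>k\<in>UNIV - {J}. dil A k (x $ k))"

lemma dil_nonneg: "0 \<le> dil A k t"
  using kernel_nonneg by (simp add: dil_def)

lemma dil_support: "8 \<le> \<bar>t\<bar> \<Longrightarrow> dil A k t = 0"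
  using kernel_support by (simp add: dil_def)

lemma dil_C11: "\<exists>C. C11 C (dil A k)"
proof (cases "k \<in> A")
  case True
  have "C11 B (\<lambda>t. \<kappa> (t / 2))"
    by (rule C11_compose_contraction[OF kernel_C11, of "\<lambda>t. t / 2"]) (auto intro!: linearI simp: add_divide_distrib)
  from C11_mult[OF C11_const[of "1/2"] this] True show ?thesis by (auto simp: dil_def[abs_def])
next
  case False
  with kernel_C11 show ?thesis by (auto simp: dil_def[abs_def])
qed

lemma C11_component:
  fixes g :: "real \<Rightarrow> real"
  assumes "C11 C g"
  shows "C11 C (\<lambda>x :: real^'n. g (x $ k))"
proof (rule C11_compose_contraction[OF assms])
  show "linear (\<lambda>x :: real^'n. x $ k)" by (intro linearI) auto
  show "norm (x $ k) \<le> norm x" for x :: "real^'n"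
    using component_le_norm_cart[of x k] by simp
qed

lemma dil_component_C11: "\<exists>C. C11 C (\<lambda>x :: real^'n. dil A k (x $ k))"
proof -
  obtain C where "C11 C (dil A k)" using dil_C11[of A k] by (elim exE)
  then have "C11 C (\<lambda>x :: real^'n. dil A k (x $ k))" by (rule C11_component[where g = "dil A k"])
  then show ?thesis by (rule exI)
qed

lemma dil_prod_C11: "\<exists>C. C11 C (\<lambda>x :: real^'n. \<Prod>k\<in>I. dil A k (x $ k))"
proof (rule C11_prod)
  fix k show "\<exists>C. C11 C (\<lambda>x :: real^'n. dil A k (x $ k))" by (rule dil_component_C11)
qed simp

lemma pkern_C11: "\<exists>C. C11 C (pkern A)"
  unfolding pkern_def[abs_def] by (rule dil_prod_C11)

lemma wkern_C11: "\<exists>C. C11 C (wkern A J)"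
proof -
  obtain C where "C11 C (\<lambda>x. \<Prod>k\<in>UNIV - {J}. dil A k (x $ k))"
    using dil_prod_C11[where I = "UNIV - {J}" and A = A] by (elim exE)
  from C11_mult[OF C11_component[OF w_C11] this] show ?thesis by (auto simp: wkern_def[abs_def])
qed

lemma large_component:
  fixes x :: "real^'n"
  assumes "8 * CARD('n) < norm x"
  shows "\<exists>k. 8 \<le> \<bar>x $ k\<bar>"
proof (rule ccontr)
  assume "\<not> ?thesis"
  then have "\<bar>x $ k\<bar> \<le> 8" for k using linear by blast
  then have "(\<Sum>k\<in>UNIV. \<bar>x $ k\<bar>) \<le> (\<Sum>k\<in>(UNIV :: 'n set). 8)"
    by (intro sum_mono)
  with norm_le_l1_cart[of x] assms show False by simp
qed

lemma pkern_support:
  fixes x :: "real^'n"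
  assumes "8 * CARD('n) < norm x"
  shows "pkern A x = 0"
proof -
  obtain k where "8 \<le> \<bar>x $ k\<bar>" using large_component[OF assms] by blast
  then have "dil A k (x $ k) = 0" by (rule dil_support)
  then show ?thesis unfolding pkern_def by (intro prod_zero) auto
qed

lemma wkern_support:
  fixes x :: "real^'n"
  assumes "8 * CARD('n) < norm x"
  shows "wkern A J x = 0"
proof -
  obtain k where k: "8 \<le> \<bar>x $ k\<bar>" using large_component[OF assms] by blast
  show ?thesis
  proof (cases "k = J")
    case True then show ?thesis using k w_support by (simp add: wkern_def)
  next
    case False
    moreover have "dil A k (x $ k) = 0" using k by (rule dil_support)
    ultimately have "(\<Prod>k\<in>UNIV - {J}. dil A k (x $ k)) = 0"
      by (intro prod_zero) auto
    then show ?thesis by (simp add: wkern_def)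
  qed
qed

lemma pkern_nonneg: "0 \<le> pkern A x"
  unfolding pkern_def by (intro prod_nonneg ballI dil_nonneg)

lemma C11_measurable: "\<exists>C. C11 C (g :: 'a::euclidean_space \<Rightarrow> real) \<Longrightarrow> g \<in> borel_measurable borel"
  using C11_continuous borel_measurable_continuous_onI by metis

lemma dil_measurable [measurable]: "dil A k \<in> borel_measurable borel"
  by (rule C11_measurable[OF dil_C11])

lemma pkern_measurable [measurable]: "pkern A \<in> borel_measurable borel"
  by (rule C11_measurable[OF pkern_C11])

lemma dil_mass: "(\<integral>\<^sup>+t. ennreal (dil A k t) \<partial>lborel) = 1"
proof -
  have [measurable]: "\<kappa> \<in> borel_measurable borel"
    using C11_continuous[OF kernel_C11] by (rule borel_measurable_continuous_onI)
  have "(\<integral>\<^sup>+t. ennreal (\<kappa> (t / 2) / 2) \<partial>lborel) = ennreal \<bar>2\<bar> * (\<integral>\<^sup>+t. ennreal (\<kappa> ((0 + 2 * t) / 2) / 2) \<partial>lborel)"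
    by (rule nn_integral_real_affine) auto
  also have "\<dots> = (\<integral>\<^sup>+t. ennreal \<bar>2\<bar> * ennreal (\<kappa> t / 2) \<partial>lborel)"
    by (subst nn_integral_cmult) auto
  also have "\<dots> = (\<integral>\<^sup>+t. ennreal (\<kappa> t) \<partial>lborel)"
    using kernel_nonneg by (intro nn_integral_cong) (subst ennreal_mult[symmetric], auto)
  finally show ?thesis using kernel_mass by (cases "k \<in> A") (simp_all add: dil_def)
qed

lemma pkern_mass:
  fixes A :: "'n::finite set"
  shows "(\<integral>\<^sup>+x. ennreal (pkern A x) \<partial>lborel) = 1"
proof -
  let ?ax = "\<lambda>k :: 'n. axis k (1::real)"
  have inj: "inj_on ?ax UNIV" by (auto simp: inj_on_def axis_eq_axis)
  define i where "i = inv_into UNIV ?ax"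
  have i: "i (?ax k) = k" for k using inj by (simp add: i_def inv_f_f[OF inj])
  have B: "(Basis :: (real^'n) set) = ?ax ` UNIV" unfolding Basis_vec_def by auto
  have p: "pkern A x = (\<Prod>b\<in>Basis. dil A (i b) (x \<bullet> b))" for x :: "real^'n"
    unfolding B pkern_def prod.reindex[OF inj] by (simp add: i inner_axis)
  have "(\<integral>\<^sup>+x. ennreal (pkern A x) \<partial>lborel) = (\<integral>\<^sup>+x. (\<Prod>b\<in>Basis. ennreal (dil A (i b) (x \<bullet> b))) \<partial>lborel)"
    unfolding p by (simp add: prod_ennreal dil_nonneg)
  also have "\<dots> = (\<Prod>b\<in>(Basis :: (real^'n) set). \<integral>\<^sup>+t. ennreal (dil A (i b) t) \<partial>lborel)"
    by (rule nn_integral_lborel_prod) auto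
  also have "\<dots> = 1" by (simp add: dil_mass)
  finally show ?thesis .
qed

lemma pkern_integral:
  fixes A :: "'n::finite set"
  shows "(\<integral>x. pkern A x \<partial>lborel) = 1"
  by (subst integral_eq_nn_integral) (auto simp: pkern_mass pkern_nonneg)

lemma pkern_UNIV: "pkern UNIV (x :: real^'n) = pkern {} (x /\<^sub>R 2) / 2 ^ CARD('n)"
proof -
  have "(x /\<^sub>R 2) $ k = x $ k / 2" for k by simp
  then show ?thesis by (simp only: pkern_def dil_def UNIV_I empty_iff if_True if_False prod_dividef prod_constant)
qed

lemma wkern_derivative:
  fixes x :: "real^'n"
  assumes "J \<notin> A"
  shows "((\<lambda>t. wkern A J (x + t *\<^sub>R axis J 1)) has_real_derivative
      (pkern A (x + t *\<^sub>R axis J 1) - pkern (insert J A) (x + t *\<^sub>R axis J 1))) (at t)"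
proof -
  define c where "c = (\<Prod>k\<in>UNIV - {J}. dil A k (x $ k))"
  have comp: "(x + t *\<^sub>R axis J 1) $ k = (if k = J then x $ J + t else x $ k)" for t k
    by (auto simp: axis_def)
  have pr: "(\<Prod>k\<in>UNIV - {J}. dil A' k ((x + t *\<^sub>R axis J 1) $ k)) = c" if "A' - {J} = A - {J}" for t A'
    unfolding c_def comp using that by (intro prod.cong) (auto simp: dil_def)
  have W: "wkern A J (x + t *\<^sub>R axis J 1) = w (x $ J + t) * c" for t
    unfolding wkern_def pr[OF refl] unfolding comp by simp
  have P: "pkern A' (x + t *\<^sub>R axis J 1) = dil A' J (x $ J + t) * c" if "A' - {J} = A - {J}" for t A'
  proof -
    have "pkern A' (x + t *\<^sub>R axis J 1) = dil A' J ((x + t *\<^sub>R axis J 1) $ J)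
        * (\<Prod>k\<in>UNIV - {J}. dil A' k ((x + t *\<^sub>R axis J 1) $ k))"
      unfolding pkern_def by (rule prod.remove) auto
    then show ?thesis unfolding pr[OF that] unfolding comp by simp
  qed
  have "((\<lambda>t. w (x $ J + t) * c) has_real_derivative (\<kappa> (x $ J + t) - \<kappa> ((x $ J + t) / 2) / 2) * c) (at t)"
    using w_derivative[of "x $ J + t"] by (intro DERIV_cmult_right) (simp add: DERIV_shift add.commute)
  moreover have "pkern A (x + t *\<^sub>R axis J 1) - pkern (insert J A) (x + t *\<^sub>R axis J 1)
      = (\<kappa> (x $ J + t) - \<kappa> ((x $ J + t) / 2) / 2) * c"
    using assms by (subst (1 2) P) (auto simp: dil_def left_diff_distrib)
  ultimately show ?thesis unfolding W by simp
qed

definition avg :: "(real^'n) set \<Rightarrow> (real^'n \<Rightarrow> real) \<Rightarrow> real \<Rightarrow> real^'n \<Rightarrow> real" where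
  "avg Y g L x = smear Y (\<lambda>x. g (x /\<^sub>R L)) x / L ^ CARD('n)"

text \<open>The chain rule produces a factor 1 / L, compensated by the L in front: a primitive taken
  at scale L is L times larger.\<close>

lemma avg_wkern_derivative:
  fixes Y :: "(real^'n) set"
  assumes sep: "separated \<delta> Y" and "0 < L" and "J \<notin> A"
  shows "((\<lambda>t. L * avg Y (wkern A J) L (x + t *\<^sub>R axis J 1)) has_real_derivative
     (avg Y (pkern A) L (x + t *\<^sub>R axis J 1) - avg Y (pkern (insert J A)) L (x + t *\<^sub>R axis J 1))) (at t)"
proof -
  let ?r = "8 * CARD('n) * L" and ?a = "axis J 1 :: real^'n"
  \<comment> \<open>A common index set for all points of the line within distance 1 of the one
    considered, so that the derivative may be computed termwise.\<close>
  define F where "F = Y \<inter> cball (x + t *\<^sub>R ?a) (?r + 1)"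
  have supp: "g (z /\<^sub>R L) = 0" if "\<And>x. 8 * CARD('n) < norm x \<Longrightarrow> g x = 0" "?r < norm z"
    for g :: "real^'n \<Rightarrow> real" and z :: "real^'n"
    using that(2) \<open>0 < L\<close> by (intro that(1)) (simp add: field_simps)
  have eq: "smear Y (\<lambda>x. g (x /\<^sub>R L)) (x + s *\<^sub>R ?a) = (\<Sum>y\<in>F. g ((x + s *\<^sub>R ?a - y) /\<^sub>R L))"
    if "\<bar>s - t\<bar> \<le> 1" "\<And>x. 8 * CARD('n) < norm x \<Longrightarrow> g x = 0" for g s
    unfolding F_def
  proof (rule smear_locally_finite_sum[OF sep])
    show "norm (x + s *\<^sub>R ?a - (x + t *\<^sub>R ?a)) \<le> 1"
      using that(1) by (simp add: scaleR_diff_left[symmetric])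
  qed (use supp that(2) in blast)
  have "((\<lambda>s. \<Sum>y\<in>F. wkern A J ((x + s *\<^sub>R ?a - y) /\<^sub>R L)) has_real_derivative
      (\<Sum>y\<in>F. (pkern A ((x + t *\<^sub>R ?a - y) /\<^sub>R L) - pkern (insert J A) ((x + t *\<^sub>R ?a - y) /\<^sub>R L)) * (1 / L))) (at t)"
  proof (rule DERIV_sum)
    fix y
    have arg: "(x + s *\<^sub>R ?a - y) /\<^sub>R L = (x - y) /\<^sub>R L + (s / L) *\<^sub>R ?a" for s
      by (simp add: algebra_simps divide_inverse)
    show "((\<lambda>s. wkern A J ((x + s *\<^sub>R ?a - y) /\<^sub>R L)) has_real_derivative
      (pkern A ((x + t *\<^sub>R ?a - y) /\<^sub>R L) - pkern (insert J A) ((x + t *\<^sub>R ?a - y) /\<^sub>R L)) * (1 / L)) (at t)"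
      unfolding arg
      by (rule DERIV_chain2[OF wkern_derivative[OF \<open>J \<notin> A\<close>]]) (use \<open>0 < L\<close> in \<open>auto intro!: derivative_eq_intros\<close>)
  qed
  then have "((\<lambda>s. smear Y (\<lambda>x. wkern A J (x /\<^sub>R L)) (x + s *\<^sub>R ?a)) has_real_derivative
      (\<Sum>y\<in>F. (pkern A ((x + t *\<^sub>R ?a - y) /\<^sub>R L) - pkern (insert J A) ((x + t *\<^sub>R ?a - y) /\<^sub>R L)) * (1 / L))) (at t)"
  proof (rule has_field_derivative_transform_within[where d = 1])
    fix s assume "dist s t < 1"
    then show "(\<Sum>y\<in>F. wkern A J ((x + s *\<^sub>R ?a - y) /\<^sub>R L)) = smear Y (\<lambda>x. wkern A J (x /\<^sub>R L)) (x + s *\<^sub>R ?a)"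
      by (subst eq) (auto simp: dist_real_def wkern_support)
  qed auto
  moreover have "(\<Sum>y\<in>F. (pkern A ((x + t *\<^sub>R ?a - y) /\<^sub>R L) - pkern (insert J A) ((x + t *\<^sub>R ?a - y) /\<^sub>R L)) * (1 / L))
    = (smear Y (\<lambda>x. pkern A (x /\<^sub>R L)) (x + t *\<^sub>R ?a) - smear Y (\<lambda>x. pkern (insert J A) (x /\<^sub>R L)) (x + t *\<^sub>R ?a)) / L"
    by (subst (1 2) eq) (auto simp: pkern_support sum_subtractf sum_divide_distrib diff_divide_distrib)
  ultimately have d: "((\<lambda>s. smear Y (\<lambda>x. wkern A J (x /\<^sub>R L)) (x + s *\<^sub>R ?a)) has_real_derivative
     (smear Y (\<lambda>x. pkern A (x /\<^sub>R L)) (x + t *\<^sub>R ?a) - smear Y (\<lambda>x. pkern (insert J A) (x /\<^sub>R L)) (x + t *\<^sub>R ?a)) / L) (at t)"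
    by simp
  have "L / L ^ CARD('n) * ((a - b) / L) = a / L ^ CARD('n) - b / L ^ CARD('n)" for a b
    using \<open>0 < L\<close> by (simp add: diff_divide_distrib[symmetric])
  note val = this
  show ?thesis
    using DERIV_cmult[OF d, of "L / L ^ CARD('n)"] unfolding avg_def val by simp
qed

text \<open>The shear is built from v = L (avg wkern - c). Its size is at most L E and its Lipschitz
  constant E, while the target density has Lipschitz constant E / L, so all powers of L cancel in
  the distortion. Subtracting c leaves the derivative of v unchanged but makes v small.\<close>

lemma avg_pushes_step:
  fixes Y :: "(real^'n) set"
  assumes sep: "separated \<delta> Y" and "0 < L" and J: "J \<notin> A" and "0 < \<rho>" and E: "0 \<le> E" "E \<le> \<rho> / 16"
    and near: "\<And>A x. \<bar>avg Y (pkern A) L x - \<rho>\<bar> \<le> E"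
    and lip: "\<And>A x y. \<bar>avg Y (pkern A) L x - avg Y (pkern A) L y\<bar> \<le> E / L * norm (x - y)"
    and wnear: "\<And>x. \<bar>avg Y (wkern A J) L x - c\<bar> \<le> E"
    and wlip: "\<And>x y. \<bar>avg Y (wkern A J) L x - avg Y (wkern A J) L y\<bar> \<le> E / L * norm (x - y)"
  shows "pushes (1 + 8 * E / \<rho>) (avg Y (pkern A) L) (avg Y (pkern (insert J A)) L)"
proof -
  have cont: "continuous_on UNIV (avg Y (pkern A) L)" for A
  proof (rule lipschitz_on_continuous_on)
    show "(E / L)-lipschitz_on UNIV (avg Y (pkern A) L)"
      using lip E \<open>0 < L\<close> by (intro lipschitz_onI) (auto simp: dist_norm)
  qed
  define m where "m = \<rho> / 2"
  have m: "0 < m" using \<open>0 < \<rho>\<close> by (simp add: m_def)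
  have low: "m \<le> avg Y (pkern A) L x" for A x
    using near[of A x] E \<open>0 < \<rho>\<close> by (simp add: m_def abs_le_iff)
  define v where "v x = L * avg Y (wkern A J) L x - L * c" for x
  have vd: "((\<lambda>t. v (x + t *\<^sub>R axis J 1)) has_real_derivative
     (avg Y (pkern A) L (x + t *\<^sub>R axis J 1) - avg Y (pkern (insert J A)) L (x + t *\<^sub>R axis J 1))) (at t)" for x t
    unfolding v_def using DERIV_diff[OF avg_wkern_derivative[OF sep \<open>0 < L\<close> J] DERIV_const] by simp
  have vb: "\<bar>v x\<bar> \<le> L * E" for x
    using wnear[of x] \<open>0 < L\<close> by (simp add: v_def right_diff_distrib[symmetric] abs_mult)
  have vlip: "\<bar>v x - v y\<bar> \<le> E * norm (x - y)" for x y
  proof -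
    have "\<bar>v x - v y\<bar> = L * \<bar>avg Y (wkern A J) L x - avg Y (wkern A J) L y\<bar>"
      using \<open>0 < L\<close> by (simp add: v_def right_diff_distrib[symmetric] abs_mult)
    also have "\<dots> \<le> L * (E / L * norm (x - y))" using wlip \<open>0 < L\<close> by (intro mult_left_mono) auto
    finally show ?thesis using \<open>0 < L\<close> by simp
  qed
  define d where "d = (E + L * E / m * (E / L)) / m"
  obtain T where T: "\<And>x y. norm (T x - T y) \<le> (1 + d) * norm (x - y)"
    "\<And>x y. (1 - d) * norm (x - y) \<le> norm (T x - T y)"
    and Tg: "\<And>g. g \<in> borel_measurable borel \<Longrightarrow>
      (\<integral>\<^sup>+x. g (T x) * ennreal (avg Y (pkern A) L x) \<partial>lborel)
       = (\<integral>\<^sup>+x. g x * ennreal (avg Y (pkern (insert J A)) L x) \<partial>lborel)"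
    using shear_transport[of "axis J 1" m, OF _ m cont cont low low vd vb vlip lip d_def] by auto
  have d0: "0 \<le> d" using E m \<open>0 < L\<close> by (auto simp: d_def)
  have "d = (E + E * (E / m)) / m" using \<open>0 < L\<close> by (simp add: d_def)
  also have "\<dots> \<le> (E + E * 1) / m"
    using E m by (intro divide_right_mono add_left_mono mult_left_mono) (auto simp: m_def)
  finally have d4: "d \<le> 4 * E / \<rho>" by (simp add: m_def)
  moreover have "4 * E / \<rho> \<le> 1 / 4" using E \<open>0 < \<rho>\<close> by (simp add: field_simps)
  ultimately have d2: "d \<le> 1 / 2" by simp
  have q1: "1 + d \<le> 1 + 8 * E / \<rho>" using d4 d0 by simp
  \<comment> \<open>Inverting 1 - d costs a factor 1 + 2 d, valid for d \<le> 1/2; with d \<le> 4 E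
    / \<rho> this is the 8 in the statement.\<close>
  have q2: "1 \<le> (1 + 8 * E / \<rho>) * (1 - d)"
  proof -
    have "0 \<le> d * (1 - 2 * d)" using d0 d2 by simp
    then have "1 \<le> (1 + 2 * d) * (1 - d)" by (simp add: algebra_simps)
    also have "\<dots> \<le> (1 + 8 * E / \<rho>) * (1 - d)" using d4 d2 by (intro mult_right_mono) auto
    finally show ?thesis .
  qed
  have "norm (T x - T y) \<le> (1 + 8 * E / \<rho>) * norm (x - y)" for x y
    using T(1)[of x y] mult_right_mono[OF q1, of "norm (x - y)"] by simp
  moreover have "norm (x - y) \<le> (1 + 8 * E / \<rho>) * norm (T x - T y)" for x y
  proof -
    have "1 * norm (x - y) \<le> (1 + 8 * E / \<rho>) * (1 - d) * norm (x - y)"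
      using q2 by (rule mult_right_mono) simp
    also have "\<dots> \<le> (1 + 8 * E / \<rho>) * norm (T x - T y)"
      unfolding mult.assoc using T(2) E \<open>0 < \<rho>\<close> by (intro mult_left_mono) auto
    finally show ?thesis by simp
  qed
  ultimately show ?thesis using Tg unfolding pushes_def by blast
qed

end

context smoothing_kernel begin

lemma avg_dilate:
  fixes Y :: "(real^'n) set"
  shows "avg Y (pkern UNIV) L = avg Y (pkern {}) (2 * L)"
proof
  fix x :: "real^'n"
  have "pkern UNIV (z /\<^sub>R L) = 1 / 2 ^ CARD('n) * pkern {} (z /\<^sub>R (2 * L))" for z :: "real^'n"
    by (simp add: pkern_UNIV)
  then have "smear Y (\<lambda>x. pkern UNIV (x /\<^sub>R L)) x = 1 / 2 ^ CARD('n) * smear Y (\<lambda>x. pkern {} (x /\<^sub>R (2 * L))) x"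
    by (simp only:) (rule smear_scale, simp)
  then show "avg Y (pkern UNIV) L x = avg Y (pkern {}) (2 * L) x"
    by (simp add: avg_def power_mult_distrib)
qed

text \<open>Each doubling of the scale takes one shear per coordinate. As the errors are summable,
  the total distortion is at most q regardless of the number of doublings, while the final density
  tends to \<rho>. The initial density is the smear of Y by a fixed kernel of mass one.\<close>

theorem rectifiable_if_uniform_discrepancy:
  fixes Y :: "(real^'n) set"
  assumes sep: "separated \<delta> Y" and "0 < \<rho>" and disc: "uniform_discrepancy Y \<rho> e"
    and e0: "\<And>L. 0 \<le> e L" and summ: "summable (\<lambda>i. e (2 ^ i))"
  shows "bilipschitz_equivalent Y (integer_lattice :: (real^'n) set)"
proof -
  let ?n = "CARD('n)"
  \<comment> \<open>All kernels that occur are indexed by a finite type, \<open>None\<close> marking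
    \<open>pkern\<close> and \<open>Some J\<close> marking \<open>wkern\<close>. Their constants and
    thresholds can thus be replaced by common ones, namely the sums.\<close>
  define G where "G i = (case i of (A, None) \<Rightarrow> pkern A | (A, Some J) \<Rightarrow> wkern A J)"
    for i :: "'n set \<times> 'n option"
  have GC: "\<exists>C. C11 C (G i)" for i
  proof (cases i)
    case (Pair A j)
    then show ?thesis using pkern_C11[of A] wkern_C11[of A] by (cases j) (simp_all add: G_def)
  qed
  have Gs: "G i x = 0" if "8 * ?n < norm x" for i x
  proof (cases i)
    case (Pair A j)
    then show ?thesis using pkern_support[OF that] wkern_support[OF that] by (cases j) (simp_all add: G_def)
  qed
  define P where "P C L0 i \<longleftrightarrow> 0 \<le> C \<and> 1 \<le> L0 \<and> (\<forall>L\<ge>L0. \<forall>x y.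
     \<bar>avg Y (G i) L x - \<rho> * (\<integral>x. G i x \<partial>lborel)\<bar> \<le> C * e L \<and>
     \<bar>avg Y (G i) L x - avg Y (G i) L y\<bar> \<le> C * e L / L * norm (x - y))" for C L0 i
  have "\<exists>C L0. P C L0 i" for i
  proof -
    obtain B where "C11 B (G i)" using GC[of i] by (elim exE)
    from smear_oscillation[OF sep disc e0 this Gs] show ?thesis unfolding P_def avg_def by blast
  qed
  then have "\<forall>i. \<exists>p. P (fst p) (snd p) i" by auto
  then obtain p where "\<And>i. P (fst (p i)) (snd (p i)) i" using choice[of "\<lambda>i p. P (fst p) (snd p) i"] by blast
  moreover define C where "C i = fst (p i)" for i
  moreover define L0 where "L0 i = snd (p i)" for i
  ultimately have PC: "P (C i) (L0 i) i" for i by simp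
  have C: "0 \<le> C i" and L0: "1 \<le> L0 i" for i using PC[of i] by (simp_all add: P_def)
  have near: "\<bar>avg Y (G i) L x - \<rho> * (\<integral>x. G i x \<partial>lborel)\<bar> \<le> C i * e L"
    and osc: "\<bar>avg Y (G i) L x - avg Y (G i) L y\<bar> \<le> C i * e L / L * norm (x - y)"
    if "L0 i \<le> L" for i L x y
    using PC[of i] that unfolding P_def by blast+
  define c where "c = sum C UNIV"
  define l where "l = sum L0 UNIV"
  have Cc: "C i \<le> c" and Ll: "L0 i \<le> l" for i
    unfolding c_def l_def using C L0 by (auto intro!: member_le_sum intro: order_trans[OF zero_le_one])
  have "0 \<le> c" using C unfolding c_def by (simp add: sum_nonneg)
  define E where "E i = c * e (2 ^ i)" for i :: nat
  have E0: "0 \<le> E i" for i using \<open>0 \<le> c\<close> e0 by (simp add: E_def)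
  have sE: "summable E" unfolding E_def using summ by (rule summable_mult)
  then have Elim: "E \<longlonglongrightarrow> 0" by (rule summable_LIMSEQ_zero)
  have "\<forall>\<^sub>F i in sequentially. E i < \<rho> / 16"
    using Elim \<open>0 < \<rho>\<close> by (intro order_tendstoD) auto
  moreover have "\<forall>\<^sub>F i in sequentially. l \<le> 2 ^ i"
  proof -
    obtain M where "l < 2 ^ M" using real_arch_pow[of 2 l] by auto
    moreover have "(2::real) ^ M \<le> 2 ^ i" if "M \<le> i" for i using that by simp
    ultimately show ?thesis
      unfolding eventually_sequentially by (meson less_imp_le order_trans)
  qed
  ultimately have "\<forall>\<^sub>F i in sequentially. E i < \<rho> / 16 \<and> l \<le> 2 ^ i" by (rule eventually_conj)
  then obtain N where N: "\<And>i. N \<le> i \<Longrightarrow> E i < \<rho> / 16 \<and> l \<le> 2 ^ i"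
    by (auto simp: eventually_sequentially)
  have near': "\<bar>avg Y (G j) (2 ^ i) x - \<rho> * (\<integral>x. G j x \<partial>lborel)\<bar> \<le> E i"
    and osc': "\<bar>avg Y (G j) (2 ^ i) x - avg Y (G j) (2 ^ i) y\<bar> \<le> E i / 2 ^ i * norm (x - y)"
    if "N \<le> i" for i j x y
  proof -
    have i: "L0 j \<le> 2 ^ i" using N[OF that] Ll[of j] by linarith
    have "C j * e (2 ^ i) \<le> E i" unfolding E_def using Cc e0 by (intro mult_right_mono)
    then show "\<bar>avg Y (G j) (2 ^ i) x - \<rho> * (\<integral>x. G j x \<partial>lborel)\<bar> \<le> E i"
      using near[OF i, of x] by linarith
    have "C j * e (2 ^ i) / 2 ^ i * norm (x - y) \<le> E i / 2 ^ i * norm (x - y)"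
      using \<open>C j * e (2 ^ i) \<le> E i\<close> by (intro mult_right_mono divide_right_mono) auto
    then show "\<bar>avg Y (G j) (2 ^ i) x - avg Y (G j) (2 ^ i) y\<bar> \<le> E i / 2 ^ i * norm (x - y)"
      using osc[OF i, of x y] by linarith
  qed
  have Gp: "G (A, None) = pkern A" "G (A, Some J) = wkern A J" for A J by (simp_all add: G_def)
  define a where "a i = ?n * (8 * E i / \<rho>)" for i
  have a0: "0 \<le> a i" for i using E0 \<open>0 < \<rho>\<close> by (simp add: a_def)
  \<comment> \<open>Induction over the coordinates dilated so far; at A = UNIV the kernel is that of
    the doubled scale, by \<open>avg_dilate\<close>.\<close>
  have step: "pushes (exp (a i)) (avg Y (pkern {}) (2 ^ i)) (avg Y (pkern {}) (2 ^ Suc i))" if i: "N \<le> i" for i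
  proof -
    have q0: "0 \<le> 1 + 8 * E i / \<rho>" using E0[of i] \<open>0 < \<rho>\<close> by simp
    have "pushes ((1 + 8 * E i / \<rho>) ^ card A) (avg Y (pkern {}) (2 ^ i)) (avg Y (pkern A) (2 ^ i))"
      if "finite A" for A :: "'n set"
      using that
    proof (induction A rule: finite_induct)
      case empty
      show ?case by (simp add: pushes_refl)
    next
      case (insert J A)
      have "pushes (1 + 8 * E i / \<rho>) (avg Y (pkern A) (2 ^ i)) (avg Y (pkern (insert J A)) (2 ^ i))"
      proof (rule avg_pushes_step[OF sep _ insert(2) \<open>0 < \<rho>\<close> E0])
        show "E i \<le> \<rho> / 16" using N[OF i] by simp
        show "\<bar>avg Y (pkern A') (2 ^ i) x - \<rho>\<bar> \<le> E i" for A' x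
          using near'[OF i, of "(A', None)" x] by (simp add: Gp pkern_integral)
        show "\<bar>avg Y (pkern A') (2 ^ i) x - avg Y (pkern A') (2 ^ i) y\<bar> \<le> E i / 2 ^ i * norm (x - y)" for A' x y
          using osc'[OF i, of "(A', None)" x y] by (simp add: Gp)
        show "\<bar>avg Y (wkern A J) (2 ^ i) x - \<rho> * (\<integral>x. wkern A J x \<partial>lborel)\<bar> \<le> E i" for x
          using near'[OF i, of "(A, Some J)" x] by (simp add: Gp)
        show "\<bar>avg Y (wkern A J) (2 ^ i) x - avg Y (wkern A J) (2 ^ i) y\<bar> \<le> E i / 2 ^ i * norm (x - y)" for x y
          using osc'[OF i, of "(A, Some J)" x y] by (simp add: Gp)
      qed simp
      from pushes_trans[OF insert(3) this _ q0] q0 insert(1,2) show ?case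
        by (simp add: mult.commute)
    qed
    from this[of UNIV] have "pushes ((1 + 8 * E i / \<rho>) ^ ?n) (avg Y (pkern {}) (2 ^ i)) (avg Y (pkern {}) (2 * 2 ^ i))"
      by (simp add: avg_dilate)
    moreover have "(1 + 8 * E i / \<rho>) ^ ?n \<le> exp (a i)"
    proof -
      have "(1 + 8 * E i / \<rho>) ^ ?n \<le> exp (8 * E i / \<rho>) ^ ?n"
        using q0 by (intro power_mono exp_ge_add_one_self)
      also have "\<dots> = exp (a i)" unfolding a_def by (simp only: exp_of_nat_mult)
      finally show ?thesis .
    qed
    ultimately show ?thesis by (simp add: pushes_mono)
  qed
  have iter: "pushes (exp (\<Sum>i<k. a (i + N))) (avg Y (pkern {}) (2 ^ N)) (avg Y (pkern {}) (2 ^ (k + N)))" for k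
  proof (induction k)
    case 0
    show ?case by (simp add: pushes_refl)
  next
    case (Suc k)
    have "pushes (exp (\<Sum>i<k. a (i + N)) * exp (a (k + N))) (avg Y (pkern {}) (2 ^ N)) (avg Y (pkern {}) (2 ^ Suc (k + N)))"
      by (rule pushes_trans[OF Suc step]) auto
    then show ?case by (simp add: exp_add)
  qed
  have "summable a" unfolding a_def using sE by (intro summable_mult summable_divide)
  then have sa: "summable (\<lambda>i. a (i + N))" by (simp add: summable_iff_shift)
  define q where "q = exp (\<Sum>i. a (i + N))"
  have iter': "pushes q (avg Y (pkern {}) (2 ^ N)) (avg Y (pkern {}) (2 ^ (k + N)))" for k
    unfolding q_def using a0 by (intro pushes_mono[OF iter] iffD2[OF exp_le_cancel_iff] sum_le_suminf[OF sa]) auto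
  let ?L = "2 ^ N :: real"
  let ?K = "\<lambda>x :: real^'n. 1 / ?L ^ ?n * pkern {} (x /\<^sub>R ?L) :: real"
  have sm: "smear Y ?K x = avg Y (pkern {}) ?L x" for x
    by (subst smear_scale) (auto simp: avg_def)
  show ?thesis
  proof (rule bilipschitz_integer_lattice_if_volume_preserving[OF sep, of ?K "8 * ?n * ?L" \<rho> q])
    show "0 \<le> ?K x" for x by (simp add: pkern_nonneg)
    show "?K \<in> borel_measurable borel" by measurable
    show "?K x = 0" if "8 * ?n * ?L < norm x" for x
      using that by (subst pkern_support) (auto simp: field_simps)
    have "(\<integral>x. ?K x \<partial>lborel) = 1"
      by (simp add: integral_lborel_scale pkern_integral)
    moreover have "integrable lborel ?K"
    proof -
      obtain B where B: "C11 B (pkern {} :: real^'n \<Rightarrow> real)" using pkern_C11 by blast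
      have "integrable lborel (\<lambda>x :: real^'n. pkern {} (x /\<^sub>R ?L))"
      proof (rule integrable_bounded_support[of _ B "8 * ?n * ?L"])
        show "pkern {} (x /\<^sub>R ?L) = 0" if "8 * ?n * ?L < norm x" for x :: "real^'n"
          using that by (subst pkern_support) (auto simp: field_simps)
        show "\<bar>pkern {} (x /\<^sub>R ?L)\<bar> \<le> B" for x :: "real^'n" by (rule C11_bound[OF B])
      qed measurable
      then show ?thesis by (rule integrable_mult_right)
    qed
    ultimately show "(\<integral>\<^sup>+x. ennreal (?K x) \<partial>lborel) = 1"
      by (subst nn_integral_eq_integral) (auto simp: pkern_nonneg)
    show "0 < q" by (simp add: q_def)
    fix \<epsilon> :: real assume "0 < \<epsilon>"
    then have "\<forall>\<^sub>F i in sequentially. E i < \<epsilon>" using Elim by (intro order_tendstoD) auto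
    then obtain k where "\<And>i. k \<le> i \<Longrightarrow> E i < \<epsilon>" by (auto simp: eventually_sequentially)
    then have k: "E (k + N) < \<epsilon>" by simp
    define f where "f = avg Y (pkern {}) (2 ^ (k + N))"
    have f: "\<bar>f x - \<rho>\<bar> \<le> \<epsilon>" for x
      using near'[of "k + N" "({}, None)" x] k by (simp add: Gp pkern_integral f_def)
    obtain T where T: "\<And>x y. norm (T x - T y) \<le> q * norm (x - y)" "\<And>x y. norm (x - y) \<le> q * norm (T x - T y)"
      and Tg: "\<And>g. g \<in> borel_measurable borel \<Longrightarrow>
        (\<integral>\<^sup>+x. g (T x) * ennreal (avg Y (pkern {}) ?L x) \<partial>lborel) = (\<integral>\<^sup>+x. g x * ennreal (f x) \<partial>lborel)"
      using iter'[of k] unfolding pushes_def f_def by blast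
    \<comment> \<open>Subtracting T 0 makes the map fix the origin, and Lebesgue measure does not
      notice the translation. The two bounds hold because f differs from \<rho> by at most
      \<epsilon> everywhere.\<close>
    have vol: "ennreal (\<rho> - \<epsilon>) * emeasure lborel V \<le> (\<integral>\<^sup>+x. ennreal (smear Y ?K x) * indicator V (T x - T 0) \<partial>lborel) \<and>
          (\<integral>\<^sup>+x. ennreal (smear Y ?K x) * indicator V (T x - T 0) \<partial>lborel) \<le> ennreal (\<rho> + \<epsilon>) * emeasure lborel V"
      if [measurable]: "V \<in> sets borel" for V
    proof -
      let ?I = "\<lambda>x. indicator V (x - T 0) :: ennreal"
      have I: "(\<integral>\<^sup>+x. ?I x \<partial>lborel) = emeasure lborel V"
        by (subst nn_integral_lborel_translate) auto
      have eq: "(\<integral>\<^sup>+x. ennreal (smear Y ?K x) * indicator V (T x - T 0) \<partial>lborel) = (\<integral>\<^sup>+x. ?I x * ennreal (f x) \<partial>lborel)"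
        unfolding sm by (subst Tg[symmetric]) (auto simp: mult.commute)
      have "ennreal (\<rho> - \<epsilon>) * emeasure lborel V = (\<integral>\<^sup>+x. ?I x * ennreal (\<rho> - \<epsilon>) \<partial>lborel)"
        unfolding I[symmetric] by (subst nn_integral_multc) (auto simp: mult.commute)
      also have "\<dots> \<le> (\<integral>\<^sup>+x. ?I x * ennreal (f x) \<partial>lborel)"
        using f by (intro nn_integral_mono mult_left_mono ennreal_leI) (auto simp: abs_le_iff algebra_simps)
      finally have 1: "ennreal (\<rho> - \<epsilon>) * emeasure lborel V \<le> (\<integral>\<^sup>+x. ?I x * ennreal (f x) \<partial>lborel)" .
      have "(\<integral>\<^sup>+x. ?I x * ennreal (f x) \<partial>lborel) \<le> (\<integral>\<^sup>+x. ?I x * ennreal (\<rho> + \<epsilon>) \<partial>lborel)"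
        using f by (intro nn_integral_mono mult_left_mono ennreal_leI) (auto simp: abs_le_iff algebra_simps)
      also have "\<dots> = ennreal (\<rho> + \<epsilon>) * emeasure lborel V"
        unfolding I[symmetric] by (subst nn_integral_multc) (auto simp: mult.commute)
      finally show ?thesis using 1 unfolding eq by blast
    qed
    show "\<exists>S. nearly_volume_preserving q \<rho> \<epsilon> (smear Y ?K) S"
      unfolding nearly_volume_preserving_def
    proof (rule exI[of _ "\<lambda>x. T x - T 0"], intro conjI allI ballI impI)
      fix V :: "(real^'n) set" assume "V \<in> sets borel"
      from vol[OF this] show
        "ennreal (\<rho> - \<epsilon>) * emeasure lborel V \<le> (\<integral>\<^sup>+x. ennreal (smear Y ?K x) * indicator V (T x - T 0) \<partial>lborel)"
        "(\<integral>\<^sup>+x. ennreal (smear Y ?K x) * indicator V (T x - T 0) \<partial>lborel) \<le> ennreal (\<rho> + \<epsilon>) * emeasure lborel V"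
        by blast+
    qed (use T in \<open>simp_all\<close>)
  qed (use \<open>0 < \<rho>\<close> in auto)
qed

end

theorem bilipschitz_integer_lattice_if_uniform_discrepancy:
  fixes Y :: "(real^'n) set"
  assumes "separated \<delta> Y" "0 < \<rho>" "uniform_discrepancy Y \<rho> e"
    and "\<And>L. 0 \<le> e L" "summable (\<lambda>i. e (2 ^ i))"
  shows "bilipschitz_equivalent Y (integer_lattice :: (real^'n) set)"
proof (rule ex_smoothing_kernel)
  fix \<kappa> w :: "real \<Rightarrow> real" and B
  assume "\<And>t. 0 \<le> \<kappa> t" "\<And>t. 4 \<le> \<bar>t\<bar> \<Longrightarrow> \<kappa> t = 0" "\<And>t. 4 \<le> \<bar>t\<bar> \<Longrightarrow> w t = 0"
    "C11 B \<kappa>" "C11 B w" "\<And>t. (w has_real_derivative (\<kappa> t - \<kappa> (t / 2) / 2)) (at t)"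
    "(\<integral>\<^sup>+t. ennreal (\<kappa> t) \<partial>lborel) = 1"
  then interpret smoothing_kernel \<kappa> w B by unfold_locales
  show ?thesis using assms by (rule rectifiable_if_uniform_discrepancy)
qed

section \<open>Transference\<close>

text \<open>The dual relative to a subspace V, because the induction on the dimension passes to
  hyperplanes of V.\<close>

definition dual_in :: "'a::euclidean_space set \<Rightarrow> 'a set \<Rightarrow> 'a set" where
  "dual_in V L = {y\<in>V. \<forall>g\<in>L. inner y g \<in> \<int>}"

definition add_subgroup :: "'a::ab_group_add set \<Rightarrow> bool" where
  "add_subgroup L \<longleftrightarrow> 0 \<in> L \<and> (\<forall>x\<in>L. \<forall>y\<in>L. x - y \<in> L)"

lemma add_subgroup_0: "add_subgroup L \<Longrightarrow> 0 \<in> L"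
  and add_subgroup_diff: "add_subgroup L \<Longrightarrow> x \<in> L \<Longrightarrow> y \<in> L \<Longrightarrow> x - y \<in> L"
  by (auto simp: add_subgroup_def)

lemma add_subgroup_uminus: "add_subgroup L \<Longrightarrow> x \<in> L \<Longrightarrow> - x \<in> L"
  using add_subgroup_diff[of L 0 x] add_subgroup_0[of L] by simp

lemma add_subgroup_add: "add_subgroup L \<Longrightarrow> x \<in> L \<Longrightarrow> y \<in> L \<Longrightarrow> x + y \<in> L"
  using add_subgroup_diff[of L x "- y"] add_subgroup_uminus[of L y] by simp

lemma add_subgroup_of_nat:
  fixes x :: "'a::real_vector"
  assumes "add_subgroup L" "x \<in> L"
  shows "of_nat n *\<^sub>R x \<in> L"
  by (induction n) (use assms add_subgroup_0 add_subgroup_add in \<open>auto simp: scaleR_add_left\<close>)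

lemma add_subgroup_of_int:
  fixes x :: "'a::real_vector"
  assumes "add_subgroup L" "x \<in> L"
  shows "of_int k *\<^sub>R x \<in> L"
proof (cases k)
  case (nonneg n)
  then show ?thesis using add_subgroup_of_nat[OF assms, of n] by simp
next
  case (neg n)
  then have "of_int k *\<^sub>R x = - (of_nat (Suc n) *\<^sub>R x)" by (simp del: of_nat_Suc)
  then show ?thesis using add_subgroup_uminus[OF assms(1) add_subgroup_of_nat[OF assms, of "Suc n"]] by metis
qed

lemma add_subgroup_sum:
  "add_subgroup L \<Longrightarrow> (\<And>i. i \<in> I \<Longrightarrow> f i \<in> L) \<Longrightarrow> sum f I \<in> L"
  by (induction I rule: infinite_finite_induct) (auto intro: add_subgroup_0 add_subgroup_add)

lemma int_subgroup_generator:
  fixes M :: "int set"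
  assumes M: "add_subgroup M"
  shows "\<exists>d\<ge>0. d \<in> M \<and> (\<forall>m\<in>M. d dvd m)"
proof (cases "M = {0}")
  case False
  then obtain m where "m \<in> M" "m \<noteq> 0" using add_subgroup_0[OF M] by blast
  then have "\<bar>m\<bar> \<in> M" "0 < \<bar>m\<bar>" using add_subgroup_uminus[OF M] by (auto simp: abs_if)
  then have ex: "0 < nat \<bar>m\<bar> \<and> int (nat \<bar>m\<bar>) \<in> M" by simp
  define d where "d = (LEAST n. 0 < n \<and> int n \<in> M)"
  have d: "0 < d" "int d \<in> M" using LeastI[of "\<lambda>n. 0 < n \<and> int n \<in> M", OF ex] by (auto simp: d_def)
  have "int d dvd k" if k: "k \<in> M" for k
  proof (rule ccontr)
    assume "\<not> int d dvd k"
    then have "k mod int d \<noteq> 0" by (simp add: dvd_eq_mod_eq_0)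
    moreover have "0 \<le> k mod int d" "k mod int d < int d" using d by auto
    ultimately have r: "0 < nat (k mod int d)" "nat (k mod int d) < d" by auto
    have "k mod int d = k - of_int (k div int d) * int d" by (simp add: minus_div_mult_eq_mod)
    moreover have "of_int j * int d \<in> M" for j
    proof -
      have nat: "of_nat n * int d \<in> M" for n :: nat
        by (induction n) (use M d add_subgroup_0 add_subgroup_add in \<open>auto simp: distrib_right\<close>)
      show ?thesis
      proof (cases j)
        case (neg n)
        have "- (of_nat (Suc n) * int d) \<in> M" by (rule add_subgroup_uminus[OF M nat])
        then show ?thesis using neg by (simp del: of_nat_Suc)
      qed (use nat in simp)
    qed
    ultimately have "k mod int d \<in> M" using add_subgroup_diff[OF M k] by metis
    then have "0 < nat (k mod int d) \<and> int (nat (k mod int d)) \<in> M" using r by simp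
    then have "d \<le> nat (k mod int d)" unfolding d_def by (rule Least_le)
    with r show False by simp
  qed
  with d show ?thesis by (intro exI[of _ "int d"]) auto
qed auto

text \<open>The covering radius of L times a lower bound for the nonzero dual vectors is at most C.
  That the dual spans V makes L discrete, and the bound \<mu> forces L to have full rank in
  V.\<close>

definition transference_bound :: "'a::euclidean_space itself \<Rightarrow> real \<Rightarrow> nat \<Rightarrow> bool" where
  "transference_bound _ C k \<longleftrightarrow> (\<forall>V L \<mu>. subspace V \<longrightarrow> dim (V :: 'a set) \<le> k \<longrightarrow> L \<subseteq> V \<longrightarrow> add_subgroup L \<longrightarrow>
     V \<subseteq> span (dual_in V L) \<longrightarrow> 0 < \<mu> \<longrightarrow> (\<forall>y\<in>dual_in V L. y \<noteq> 0 \<longrightarrow> \<mu> \<le> norm y) \<longrightarrow>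
     (\<forall>x\<in>V. \<exists>g\<in>L. norm (x - g) \<le> C / \<mu>))"

text \<open>Transference by induction on the dimension: split the lattice into layers orthogonal to an almost
  shortest dual vector \<open>y\<close>. Every dual vector \<open>z\<close> of the layer through the origin lifts to a dual vector
  \<open>z + t y\<close> with \<open>\<bar>t\<bar> \<le> 1/2\<close>, so that \<open>z\<close> cannot be much shorter than \<open>y\<close>.\<close>

lemma transference: "\<exists>C\<ge>0. transference_bound TYPE('a::euclidean_space) C k"
proof (induction k)
  case 0
  show ?case
    unfolding transference_bound_def
  proof (intro exI[of _ 0] conjI allI impI ballI)
    fix V L :: "'a set" and \<mu> x
    assume "subspace V" "dim V \<le> 0" "add_subgroup L" "x \<in> V"
    then show "\<exists>g\<in>L. norm (x - g) \<le> 0 / \<mu>"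
      using dim_eq_0[of V] by (intro bexI[of _ 0]) (auto simp: add_subgroup_0)
  qed simp
next
  case (Suc k)
  then obtain C where "0 \<le> C" and "transference_bound TYPE('a) C k" by (elim exE conjE)
  note IH = this(2)[unfolded transference_bound_def, rule_format]
  show ?case
    unfolding transference_bound_def
  proof (intro exI[of _ "1 / 2 + 2 * C"] conjI allI impI ballI)
    fix V L :: "'a set" and \<mu> x
    assume V: "subspace V" "dim V \<le> Suc k" and LV: "L \<subseteq> V" and L: "add_subgroup L"
      and sp: "V \<subseteq> span (dual_in V L)" and "0 < \<mu>"
      and \<mu>: "\<forall>y\<in>dual_in V L. y \<noteq> 0 \<longrightarrow> \<mu> \<le> norm y" and x: "x \<in> V"
    let ?D = "dual_in V L"
    show "\<exists>g\<in>L. norm (x - g) \<le> (1 / 2 + 2 * C) / \<mu>"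
    proof (cases "?D - {0} = {}")
      case True
      then have "?D \<subseteq> {0}" by blast
      then have "span ?D \<subseteq> {0}" using span_mono[of ?D "{0}"] by simp
      with sp x have "x = 0" by blast
      then show ?thesis using L \<open>0 \<le> C\<close> \<open>0 < \<mu>\<close>
        by (intro bexI[of _ 0]) (auto simp: add_subgroup_0)
    next
      case False
      define I where "I = Inf (norm ` (?D - {0}))"
      have bdd: "bdd_below (norm ` (?D - {0}))" by (intro bdd_belowI[of _ 0]) auto
      have I\<mu>: "\<mu> \<le> I" unfolding I_def using False \<mu> by (intro cInf_greatest) auto
      have Ile: "I \<le> norm y" if "y \<in> ?D" "y \<noteq> 0" for y
        unfolding I_def using that bdd by (intro cInf_lower) auto
      \<comment> \<open>An infimum is enough, attained up to a factor 3/2. This factor is below 2,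
        which makes y primitive; and as 3/2 times 1/2 is 3/4, it leaves at least (1 - 9/16) I^2
        \<ge> I^2 / 4 for the squared length of z.\<close>
      have "I < 3 / 2 * I" using I\<mu> \<open>0 < \<mu>\<close> by simp
      then obtain y where y: "y \<in> ?D" "y \<noteq> 0" "norm y < 3 / 2 * I"
        using False cInf_lessD[of "norm ` (?D - {0})" "3 / 2 * I"] unfolding I_def by auto
      have yV: "y \<in> V" and yL: "\<And>g. g \<in> L \<Longrightarrow> inner y g \<in> \<int>" using y by (auto simp: dual_in_def)
      have ymu: "\<mu> \<le> norm y" using Ile[OF y(1,2)] I\<mu> by simp
      have yy: "0 < inner y y" using y by simp
      define M where "M = {m :: int. \<exists>g\<in>L. inner y g = of_int m}"
      have "add_subgroup M"
        unfolding add_subgroup_def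
      proof (intro conjI ballI)
        show "0 \<in> M" using add_subgroup_0[OF L] by (auto simp: M_def intro!: bexI[of _ 0])
        fix m n assume "m \<in> M" "n \<in> M"
        then obtain g h where "g \<in> L" "h \<in> L" "inner y g = of_int m" "inner y h = of_int n" by (auto simp: M_def)
        then show "m - n \<in> M"
          using add_subgroup_diff[OF L] by (auto simp: M_def inner_diff_right intro!: bexI[of _ "g - h"])
      qed
      then obtain d where d: "0 \<le> d" "d \<in> M" "\<And>m. m \<in> M \<Longrightarrow> d dvd m" using int_subgroup_generator by blast
      \<comment> \<open>If all values y . g were multiples of some c \<ge> 2, then y / c would be a
        dual vector shorter than the infimum. For d = 0 all values vanish and c = 2 will do.\<close>
      have "d = 1"
      proof (rule ccontr)
        assume "d \<noteq> 1"
        define c where "c = (if d = 0 then 2 else d)"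
        have c: "2 \<le> c" using d \<open>d \<noteq> 1\<close> by (auto simp: c_def)
        have "y /\<^sub>R of_int c \<in> ?D"
          unfolding dual_in_def
        proof (intro CollectI conjI ballI)
          show "y /\<^sub>R of_int c \<in> V" using V yV by (simp add: subspace_scale)
          fix g assume "g \<in> L"
          then obtain m where m: "inner y g = of_int m" using yL by (auto elim: Ints_cases)
          then have "d dvd m" using d \<open>g \<in> L\<close> by (auto simp: M_def)
          then have "c dvd m" by (auto simp: c_def)
          then obtain j where "m = c * j" by (elim dvdE)
          then have "inner (y /\<^sub>R of_int c) g = of_int j" using m c by (simp add: mult.assoc[symmetric])
          then show "inner (y /\<^sub>R of_int c) g \<in> \<int>" by simp
        qed
        then have "I \<le> norm (y /\<^sub>R of_int c)" using y c by (intro Ile) auto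
        also have "\<dots> = norm y / of_int c" using c by (simp add: divide_inverse_commute)
        also have "\<dots> \<le> norm y / 2" using c by (intro divide_left_mono) auto
        finally show False using y(3) I\<mu> \<open>0 < \<mu>\<close> by simp
      qed
      then obtain g1 where g1: "g1 \<in> L" "inner y g1 = 1" using d(2) by (auto simp: M_def)
      define V0 where "V0 = {x\<in>V. inner y x = 0}"
      define L0 where "L0 = {x\<in>L. inner y x = 0}"
      have V0: "subspace V0"
        using V by (auto simp: V0_def subspace_def inner_add_right)
      have "y \<notin> V0" using y by (simp add: V0_def)
      moreover have "V0 \<subseteq> V" by (auto simp: V0_def)
      ultimately have "V0 \<subset> V" using yV by blast
      then have "dim V0 < dim V"
        using V0 V(1) by (intro dim_psubset) (simp add: span_eq_iff[THEN iffD2])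
      then have dimV0: "dim V0 \<le> k" using V by simp
      have L0: "L0 \<subseteq> V0" "add_subgroup L0"
        using LV L by (auto simp: L0_def V0_def add_subgroup_def inner_diff_right)
      define P where "P x = x - (inner y x / inner y y) *\<^sub>R y" for x
      have linP: "linear P"
        unfolding P_def by (intro linearI) (auto simp: inner_add_right algebra_simps add_divide_distrib)
      have PV0: "P x \<in> V0" if "x \<in> V" for x
        using that V yV y by (auto simp: V0_def P_def inner_diff_right subspace_diff subspace_scale)
      have Pid: "P x = x" if "x \<in> V0" for x using that by (simp add: P_def V0_def)
      have PD: "P z \<in> dual_in V0 L0" if "z \<in> ?D" for z
        using that PV0 by (auto simp: dual_in_def L0_def P_def inner_diff_left)
      have sp0: "V0 \<subseteq> span (dual_in V0 L0)"
      proof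
        fix x assume x: "x \<in> V0"
        then have "x \<in> span ?D" using sp by (auto simp: V0_def)
        then have "P x \<in> P ` span ?D" by blast
        also have "\<dots> = span (P ` ?D)" using linP by (simp add: linear_span_image)
        also have "\<dots> \<subseteq> span (dual_in V0 L0)" using PD by (intro span_mono) auto
        finally show "x \<in> span (dual_in V0 L0)" using Pid[OF x] by simp
      qed
      have short: "\<mu> / 2 \<le> norm z" if z: "z \<in> dual_in V0 L0" "z \<noteq> 0" for z
      proof -
        \<comment> \<open>The coefficient t is chosen so that u = z + t y pairs with g1 to the
          integer -r. As g - m g1 lies in \<open>L0\<close> for m = y . g, integrality on
          \<open>L0\<close> and at g1 makes u integral on all of L.\<close>
        define r where "r = round (- inner z g1)"
        define t where "t = - inner z g1 - of_int r"
        have t: "\<bar>t\<bar> \<le> 1 / 2"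
          using of_int_round_abs_le[of "- inner z g1"] unfolding t_def r_def by linarith
        define u where "u = z + t *\<^sub>R y"
        have zy: "inner z y = 0" "z \<in> V" using z by (auto simp: dual_in_def V0_def inner_commute)
        have nu: "inner u u = inner z z + t\<^sup>2 * inner y y"
          using zy by (simp add: u_def inner_add_left inner_add_right inner_commute power2_eq_square)
        have "u \<in> ?D"
          unfolding dual_in_def
        proof (intro CollectI conjI ballI)
          show "u \<in> V" using zy V yV by (simp add: u_def subspace_add subspace_scale)
          fix g assume g: "g \<in> L"
          then obtain m where m: "inner y g = of_int m" using yL by (auto elim: Ints_cases)
          have "g - of_int m *\<^sub>R g1 \<in> L0"
            using g g1 m add_subgroup_diff[OF L g add_subgroup_of_int[OF L g1(1)]]
            by (auto simp: L0_def inner_diff_right)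
          then have "inner z (g - of_int m *\<^sub>R g1) \<in> \<int>" using z by (simp add: dual_in_def)
          moreover have "inner u g = inner z (g - of_int m *\<^sub>R g1) - of_int (m * r)"
            by (simp add: u_def t_def m inner_add_left inner_diff_right algebra_simps)
          ultimately show "inner u g \<in> \<int>" by simp
        qed
        moreover have "u \<noteq> 0"
        proof
          assume "u = 0"
          then have "inner z z + t\<^sup>2 * inner y y = 0" using nu by simp
          moreover have "0 < inner z z" "0 \<le> t\<^sup>2 * inner y y" using z by auto
          ultimately show False by linarith
        qed
        ultimately have "I \<le> norm u" by (rule Ile)
        then have "I\<^sup>2 \<le> inner u u" using I\<mu> \<open>0 < \<mu>\<close> by (simp add: power2_norm_eq_inner[symmetric] power_mono)
        also have "\<dots> = (norm z)\<^sup>2 + t\<^sup>2 * (norm y)\<^sup>2" by (simp add: nu power2_norm_eq_inner)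
        also have "t\<^sup>2 * (norm y)\<^sup>2 \<le> (1 / 2)\<^sup>2 * (3 / 2 * I)\<^sup>2"
        proof (rule mult_mono)
          show "t\<^sup>2 \<le> (1 / 2)\<^sup>2" using t abs_le_square_iff[of t "1 / 2"] by simp
          show "(norm y)\<^sup>2 \<le> (3 / 2 * I)\<^sup>2" using y(3) by (intro power_mono) auto
        qed auto
        finally have "I\<^sup>2 \<le> (norm z)\<^sup>2 + (1 / 2)\<^sup>2 * (3 / 2 * I)\<^sup>2" by simp
        moreover have "(1 / 2)\<^sup>2 * (3 / 2 * I)\<^sup>2 = 9 / 16 * I\<^sup>2" "(I / 2)\<^sup>2 = 1 / 4 * I\<^sup>2"
          by (simp_all add: power2_eq_square)
        ultimately have "(I / 2)\<^sup>2 \<le> (norm z)\<^sup>2" using zero_le_power2[of I] by linarith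
        then have "I / 2 \<le> norm z" by (rule power2_le_imp_le) simp
        then show ?thesis using I\<mu> by simp
      qed
      \<comment> \<open>A multiple of g1 moves x to within half a layer of V0, hence to distance at
        most 1 / (2 \<mu>) from its projection. In V0 dual vectors have length at least \<mu> / 2,
        whence C / (\<mu> / 2). The two contributions make up the constant 1 / 2 + 2 C.\<close>
      define m where "m = round (inner y x)"
      define x' where "x' = x - of_int m *\<^sub>R g1"
      have x'V: "x' \<in> V" using x g1 LV V by (auto simp: x'_def subspace_diff subspace_scale)
      obtain g0 where g0: "g0 \<in> L0" "norm (P x' - g0) \<le> C / (\<mu> / 2)"
        using IH[OF V0 dimV0 L0 sp0 half_gt_zero[OF \<open>0 < \<mu>\<close>] short PV0[OF x'V]] by blast
      have "inner y x' = inner y x - of_int m" by (simp add: x'_def inner_diff_right g1)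
      then have "\<bar>inner y x'\<bar> \<le> 1 / 2"
        using of_int_round_abs_le[of "inner y x"] unfolding m_def by linarith
      have "norm (x' - P x') = \<bar>inner y x'\<bar> / norm y"
        using yy by (simp add: P_def power2_norm_eq_inner[symmetric] power2_eq_square)
      also have "\<dots> \<le> (1 / 2) / \<mu>"
        using \<open>\<bar>inner y x'\<bar> \<le> 1 / 2\<close> ymu \<open>0 < \<mu>\<close> by (intro frac_le) auto
      finally have 1: "norm (x' - P x') \<le> (1 / 2) / \<mu>" .
      have "norm (x' - g0) \<le> norm (x' - P x') + norm (P x' - g0)"
        using norm_triangle_ineq[of "x' - P x'" "P x' - g0"] by simp
      also have "\<dots> \<le> (1 / 2) / \<mu> + C / (\<mu> / 2)" using 1 g0 by simp
      also have "\<dots> = (1 / 2 + 2 * C) / \<mu>" by (simp add: add_divide_distrib)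
      finally have "norm (x - (of_int m *\<^sub>R g1 + g0)) \<le> (1 / 2 + 2 * C) / \<mu>"
        by (simp add: x'_def diff_diff_eq)
      moreover have "of_int m *\<^sub>R g1 + g0 \<in> L"
        using L g0 g1 by (auto simp: L0_def intro: add_subgroup_add add_subgroup_of_int)
      ultimately show ?thesis by blast
    qed
  qed (use \<open>0 \<le> C\<close> in simp)
qed

section \<open>Lattices and the span of their duals\<close>

lemma is_lattice_add_subgroup: "is_lattice G \<Longrightarrow> add_subgroup G"
  by (simp add: is_lattice_def add_subgroup_def)

lemma is_lattice_separated:
  assumes "is_lattice G"
  shows "\<exists>\<delta>. separated \<delta> G"
proof -
  from assms obtain e where "0 < e" "\<And>g. g \<in> G \<Longrightarrow> g \<noteq> 0 \<Longrightarrow> e \<le> norm g" "\<And>x y. x \<in> G \<Longrightarrow> y \<in> G \<Longrightarrow> x - y \<in> G"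
    by (auto simp: is_lattice_def)
  then show ?thesis by (intro exI[of _ e]) (auto simp: separated_def dist_norm)
qed

text \<open>A linear functional vanishing on G takes all its values on the compact set K; being
  bounded, it is zero.\<close>

lemma is_lattice_span:
  assumes "is_lattice (G :: 'a::euclidean_space set)"
  shows "span G = UNIV"
proof (rule ccontr)
  assume "span G \<noteq> UNIV"
  then obtain a where a: "a \<noteq> 0" "\<And>x. x \<in> span G \<Longrightarrow> inner a x = 0"
    using span_not_UNIV_orthogonal by blast
  obtain K where "compact K" and K: "\<And>x. \<exists>g\<in>G. \<exists>k\<in>K. x = g + k"
    using assms by (auto simp: is_lattice_def)
  then obtain R where R: "\<And>k. k \<in> K \<Longrightarrow> norm k \<le> R"
    using compact_imp_bounded bounded_iff by metis
  obtain g k where gk: "g \<in> G" "k \<in> K" "((\<bar>R\<bar> + 1) / norm a) *\<^sub>R a = g + k" using K by blast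
  have "(\<bar>R\<bar> + 1) / norm a * inner a a = inner a g + inner a k"
    using arg_cong[OF gk(3), of "inner a"] by (simp add: inner_add_right)
  also have "\<dots> = inner a k" using a gk by (simp add: span_base)
  also have "\<dots> \<le> norm a * norm k" by (rule norm_cauchy_schwarz)
  also have "\<dots> \<le> norm a * R" using R gk by (intro mult_left_mono) auto
  finally have "(\<bar>R\<bar> + 1) * norm a \<le> norm a * R"
    using a by (simp add: power2_norm_eq_inner[symmetric] power2_eq_square)
  then have "\<bar>R\<bar> + 1 \<le> R" using a by (simp add: mult.commute)
  then show False by simp
qed

text \<open>Modulo the sublattice spanned by a basis \<open>B \<subseteq> G\<close> of the space, the multiples of a lattice point fall into
  finitely many classes, so \<open>G\<close> has coordinates in \<open>B\<close> with a common denominator.\<close>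

lemma is_lattice_common_denominator:
  assumes G: "is_lattice (G :: 'a::euclidean_space set)"
    and B: "B \<subseteq> G" "independent B" "span B = UNIV"
  shows "\<exists>N::nat. 0 < N \<and> (\<forall>g\<in>G. \<forall>b\<in>B. of_nat N * representation B g b \<in> \<int>)"
proof -
  have finB: "finite B" using B(2) by (rule finiteI_independent)
  have sub: "add_subgroup G" using G by (rule is_lattice_add_subgroup)
  obtain \<delta> where sep: "separated \<delta> G" using is_lattice_separated[OF G] by blast
  define F where "F = G \<inter> cball 0 (\<Sum>b\<in>B. norm b)"
  have finF: "finite F"
    unfolding F_def by (intro separated_finite[OF sep]) (auto intro: bounded_subset[OF bounded_cball])
  \<comment> \<open>The pigeonhole argument yields a multiplier j - i of at most card F that depends
    on g; the factorial is divisible by all of them.\<close>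
  define N where "N = (fact (card F) :: nat)"
  have "of_nat N * representation B g b \<in> \<int>" if g: "g \<in> G" and b: "b \<in> B" for g b
  proof -
    let ?c = "representation B g"
    \<comment> \<open>The representative of k g in the parallelepiped spanned by B; if two of them
      coincide, (j - i) g is an integer combination of B.\<close>
    define X where "X k = (\<Sum>b\<in>B. frac (of_nat k * ?c b) *\<^sub>R b)" for k :: nat
    have rep: "(\<Sum>b\<in>B. ?c b *\<^sub>R b) = g"
      using sum_representation_eq[OF B(2) _ finB] B(3) by auto
    have "X k \<in> F" for k
    proof -
      have "X k = of_nat k *\<^sub>R g - (\<Sum>b\<in>B. of_int \<lfloor>of_nat k * ?c b\<rfloor> *\<^sub>R b)"
        by (subst rep[symmetric]) (simp add: X_def frac_def scaleR_diff_left sum_subtractf scaleR_sum_right)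
      also have "\<dots> \<in> G"
        using B(1) g sub by (intro add_subgroup_diff[OF sub] add_subgroup_of_nat add_subgroup_sum add_subgroup_of_int) auto
      finally have "X k \<in> G" .
      moreover have "norm (X k) \<le> (\<Sum>b\<in>B. norm b)"
        unfolding X_def by (rule order_trans[OF norm_sum sum_mono])
          (auto simp: frac_ge_0 less_imp_le[OF frac_lt_1] mult_left_le_one_le)
      ultimately show ?thesis by (simp add: F_def)
    qed
    then have "X ` {0..card F} \<subseteq> F" by blast
    then have "card (X ` {0..card F}) \<le> card F" using finF by (rule card_mono[rotated])
    then have "\<not> inj_on X {0..card F}" by (intro pigeonhole) simp
    then obtain i j where ij: "i \<le> card F" "j \<le> card F" "i < j" "X i = X j"
      unfolding inj_on_def by (metis atLeastAtMost_iff linorder_neqE_nat)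
    have "(\<Sum>b\<in>B. (frac (of_nat i * ?c b) - frac (of_nat j * ?c b)) *\<^sub>R b) = 0"
      using ij(4) by (simp add: X_def scaleR_diff_left sum_subtractf)
    then have "frac (of_nat i * ?c b) - frac (of_nat j * ?c b) = 0"
      using independentD[OF B(2) finB subset_refl _ b, of "\<lambda>b. frac (of_nat i * ?c b) - frac (of_nat j * ?c b)"] by blast
    then have "of_nat (j - i) * ?c b = of_int (\<lfloor>of_nat j * ?c b\<rfloor> - \<lfloor>of_nat i * ?c b\<rfloor>)"
      using ij by (simp add: frac_def of_nat_diff algebra_simps)
    then have int: "of_nat (j - i) * ?c b \<in> \<int>" by (metis Ints_of_int)
    have "(j - i) dvd N" unfolding N_def using ij by (intro dvd_fact) auto
    then obtain q where "N = (j - i) * q" by blast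
    then have "of_nat N * ?c b = of_nat q * (of_nat (j - i) * ?c b)" by simp
    with int show ?thesis by (metis Ints_mult Ints_of_nat)
  qed
  then show ?thesis by (intro exI[of _ N]) (auto simp: N_def)
qed

text \<open>N times a coordinate functional with respect to B is integral on G, so it is represented
  by a dual vector. A vector orthogonal to the dual lattice therefore has all coordinates
  zero.\<close>

lemma span_dual_lattice:
  assumes G: "is_lattice (G :: 'a::euclidean_space set)"
  shows "span (dual_lattice G) = UNIV"
proof (rule ccontr)
  assume "span (dual_lattice G) \<noteq> UNIV"
  then obtain a where a: "a \<noteq> 0" "\<And>x. x \<in> span (dual_lattice G) \<Longrightarrow> inner a x = 0"
    using span_not_UNIV_orthogonal by blast
  obtain B where B: "B \<subseteq> G" "independent B" "G \<subseteq> span B"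
    using maximal_independent_subset by blast
  have spB: "span B = UNIV" using is_lattice_span[OF G] B(3) span_mono[OF B(3)] by (simp add: span_span top.extremum_unique)
  have finB: "finite B" using B(2) by (rule finiteI_independent)
  obtain N :: nat where N: "0 < N" "\<And>g b. g \<in> G \<Longrightarrow> b \<in> B \<Longrightarrow> of_nat N * representation B g b \<in> \<int>"
    using is_lattice_common_denominator[OF G B(1,2) spB] by blast
  have "representation B a b = 0" if b: "b \<in> B" for b
  proof -
    have lin: "linear (\<lambda>x. representation B x b)"
      using B(2) spB by (intro linearI) (simp_all add: representation_add representation_scale)
    define y where "y = of_nat N *\<^sub>R adjoint (\<lambda>x. representation B x b) 1"
    have y: "inner y x = of_nat N * representation B x b" for x
      using adjoint_works[OF lin, of x 1] by (simp add: y_def inner_commute)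
    have "y \<in> dual_lattice G" using N b by (auto simp: dual_lattice_def y)
    then have "inner a y = 0" using a by (simp add: span_base)
    then show ?thesis using y[of a] N by (simp add: inner_commute)
  qed
  then have "a = 0" using sum_representation_eq[OF B(2) _ finB subset_refl, of a] spB by simp
  with a show False by simp
qed

section \<open>Counting lattice points\<close>

text \<open>Rescaling the factors by 1 / T and 1 / r turns the anisotropic condition into the lower
  bound 1 for nonzero dual vectors. The rescaling \<Phi> is self-adjoint, so the dual of the image
  of G consists of the y with \<Phi> y in the dual of G. The transference constant depends only on
  the space, hence not on T and r.\<close>

lemma lattice_covering:
  fixes G :: "('a::euclidean_space \<times> 'b::euclidean_space) set"
  assumes G: "is_lattice G"
  shows "\<exists>C\<ge>0. \<forall>T r x. 0 < T \<longrightarrow> 0 < r \<longrightarrow>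
     (\<forall>\<theta>\<in>dual_lattice G. \<theta> \<noteq> 0 \<longrightarrow> 1 \<le> T * norm (fst \<theta>) \<or> 1 \<le> r * norm (snd \<theta>)) \<longrightarrow>
     (\<exists>g\<in>G. norm (fst x - fst g) \<le> C * T \<and> norm (snd x - snd g) \<le> C * r)"
proof -
  obtain C where "0 \<le> C" and "transference_bound TYPE('a \<times> 'b) C DIM('a \<times> 'b)"
    using transference by blast
  note H = this(2)[unfolded transference_bound_def, rule_format]
  show ?thesis
  proof (intro exI[of _ C] conjI allI impI)
    fix T r :: real and x :: "'a \<times> 'b"
    assume "0 < T" "0 < r"
      and far: "\<forall>\<theta>\<in>dual_lattice G. \<theta> \<noteq> 0 \<longrightarrow> 1 \<le> T * norm (fst \<theta>) \<or> 1 \<le> r * norm (snd \<theta>)"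
    define \<Phi> where "\<Phi> y = (fst y /\<^sub>R T, snd y /\<^sub>R r)" for y :: "'a \<times> 'b"
    define \<Psi> where "\<Psi> y = (T *\<^sub>R fst y, r *\<^sub>R snd y)" for y :: "'a \<times> 'b"
    have \<Phi>\<Psi>: "\<Phi> (\<Psi> y) = y" "\<Psi> (\<Phi> y) = y" for y
      using \<open>0 < T\<close> \<open>0 < r\<close> by (simp_all add: \<Phi>_def \<Psi>_def)
    have adj: "inner (\<Phi> y) z = inner y (\<Phi> z)" for y z
      by (simp add: \<Phi>_def inner_prod_def)
    have lin: "linear \<Psi>" by (intro linearI) (auto simp: \<Psi>_def scaleR_add_right)
    define L where "L = \<Phi> ` G"
    have L: "add_subgroup L"
      unfolding add_subgroup_def
    proof (intro conjI ballI)
      show "0 \<in> L" using is_lattice_add_subgroup[OF G]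
        by (auto simp: L_def \<Phi>_def zero_prod_def dest: add_subgroup_0 intro!: image_eqI[of _ _ 0])
      fix a b assume "a \<in> L" "b \<in> L"
      then obtain g h where gh: "g \<in> G" "h \<in> G" "a = \<Phi> g" "b = \<Phi> h" by (auto simp: L_def)
      have "a - b = \<Phi> (g - h)" by (simp add: gh \<Phi>_def scaleR_diff_right)
      then show "a - b \<in> L" using gh add_subgroup_diff[OF is_lattice_add_subgroup[OF G]] by (auto simp: L_def)
    qed
    have dual: "y \<in> dual_in UNIV L \<longleftrightarrow> \<Phi> y \<in> dual_lattice G" for y
      by (auto simp: dual_in_def dual_lattice_def L_def adj)
    have "UNIV \<subseteq> span (dual_in UNIV L)"
    proof
      fix y
      have "\<Phi> y \<in> span (dual_lattice G)" using span_dual_lattice[OF G] by simp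
      then have "\<Psi> (\<Phi> y) \<in> span (\<Psi> ` dual_lattice G)" using linear_span_image[OF lin] by blast
      moreover have "\<Psi> ` dual_lattice G \<subseteq> dual_in UNIV L" by (simp add: image_subset_iff dual \<Phi>\<Psi>)
      ultimately show "y \<in> span (dual_in UNIV L)" using span_mono \<Phi>\<Psi> by (metis subsetD)
    qed
    moreover have "1 \<le> norm y" if "y \<in> dual_in UNIV L" "y \<noteq> 0" for y
    proof -
      have "\<Phi> y \<in> dual_lattice G" using that dual by simp
      moreover have "\<Phi> y \<noteq> 0" using that \<Phi>\<Psi>(2)[of y] by (auto simp: \<Psi>_def zero_prod_def)
      ultimately have "1 \<le> T * norm (fst (\<Phi> y)) \<or> 1 \<le> r * norm (snd (\<Phi> y))" using far by blast
      then have "1 \<le> norm (fst y) \<or> 1 \<le> norm (snd y)" using \<open>0 < T\<close> \<open>0 < r\<close> by (simp add: \<Phi>_def mult.assoc[symmetric])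
      then show ?thesis using norm_fst_le[of "fst y" "snd y"] norm_snd_le[of "snd y" "fst y"] by auto
    qed
    ultimately have "\<exists>g\<in>L. norm (\<Phi> x - g) \<le> C / 1"
      using L by (intro H[of UNIV L 1]) (auto simp: dim_UNIV simp del: DIM_prod)
    then obtain g where g: "g \<in> G" "norm (\<Phi> x - \<Phi> g) \<le> C" by (auto simp: L_def)
    have e: "\<Phi> x - \<Phi> g = ((fst x - fst g) /\<^sub>R T, (snd x - snd g) /\<^sub>R r)"
      by (simp add: \<Phi>_def scaleR_diff_right)
    have "norm ((fst x - fst g) /\<^sub>R T) \<le> C" "norm ((snd x - snd g) /\<^sub>R r) \<le> C"
      using g(2) norm_fst_le norm_snd_le unfolding e by (meson order_trans)+
    then have "norm (fst x - fst g) / T \<le> C" "norm (snd x - snd g) / r \<le> C"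
      using \<open>0 < T\<close> \<open>0 < r\<close> unfolding norm_scaleR by (simp_all add: divide_inverse_commute)
    then show "\<exists>g\<in>G. norm (fst x - fst g) \<le> C * T \<and> norm (snd x - snd g) \<le> C * r"
      using g(1) \<open>0 < T\<close> \<open>0 < r\<close> by (intro bexI[of _ g]) (simp_all add: pos_divide_le_eq)
  qed fact
qed

text \<open>The translates of \<open>tile G B\<close> by \<open>G\<close> form a partition of unity when those of \<open>B\<close> cover the space.\<close>

definition tile :: "'a::euclidean_space set \<Rightarrow> 'a set \<Rightarrow> 'a \<Rightarrow> real" where
  "tile G B x = indicator B x / real (card {g\<in>G. x - g \<in> B})"

locale lattice_tile =
  fixes G B :: "'a::euclidean_space set" and b :: real
  assumes lattice: "is_lattice G" and B_meas [measurable]: "B \<in> sets borel"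
    and B_bound: "\<And>x. x \<in> B \<Longrightarrow> norm x \<le> b"
    and cover: "\<And>x. \<exists>g\<in>G. x - g \<in> B"
begin

lemma subgroup: "add_subgroup G"
  by (rule is_lattice_add_subgroup[OF lattice])

lemma finite_lattice_cball: "finite {g\<in>G. norm (g + v) \<le> r}"
proof -
  obtain \<delta> where "separated \<delta> G" using is_lattice_separated[OF lattice] by blast
  then show ?thesis
  proof (rule separated_finite)
    show "bounded {g\<in>G. norm (g + v) \<le> r}"
    proof (rule boundedI)
      fix g assume "g \<in> {g\<in>G. norm (g + v) \<le> r}"
      then show "norm g \<le> r + norm v" using norm_triangle_ineq4[of "g + v" v] by auto
    qed
  qed auto
qed

lemma finite_overlap: "finite {g\<in>G. x - g \<in> B}"
proof (rule finite_subset[OF _ finite_lattice_cball[of "- x" b]])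
  show "{g\<in>G. x - g \<in> B} \<subseteq> {g\<in>G. norm (g + - x) \<le> b}"
  proof safe
    fix g assume "x - g \<in> B"
    then have "norm (x - g) \<le> b" by (rule B_bound)
    then show "norm (g + - x) \<le> b" by (simp add: norm_minus_commute)
  qed
qed

lemma tile_nonneg: "0 \<le> tile G B x"
  by (simp add: tile_def)

lemma tile_le_1: "tile G B x \<le> 1"
proof (cases "x \<in> B")
  case True
  then have "0 \<in> {g\<in>G. x - g \<in> B}" using add_subgroup_0[OF subgroup] by simp
  then have "1 \<le> card {g\<in>G. x - g \<in> B}" using finite_overlap by (metis One_nat_def Suc_leI card_gt_0_iff empty_iff)
  then show ?thesis by (simp add: tile_def True)
qed (simp add: tile_def)

lemma tile_support: "tile G B x \<noteq> 0 \<Longrightarrow> x \<in> B"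
  by (auto simp: tile_def indicator_def split: if_splits)

text \<open>The overlap count becomes a sum of indicators over an index set independent of x, from
  which Borel measurability is evident.\<close>

lemma tile_eq: "tile G B x = indicator B x / (\<Sum>g\<in>{g\<in>G. norm g \<le> 2 * b}. indicator B (x - g))"
proof (cases "x \<in> B")
  case True
  have "{g\<in>G. x - g \<in> B} \<subseteq> {g\<in>G. norm g \<le> 2 * b}"
  proof safe
    fix g assume "x - g \<in> B"
    then have "norm (x - g) \<le> b" "norm x \<le> b" using B_bound True by auto
    then show "norm g \<le> 2 * b" using norm_triangle_ineq4[of x "x - g"] by simp
  qed
  then have "{g\<in>{g\<in>G. norm g \<le> 2 * b}. x - g \<in> B} = {g\<in>G. x - g \<in> B}" by blast
  moreover have "finite {g\<in>G. norm g \<le> 2 * b}" using finite_lattice_cball[of 0 "2 * b"] by simp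
  ultimately have "(\<Sum>g\<in>{g\<in>G. norm g \<le> 2 * b}. indicator B (x - g)) = real (card {g\<in>G. x - g \<in> B})"
    by (simp add: indicator_def sum.If_cases Int_def)
  then show ?thesis by (simp add: tile_def)
qed (simp add: tile_def)

lemma tile_measurable [measurable]: "tile G B \<in> borel_measurable borel"
  unfolding tile_eq[abs_def] by measurable

lemma tile_integrable: "integrable lborel (\<lambda>x. tile G B (x - y))"
proof (rule integrable_bounded_support[of _ 1 "b + norm y"])
  show "\<bar>tile G B (x - y)\<bar> \<le> 1" for x using tile_nonneg tile_le_1 by simp
  show "tile G B (x - y) = 0" if "b + norm y < norm x" for x
  proof (rule ccontr)
    assume "tile G B (x - y) \<noteq> 0"
    then have "norm (x - y) \<le> b" using tile_support B_bound by blast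
    with that norm_triangle_ineq[of "x - y" y] show False by simp
  qed
qed measurable

lemma tile_sum_le_1:
  assumes "finite F" "F \<subseteq> G"
  shows "(\<Sum>g\<in>F. tile G B (x - g)) \<le> 1"
    and "{g\<in>G. x - g \<in> B} \<subseteq> F \<Longrightarrow> (\<Sum>g\<in>F. tile G B (x - g)) = 1"
proof -
  let ?N = "{g\<in>G. x - g \<in> B}"
  have "?N \<noteq> {}" using cover by blast
  then have N: "0 < card ?N" using finite_overlap by (simp add: card_gt_0_iff)
  \<comment> \<open>The number of translates of B covering a point is invariant under G, so all
    terms have the same denominator.\<close>
  have t: "tile G B (x - g) = indicator B (x - g) / real (card ?N)" if g: "g \<in> G" for g
  proof -
    have "bij_betw (\<lambda>h. h - g) ?N {h\<in>G. x - g - h \<in> B}"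
      by (rule bij_betwI[where g = "\<lambda>h. h + g"])
        (use g add_subgroup_add[OF subgroup] add_subgroup_diff[OF subgroup] in \<open>auto simp: algebra_simps\<close>)
    then show ?thesis by (simp add: tile_def bij_betw_same_card)
  qed
  have "(\<Sum>g\<in>F. tile G B (x - g)) = (\<Sum>g\<in>F. indicator B (x - g)) / real (card ?N)"
    using assms by (simp add: t sum_divide_distrib subset_iff)
  also have "(\<Sum>g\<in>F. indicator B (x - g) :: real) = real (card (F \<inter> ?N))"
    using assms by (auto simp: indicator_def sum.If_cases intro!: arg_cong[of _ _ card])
  finally have eq: "(\<Sum>g\<in>F. tile G B (x - g)) = real (card (F \<inter> ?N)) / real (card ?N)" .
  have "card (F \<inter> ?N) \<le> card ?N" by (intro card_mono finite_overlap) auto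
  then show "(\<Sum>g\<in>F. tile G B (x - g)) \<le> 1" unfolding eq using N by simp
  assume "?N \<subseteq> F"
  then have "F \<inter> ?N = ?N" by blast
  then show "(\<Sum>g\<in>F. tile G B (x - g)) = 1" unfolding eq using N by simp
qed

text \<open>Sampling error: each sample is spread over the tile around it.\<close>

lemma lattice_sum_approx:
  fixes f h :: "'a \<Rightarrow> real"
  assumes [measurable]: "f \<in> borel_measurable borel" and fA: "\<And>x. \<bar>f x\<bar> \<le> A" and fR: "\<And>x. R < norm x \<Longrightarrow> f x = 0"
    and h: "integrable lborel h" "\<And>x. 0 \<le> h x"
    and close: "\<And>x z. z - x \<in> B \<Longrightarrow> \<bar>f x - f z\<bar> \<le> h z"
  shows "\<bar>(\<integral>x. tile G B x \<partial>lborel) * (\<Sum>g\<in>{g\<in>G. f (g + v) \<noteq> 0}. f (g + v)) - (\<integral>x. f x \<partial>lborel)\<bar> \<le> (\<integral>x. h x \<partial>lborel)"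
proof -
  let ?t = "\<lambda>g x. tile G B (x - v - g)"
  define F where "F = {g\<in>G. norm (g + v) \<le> R + \<bar>b\<bar>}"
  have F: "finite F" "F \<subseteq> G" using finite_lattice_cball by (auto simp: F_def)
  have [measurable]: "h \<in> borel_measurable borel" using h(1) by auto
  have intf: "integrable lborel f" by (rule integrable_bounded_support[OF _ fA fR]) measurable
  have ti: "integrable lborel (?t g)" for g using tile_integrable[of "v + g"] by (simp add: diff_diff_eq)
  have tv: "(\<integral>x. ?t g x \<partial>lborel) = (\<integral>x. tile G B x \<partial>lborel)" for g
    using integral_lborel_translate[of "tile G B" "- (v + g)"] by (simp add: algebra_simps)
  have t1: "\<bar>?t g x\<bar> \<le> 1" for g x using tile_nonneg tile_le_1 by simp
  have i1: "integrable lborel (\<lambda>x. f x * ?t g x)" for g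
    by (rule Bochner_Integration.integrable_bound[OF intf])
      (measurable, auto simp: abs_mult intro!: AE_I2 mult_left_le t1)
  have i2: "integrable lborel (\<lambda>x. h x * ?t g x)" for g
    by (rule Bochner_Integration.integrable_bound[OF h(1)])
      (measurable, auto simp: abs_mult intro!: AE_I2 mult_left_le t1)
  have fs: "f x = (\<Sum>g\<in>F. f x * ?t g x)" for x
  proof (cases "f x = 0")
    case False
    then have "norm x \<le> R" using fR by (meson not_le)
    have "{g\<in>G. x - v - g \<in> B} \<subseteq> F"
    proof safe
      fix g assume g: "g \<in> G" "x - v - g \<in> B"
      have "norm (g + v) \<le> norm x + norm (x - v - g)"
        using norm_triangle_ineq4[of x "x - v - g"] by (simp add: algebra_simps)
      also have "\<dots> \<le> R + \<bar>b\<bar>" using B_bound[OF g(2)] \<open>norm x \<le> R\<close> by simp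
      finally show "g \<in> F" using g by (simp add: F_def)
    qed
    from tile_sum_le_1(2)[OF F this] show ?thesis by (simp add: sum_distrib_left[symmetric])
  qed simp
  have "(\<Sum>g\<in>{g\<in>G. f (g + v) \<noteq> 0}. f (g + v)) = (\<Sum>g\<in>F. f (g + v))"
  proof (rule sum.mono_neutral_left[OF F(1)])
    show "{g\<in>G. f (g + v) \<noteq> 0} \<subseteq> F"
    proof safe
      fix g assume "g \<in> G" "f (g + v) \<noteq> 0"
      then have "norm (g + v) \<le> R" using fR by (meson not_le)
      then show "g \<in> F" using \<open>g \<in> G\<close> by (simp add: F_def)
    qed
  qed (use F in auto)
  then have "(\<integral>x. tile G B x \<partial>lborel) * (\<Sum>g\<in>{g\<in>G. f (g + v) \<noteq> 0}. f (g + v)) = (\<Sum>g\<in>F. \<integral>x. f (g + v) * ?t g x \<partial>lborel)"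
    by (simp add: tv sum_distrib_left mult.commute)
  moreover have "(\<integral>x. f x \<partial>lborel) = (\<Sum>g\<in>F. \<integral>x. f x * ?t g x \<partial>lborel)"
    by (subst fs) (rule Bochner_Integration.integral_sum[OF i1])
  \<comment> \<open>Inserting the partition of unity into the integral of f leaves only the
    oscillation of f between g + v and the points of its tile, which h bounds. The tiles sum to at
    most 1, so h is integrated once.\<close>
  ultimately have "(\<integral>x. tile G B x \<partial>lborel) * (\<Sum>g\<in>{g\<in>G. f (g + v) \<noteq> 0}. f (g + v)) - (\<integral>x. f x \<partial>lborel)
      = (\<Sum>g\<in>F. \<integral>x. (f (g + v) - f x) * ?t g x \<partial>lborel)"
    using ti i1 by (simp add: sum_subtractf[symmetric] left_diff_distrib)
  also have "\<bar>\<dots>\<bar> \<le> (\<Sum>g\<in>F. \<integral>x. h x * ?t g x \<partial>lborel)"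
  proof (rule order_trans[OF sum_abs sum_mono])
    fix g
    have ii: "integrable lborel (\<lambda>x. (f (g + v) - f x) * ?t g x)"
      using ti i1 by (simp add: left_diff_distrib)
    have "norm (\<integral>x. (f (g + v) - f x) * ?t g x \<partial>lborel) \<le> (\<integral>x. norm ((f (g + v) - f x) * ?t g x) \<partial>lborel)"
      by (rule integral_norm_bound)
    also have "\<dots> \<le> (\<integral>x. h x * ?t g x \<partial>lborel)"
    proof (rule integral_mono[OF integrable_norm[OF ii] i2])
      fix x
      show "norm ((f (g + v) - f x) * ?t g x) \<le> h x * ?t g x"
      proof (cases "?t g x = 0")
        case False
        then have "x - (g + v) \<in> B" using tile_support by (simp add: algebra_simps)
        then have "\<bar>f (g + v) - f x\<bar> \<le> h x" by (rule close)
        then show ?thesis using tile_nonneg by (simp add: abs_mult mult_right_mono)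
      qed simp
    qed
    finally show "\<bar>\<integral>x. (f (g + v) - f x) * ?t g x \<partial>lborel\<bar> \<le> (\<integral>x. h x * ?t g x \<partial>lborel)" by simp
  qed
  also have "\<dots> = (\<integral>x. (\<Sum>g\<in>F. h x * ?t g x) \<partial>lborel)"
    by (rule Bochner_Integration.integral_sum[OF i2, symmetric])
  also have "\<dots> \<le> (\<integral>x. h x \<partial>lborel)"
  proof (rule integral_mono[OF Bochner_Integration.integrable_sum[OF i2] h(1)])
    fix x
    have "h x * (\<Sum>g\<in>F. tile G B (x - v - g)) \<le> h x * 1"
      using tile_sum_le_1(1)[OF F] h(2) by (intro mult_left_mono)
    then show "(\<Sum>g\<in>F. h x * ?t g x) \<le> h x" by (simp add: sum_distrib_left)
  qed
  finally show ?thesis .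
qed

text \<open>The overlap count is bounded on B, so the tile dominates a positive multiple of the
  indicator of B.\<close>

lemma tile_integral_pos:
  assumes "0 < measure lborel B"
  shows "0 < (\<integral>x. tile G B x \<partial>lborel)"
proof -
  let ?c = "card {g\<in>G. norm g \<le> 2 * \<bar>b\<bar>}"
  have fin: "finite {g\<in>G. norm g \<le> 2 * \<bar>b\<bar>}" using finite_lattice_cball[of 0 "2 * \<bar>b\<bar>"] by simp
  then have c: "0 < ?c" using add_subgroup_0[OF subgroup] by (auto simp: card_gt_0_iff intro!: exI[of _ 0])
  have bB: "bounded B" using B_bound by (auto intro: boundedI)
  have "measure lborel B / ?c = (\<integral>x. indicator B x / ?c \<partial>lborel)"
    using emeasure_bounded_finite[OF bB] by simp
  also have "\<dots> \<le> (\<integral>x. tile G B x \<partial>lborel)"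
  proof (rule integral_mono)
    show "integrable lborel (\<lambda>x. indicator B x / real ?c :: real)"
      using emeasure_bounded_finite[OF bB] by (intro integrable_divide integrable_real_indicator) auto
    show "integrable lborel (tile G B)" using tile_integrable[of 0] by simp
    fix x
    show "indicator B x / real ?c \<le> tile G B x"
    proof (cases "x \<in> B")
      case True
      have "{g\<in>G. x - g \<in> B} \<subseteq> {g\<in>G. norm g \<le> 2 * \<bar>b\<bar>}"
      proof safe
        fix g assume "x - g \<in> B"
        then have "norm (x - g) \<le> b" "norm x \<le> b" using B_bound True by auto
        then show "norm g \<le> 2 * \<bar>b\<bar>" using norm_triangle_ineq4[of x "x - g"] by simp
      qed
      then have "card {g\<in>G. x - g \<in> B} \<le> ?c" using fin by (intro card_mono)
      moreover have "0 < card {g\<in>G. x - g \<in> B}"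
        using True finite_overlap add_subgroup_0[OF subgroup] by (auto simp: card_gt_0_iff intro!: exI[of _ 0])
      ultimately show ?thesis by (simp add: tile_def True frac_le)
    qed (simp add: tile_def)
  qed
  finally have "measure lborel B / ?c \<le> (\<integral>x. tile G B x \<partial>lborel)" .
  moreover have "0 < measure lborel B / ?c" using assms c by simp
  ultimately show ?thesis by linarith
qed

end

text \<open>Both integrals unfold to the sum over g of the integrals of t (x) t' (x - g): each tile
  is multiplied by the partition of unity made from the other, followed by translation by g and
  replacing g by -g.\<close>

lemma tile_integral_unique:
  assumes "lattice_tile G B b" "lattice_tile G B' b'"
  shows "(\<integral>x. tile G B x \<partial>lborel) = (\<integral>x. tile G B' x \<partial>lborel)"
proof -
  interpret A: lattice_tile G B b by fact
  interpret A': lattice_tile G B' b' by fact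
  let ?t = "tile G B" and ?t' = "tile G B'"
  define F where "F = {g\<in>G. norm g \<le> \<bar>b\<bar> + \<bar>b'\<bar>}"
  have F: "finite F" "F \<subseteq> G" using A.finite_lattice_cball[of 0] by (auto simp: F_def)
  have neg: "bij_betw uminus F F"
    by (rule bij_betwI[where g = uminus]) (auto simp: F_def add_subgroup_uminus[OF A.subgroup])
  have sub: "{g\<in>G. x - g \<in> B'} \<subseteq> F" if "x \<in> B" for x
  proof safe
    fix g assume "g \<in> G" "x - g \<in> B'"
    then show "g \<in> F"
      using A.B_bound[OF that] A'.B_bound[of "x - g"] norm_triangle_ineq4[of x "x - g"] by (auto simp: F_def)
  qed
  have sub': "{g\<in>G. x - g \<in> B} \<subseteq> F" if "x \<in> B'" for x
  proof safe
    fix g assume "g \<in> G" "x - g \<in> B"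
    then show "g \<in> F"
      using A'.B_bound[OF that] A.B_bound[of "x - g"] norm_triangle_ineq4[of x "x - g"] by (auto simp: F_def)
  qed
  have bd: "\<bar>?t x\<bar> \<le> 1" "\<bar>?t' x\<bar> \<le> 1" for x
    using A.tile_nonneg A.tile_le_1 A'.tile_nonneg A'.tile_le_1 by simp_all
  have [measurable]: "?t \<in> borel_measurable borel" "?t' \<in> borel_measurable borel"
    by (rule A.tile_measurable A'.tile_measurable)+
  have i: "integrable lborel (\<lambda>x. ?t x * ?t' (x - g))" for g
    using A.tile_integrable[of 0]
    by (rule Bochner_Integration.integrable_bound) (measurable, auto simp: abs_mult intro!: AE_I2 mult_left_le bd)
  have i': "integrable lborel (\<lambda>x. ?t (x - g) * ?t' x)" for g
    using A'.tile_integrable[of 0]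
    by (rule Bochner_Integration.integrable_bound) (measurable, auto simp: abs_mult intro!: AE_I2 mult_left_le_one_le bd)
  have e: "?t x = (\<Sum>g\<in>F. ?t x * ?t' (x - g))" for x
    using A'.tile_sum_le_1(2)[OF F sub] A.tile_support[of x] by (cases "?t x = 0") (auto simp: sum_distrib_left[symmetric])
  have e': "?t' x = (\<Sum>g\<in>F. ?t (x - g) * ?t' x)" for x
    using A.tile_sum_le_1(2)[OF F sub'] A'.tile_support[of x] by (cases "?t' x = 0") (auto simp: sum_distrib_right[symmetric])
  have "(\<integral>x. ?t x \<partial>lborel) = (\<Sum>g\<in>F. \<integral>x. ?t x * ?t' (x - g) \<partial>lborel)"
    by (subst e) (rule Bochner_Integration.integral_sum[OF i])
  also have "\<dots> = (\<Sum>g\<in>F. \<integral>x. ?t (x - - g) * ?t' x \<partial>lborel)"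
  proof (rule sum.cong)
    fix g
    show "(\<integral>x. ?t x * ?t' (x - g) \<partial>lborel) = (\<integral>x. ?t (x - - g) * ?t' x \<partial>lborel)"
      using integral_lborel_translate[of "\<lambda>x. ?t x * ?t' (x - g)" g] by simp
  qed simp
  also have "\<dots> = (\<Sum>g\<in>F. \<integral>x. ?t (x - g) * ?t' x \<partial>lborel)"
    using sum.reindex_bij_betw[OF neg, of "\<lambda>g. \<integral>x. ?t (x - g) * ?t' x \<partial>lborel"] by simp
  also have "\<dots> = (\<integral>x. ?t' x \<partial>lborel)"
    by (subst (2) e') (rule Bochner_Integration.integral_sum[OF i', symmetric])
  finally show ?thesis .
qed

lemma ex_lattice_tile_cball:
  assumes "is_lattice (G :: 'a::euclidean_space set)"
  shows "\<exists>R>0. lattice_tile G (cball 0 R) R"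
proof -
  obtain K where "compact K" and K: "\<And>x. \<exists>g\<in>G. \<exists>k\<in>K. x = g + k"
    using assms by (auto simp: is_lattice_def)
  then obtain R where R: "0 < R" "\<And>k. k \<in> K \<Longrightarrow> norm k \<le> R"
    using compact_imp_bounded bounded_pos by metis
  have "\<exists>g\<in>G. x - g \<in> cball 0 R" for x
  proof -
    obtain g k where "g \<in> G" "k \<in> K" "x = g + k" using K by blast
    then show ?thesis using R(2)[of k] by (intro bexI[of _ g]) auto
  qed
  then show ?thesis using R assms by (intro exI[of _ R]) (auto intro!: lattice_tile.intro)
qed

text \<open>V is the volume of a fundamental domain, obtained without choosing one. Being the same
  for every tile, it is a constant even though the tile will vary with the scale.\<close>

lemma covolume:
  assumes G: "is_lattice (G :: 'a::euclidean_space set)"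
  obtains V where "0 < V" "\<And>B b. lattice_tile G B b \<Longrightarrow> (\<integral>x. tile G B x \<partial>lborel) = V"
proof -
  obtain R where R: "0 < R" and L: "lattice_tile G (cball 0 R) R" using ex_lattice_tile_cball[OF G] by blast
  have "0 < measure lborel (cball (0::'a) R)" using content_cball_pos[OF R] by simp
  then have "0 < (\<integral>x. tile G (cball 0 R) x \<partial>lborel)" by (rule lattice_tile.tile_integral_pos[OF L])
  then show ?thesis using tile_integral_unique[OF _ L] by (rule that)
qed

section \<open>Cut-and-project sets\<close>

lemma integral_lborel_reflect:
  fixes K :: "'a::euclidean_space \<Rightarrow> real"
  assumes [measurable]: "K \<in> borel_measurable borel"
  shows "(\<integral>x. K (p - x) \<partial>lborel) = (\<integral>x. K x \<partial>lborel)"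
proof -
  have "(\<integral>x. K x \<partial>lborel) = (\<integral>x. K x \<partial>density (distr lborel borel (\<lambda>x. p + (-1) *\<^sub>R x)) (\<lambda>_. ennreal (\<bar>-1\<bar> ^ DIM('a))))"
    by (subst lborel_affine[of "-1" p]) auto
  also have "\<dots> = (\<integral>x. K (p - x) \<partial>lborel)"
    by (subst integral_density) (auto simp: integral_distr)
  finally show ?thesis ..
qed

lemma integral_product_bounded_support:
  fixes f :: "'a::euclidean_space \<Rightarrow> real" and g :: "'b::euclidean_space \<Rightarrow> real"
  assumes [measurable]: "f \<in> borel_measurable borel" "g \<in> borel_measurable borel"
    and f: "\<And>x. \<bar>f x\<bar> \<le> A" "\<And>x. r < norm x \<Longrightarrow> f x = 0"
    and g: "\<And>x. \<bar>g x\<bar> \<le> A'" "\<And>x. r' < norm x \<Longrightarrow> g x = 0"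
  shows "integrable lborel (\<lambda>z. f (fst z) * g (snd z))"
    and "(\<integral>z. f (fst z) * g (snd z) \<partial>lborel) = (\<integral>x. f x \<partial>lborel) * (\<integral>y. g y \<partial>lborel)"
proof -
  have [measurable]: "(\<lambda>z :: 'a \<times> 'b. f (fst z)) \<in> borel_measurable borel" "(\<lambda>z :: 'a \<times> 'b. g (snd z)) \<in> borel_measurable borel"
    by (rule measurable_compose[OF _ assms(1)] measurable_compose[OF _ assms(2)],
        intro borel_measurable_continuous_onI continuous_intros)+
  show i: "integrable lborel (\<lambda>z. f (fst z) * g (snd z))"
  proof (rule integrable_bounded_support[of _ "A * A'" "\<bar>r\<bar> + \<bar>r'\<bar>"])
    have "0 \<le> A" using f(1)[of 0] by linarith
    then show "\<bar>f (fst z) * g (snd z)\<bar> \<le> A * A'" for z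
      using f(1)[of "fst z"] g(1)[of "snd z"] by (auto simp: abs_mult intro: mult_mono)
    fix z :: "'a \<times> 'b" assume "\<bar>r\<bar> + \<bar>r'\<bar> < norm z"
    also have "norm z \<le> norm (fst z) + norm (snd z)" using norm_Pair_le[of "fst z" "snd z"] by simp
    finally have "r < norm (fst z) \<or> r' < norm (snd z)" by linarith
    then show "f (fst z) * g (snd z) = 0" using f(2) g(2) by auto
  qed measurable
  have "(\<integral>z. f (fst z) * g (snd z) \<partial>(lborel \<Otimes>\<^sub>M lborel)) = (\<integral>x. \<integral>y. f x * g y \<partial>lborel \<partial>lborel)"
    using lborel_pair.integral_fst'[of "\<lambda>z. f (fst z) * g (snd z)"] i by (simp add: lborel_prod)
  then show "(\<integral>z. f (fst z) * g (snd z) \<partial>lborel) = (\<integral>x. f x \<partial>lborel) * (\<integral>y. g y \<partial>lborel)"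
    by (simp add: lborel_prod)
qed

lemma integral_rectangle:
  fixes S :: "'a::euclidean_space set" and S' :: "'b::euclidean_space set"
  assumes "S \<in> sets borel" "S' \<in> sets borel" "bounded S" "bounded S'"
  shows "integrable lborel (\<lambda>z. indicator S (fst z) * indicator S' (snd z) :: real)"
    and "(\<integral>z. indicator S (fst z) * indicator S' (snd z) \<partial>lborel) = measure lborel S * measure lborel S'"
proof -
  obtain r r' where r: "\<And>x. x \<in> S \<Longrightarrow> norm x \<le> r" "\<And>x. x \<in> S' \<Longrightarrow> norm x \<le> r'"
    using assms by (auto simp: bounded_iff)
  have s: "indicator S x = (0::real)" if "r < norm x" for x using r(1)[of x] that by (auto simp: indicator_def)
  have s': "indicator S' x = (0::real)" if "r' < norm x" for x using r(2)[of x] that by (auto simp: indicator_def)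
  have m: "(indicator S :: 'a \<Rightarrow> real) \<in> borel_measurable borel" "(indicator S' :: 'b \<Rightarrow> real) \<in> borel_measurable borel"
    using assms by auto
  show "integrable lborel (\<lambda>z. indicator S (fst z) * indicator S' (snd z) :: real)"
    by (rule integral_product_bounded_support(1)[OF m _ s _ s', where A = 1 and A' = 1]) (auto simp: indicator_def)
  show "(\<integral>z. indicator S (fst z) * indicator S' (snd z) \<partial>lborel) = measure lborel S * measure lborel S'"
    by (subst integral_product_bounded_support(2)[OF m _ s _ s', where A = 1 and A' = 1]) (auto simp: indicator_def[of S] indicator_def[of S'])
qed

section \<open>The boundary layer of the window\<close>

lemma frontier_between:
  fixes x z :: "'a::real_normed_vector"
  assumes "x \<in> S" "z \<notin> S"
  shows "\<exists>w\<in>frontier S. dist x w \<le> dist x z \<and> dist z w \<le> dist x z"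
proof -
  have "closed_segment x z \<inter> frontier S \<noteq> {}"
    using assms by (intro connected_Int_frontier) auto
  then obtain w where w: "w \<in> closed_segment x z" "w \<in> frontier S" by blast
  from segment_bound[OF w(1)] w(2) show ?thesis
    by (intro bexI[of _ w]) (auto simp: dist_norm norm_minus_commute)
qed

lemma nbhd_open: "open (nbhd U r)"
proof -
  have "nbhd U r = (\<Union>y\<in>U. ball y r)" by (auto simp: nbhd_def dist_commute)
  then show ?thesis by auto
qed

lemma nbhd_bounded:
  assumes "bounded U"
  shows "bounded (nbhd U r :: 'a::real_normed_vector set)"
proof -
  obtain b where b: "\<And>y. y \<in> U \<Longrightarrow> norm y \<le> b" using assms by (auto simp: bounded_iff)
  show ?thesis
  proof (rule boundedI)
    fix x assume "x \<in> nbhd U r"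
    then obtain y where y: "y \<in> U" "norm (x - y) < r" by (auto simp: nbhd_def dist_norm)
    then show "norm x \<le> b + r" using b[OF y(1)] norm_triangle_sub[of x y] by simp
  qed
qed

lemma upper_minkowski_content_finite:
  assumes "upper_minkowski_content s U < \<infinity>"
  shows "\<exists>M\<ge>0. \<exists>r1>0. \<forall>r. 0 < r \<longrightarrow> r < r1 \<longrightarrow> measure lborel (nbhd U r) \<le> M * r powr s"
proof -
  obtain n where n: "upper_minkowski_content s U < ereal (real n)"
    using assms less_PInf_Ex_of_nat by auto
  then have "\<forall>\<^sub>F r in at_right 0. ereal (measure lborel (nbhd U r) / r powr s) < ereal (real n)"
    unfolding upper_minkowski_content_def by (rule Limsup_lessD)
  then obtain r1 where r1: "0 < r1" "\<And>r. 0 < r \<Longrightarrow> r < r1 \<Longrightarrow> measure lborel (nbhd U r) / r powr s < real n"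
    unfolding eventually_at_right_field by auto
  show ?thesis
  proof (rule exI[of _ "real n"], intro conjI exI[of _ r1] allI impI)
    fix r assume "0 < r" "r < r1"
    from r1(2)[OF this] \<open>0 < r\<close> show "measure lborel (nbhd U r) \<le> real n * r powr s"
      by (simp add: divide_less_eq less_imp_le)
  qed (use r1 in auto)
qed

text \<open>The summand of the smeared cut-and-project set at p, regarded as a function on the whole
  space, so that smearing becomes a sum over the translated lattice.\<close>

definition lift_kernel :: "(real^'m) set \<Rightarrow> (real^'n \<Rightarrow> real) \<Rightarrow> real^'n \<Rightarrow> (real^'n) \<times> (real^'m) \<Rightarrow> real" where
  "lift_kernel W K p x = K (p - fst x) * indicator W (snd x)"

lemma fst_inj_on_lattice:
  fixes G :: "((real^'n) \<times> (real^'m)) set"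
  assumes G: "is_lattice G" and irr: "G \<inter> {x. fst x = 0} = {0}"
  shows "inj_on fst G"
proof (rule inj_onI)
  fix x y assume xy: "x \<in> G" "y \<in> G" "fst x = fst y"
  then have "x - y \<in> G \<inter> {x. fst x = 0}"
    using add_subgroup_diff[OF is_lattice_add_subgroup[OF G]] by auto
  then show "x = y" unfolding irr by simp
qed

text \<open>\<open>fst\<close> is injective on G, so no point of the projected set stands for two
  lattice points.\<close>

lemma smear_cut_and_project:
  fixes G :: "((real^'n) \<times> (real^'m)) set"
  assumes G: "is_lattice G" and irr: "G \<inter> {x. fst x = 0} = {0}"
  shows "smear (cut_and_project G v W) K p
    = (\<Sum>g\<in>{g\<in>G. lift_kernel W K p (g + v) \<noteq> 0}. lift_kernel W K p (g + v))"
  unfolding smear_def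
proof (rule sum.reindex_cong[where l = "\<lambda>g. fst (g + v)"])
  let ?S = "{g\<in>G. lift_kernel W K p (g + v) \<noteq> 0}"
  show "inj_on (\<lambda>g. fst (g + v)) ?S"
    using fst_inj_on_lattice[OF G irr] by (auto simp: inj_on_def)
  show "{y\<in>cut_and_project G v W. K (p - y) \<noteq> 0} = (\<lambda>g. fst (g + v)) ` ?S"
  proof (intro subset_antisym subsetI)
    fix y assume y: "y \<in> {y\<in>cut_and_project G v W. K (p - y) \<noteq> 0}"
    then obtain g where "g \<in> G" "snd (g + v) \<in> W" "y = fst (g + v)"
      unfolding cut_and_project_def by blast
    then show "y \<in> (\<lambda>g. fst (g + v)) ` ?S" using y by (intro image_eqI[of _ _ g]) (auto simp: lift_kernel_def)
  next
    fix y assume "y \<in> (\<lambda>g. fst (g + v)) ` ?S"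
    then obtain g where g: "g \<in> G" "lift_kernel W K p (g + v) \<noteq> 0" "y = fst (g + v)" by blast
    then have "snd (g + v) \<in> W" "K (p - y) \<noteq> 0" by (auto simp: lift_kernel_def indicator_def split: if_splits)
    then show "y \<in> {y\<in>cut_and_project G v W. K (p - y) \<noteq> 0}" using g unfolding cut_and_project_def by blast
  qed
  fix g assume "g \<in> ?S"
  then show "K (p - fst (g + v)) = lift_kernel W K p (g + v)"
    by (auto simp: lift_kernel_def indicator_def split: if_splits)
qed

text \<open>Two nearby points differ by the projection of a lattice vector from the finite set F,
  and irrationality keeps these projections away from 0. The 1 in the minimum covers points more
  than 1 apart and the case of empty F.\<close>

lemma separated_cut_and_project:
  fixes G :: "((real^'n) \<times> (real^'m)) set"
  assumes G: "is_lattice G" and irr: "G \<inter> {x. fst x = 0} = {0}" and "bounded W"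
  shows "\<exists>\<delta>. separated \<delta> (cut_and_project G v W)"
proof -
  obtain R where R: "\<And>y. y \<in> W \<Longrightarrow> norm y \<le> R" using \<open>bounded W\<close> by (auto simp: bounded_iff)
  define F where "F = {g\<in>G. g \<noteq> 0 \<and> norm (fst g) \<le> 1 \<and> norm (snd g) \<le> 2 * R}"
  obtain \<delta> where "separated \<delta> G" using is_lattice_separated[OF G] by blast
  then have "finite F"
  proof (rule separated_finite)
    show "bounded F"
    proof (rule boundedI)
      fix g assume "g \<in> F"
      then show "norm g \<le> 1 + 2 * R" using norm_Pair_le[of "fst g" "snd g"] by (auto simp: F_def)
    qed
  qed (auto simp: F_def)
  define \<epsilon> where "\<epsilon> = Min (insert 1 ((\<lambda>g. norm (fst g)) ` F))"
  have "fst g \<noteq> 0" if "g \<in> F" for g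
    using that irr unfolding F_def by blast
  then have "0 < \<epsilon>" using \<open>finite F\<close> by (auto simp: \<epsilon>_def)
  have "\<epsilon> \<le> dist x y" if xy: "x \<in> cut_and_project G v W" "y \<in> cut_and_project G v W" "x \<noteq> y" for x y
  proof -
    obtain g h where gh: "g \<in> G" "h \<in> G" "snd (g + v) \<in> W" "snd (h + v) \<in> W" "x = fst (g + v)" "y = fst (h + v)"
      using xy unfolding cut_and_project_def by blast
    have d: "x - y = fst (g - h)" using gh by simp
    show ?thesis
    proof (cases "norm (x - y) \<le> 1")
      case True
      have "norm (snd (g - h)) = norm (snd (g + v) - snd (h + v))" by simp
      also have "\<dots> \<le> norm (snd (g + v)) + norm (snd (h + v))" by (rule norm_triangle_ineq4)
      also have "\<dots> \<le> 2 * R" using R gh by (smt (verit))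
      finally have "g - h \<in> F"
        using gh d True xy(3) add_subgroup_diff[OF is_lattice_add_subgroup[OF G]] by (auto simp: F_def)
      then have "norm (fst (g - h)) \<in> (\<lambda>g. norm (fst g)) ` F" by (rule imageI)
      then have "\<epsilon> \<le> norm (fst (g - h))" using \<open>finite F\<close> unfolding \<epsilon>_def by (intro Min_le) auto
      then show ?thesis by (simp add: dist_norm d)
    next
      case False
      then have "1 \<le> dist x y" by (simp add: dist_norm)
      moreover have "\<epsilon> \<le> 1" using \<open>finite F\<close> unfolding \<epsilon>_def by (intro Min_le) auto
      ultimately show ?thesis by simp
    qed
  qed
  with \<open>0 < \<epsilon>\<close> show ?thesis unfolding separated_def by blast
qed

text \<open>Two effects are separated: the variation of K over a distance t, and a crossing of the
  window boundary between snd x and snd z, which puts snd z near the frontier. If only snd x lies in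
  W both occur, through \<open>K (p - fst z)\<close>. The indicators are taken at z because the
  bound will be integrated over z.\<close>

lemma window_smoothing_error:
  fixes W :: "(real^'m) set" and K :: "real^'n \<Rightarrow> real" and x z :: "(real^'n) \<times> (real^'m)"
  assumes W: "\<And>y. y \<in> W \<Longrightarrow> norm y \<le> R" and "0 \<le> c" "0 < L" "0 \<le> A"
    and K: "\<And>x. \<bar>K x\<bar> \<le> A" "\<And>x y. \<bar>K x - K y\<bar> \<le> A / L * norm (x - y)" "\<And>x. c * L < norm x \<Longrightarrow> K x = 0"
    and xz: "norm (fst z - fst x) \<le> t" "norm (snd z - snd x) \<le> u" and "t \<le> L" "0 < u" "u \<le> 1"
  shows "\<bar>lift_kernel W K p x - lift_kernel W K p z\<bar>
    \<le> A * (t / L) * (indicator (cball p ((c + 1) * L)) (fst z) * indicator (cball 0 (R + 1)) (snd z))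
      + A * (indicator (cball p (c * L)) (fst z) * indicator (nbhd (frontier W) (2 * u)) (snd z))"
proof -
  let ?P = "indicator (cball p ((c + 1) * L)) (fst z) * indicator (cball 0 (R + 1)) (snd z) :: real"
  let ?Q = "indicator (cball p (c * L)) (fst z) * indicator (nbhd (frontier W) (2 * u)) (snd z) :: real"
  let ?Kx = "K (p - fst x)" and ?Kz = "K (p - fst z)"
  have t0: "0 \<le> t" using xz(1) norm_ge_zero order_trans by blast
  have P0: "0 \<le> A * (t / L) * ?P" using t0 \<open>0 < L\<close> \<open>0 \<le> A\<close> by simp
  have Q0: "0 \<le> A * ?Q" using \<open>0 \<le> A\<close> by simp
  have lip: "\<bar>?Kx - ?Kz\<bar> \<le> A * (t / L)"
  proof -
    have "\<bar>?Kx - ?Kz\<bar> \<le> A / L * norm (p - fst x - (p - fst z))" by (rule K(2))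
    also have "\<dots> \<le> A / L * t" using xz(1) \<open>0 < L\<close> \<open>0 \<le> A\<close> by (intro mult_left_mono) auto
    finally show ?thesis by simp
  qed
  have tri: "norm (p - fst z) \<le> norm (p - fst x) + t"
    using norm_triangle_ineq4[of "p - fst x" "fst z - fst x"] xz(1) by simp
  have close: "\<bar>?Kx - ?Kz\<bar> \<le> A * (t / L) * ?P" if "snd x \<in> W" "?Kx \<noteq> 0 \<or> ?Kz \<noteq> 0"
  proof -
    have "norm (p - fst x) \<le> c * L \<or> norm (p - fst z) \<le> c * L" using that(2) K(3) by (meson not_le)
    then have "norm (p - fst z) \<le> (c + 1) * L"
      using tri \<open>t \<le> L\<close> \<open>0 < L\<close> by (auto simp: distrib_right)
    moreover have "norm (snd z) \<le> R + 1"
      using W[OF that(1)] xz(2) \<open>u \<le> 1\<close> norm_triangle_sub[of "snd z" "snd x"] by simp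
    ultimately have "?P = 1" by (simp add: dist_norm)
    then show ?thesis using lip by simp
  qed
  \<comment> \<open>The segment joining the two points meets the frontier within distance u of snd
    z; neighbourhoods are defined by a strict inequality, hence 2 u.\<close>
  have edge: "\<bar>?Kz\<bar> \<le> A * ?Q" if "snd x \<in> W \<longleftrightarrow> snd z \<notin> W"
  proof (cases "?Kz = 0")
    case False
    then have "norm (p - fst z) \<le> c * L" using K(3) by (meson not_le)
    moreover have "snd z \<in> nbhd (frontier W) (2 * u)"
    proof -
      have "\<exists>w\<in>frontier W. dist (snd z) w \<le> dist (snd x) (snd z)"
      proof (cases "snd x \<in> W")
        case True
        then show ?thesis using frontier_between[of "snd x" W "snd z"] that by blast
      next
        case False
        then show ?thesis
          using frontier_between[of "snd z" W "snd x"] that unfolding dist_commute[of "snd z" "snd x"] by blast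
      qed
      then obtain w where w: "w \<in> frontier W" "dist (snd z) w \<le> dist (snd x) (snd z)" by blast
      note w(2)
      also have "dist (snd x) (snd z) \<le> u" using xz(2) by (simp add: dist_norm norm_minus_commute)
      finally show ?thesis using w \<open>0 < u\<close> unfolding nbhd_def by force
    qed
    ultimately have "?Q = 1" by (simp add: dist_norm)
    then show ?thesis using K(1) by simp
  qed (use Q0 in simp)
  consider "snd x \<in> W" "snd z \<in> W" | "snd x \<notin> W" "snd z \<notin> W" | "snd x \<in> W" "snd z \<notin> W" | "snd x \<notin> W" "snd z \<in> W"
    by blast
  then show ?thesis
  proof cases
    case 1
    show ?thesis
    proof (cases "?Kx \<noteq> 0 \<or> ?Kz \<noteq> 0")
      case True
      from close[OF 1(1) True] Q0 show ?thesis unfolding lift_kernel_def using 1 by simp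
    next
      case False
      then show ?thesis using P0 Q0 by (simp add: lift_kernel_def)
    qed
  next
    case 2
    then show ?thesis using P0 Q0 by (simp add: lift_kernel_def)
  next
    case 3
    show ?thesis
    proof (cases "?Kx = 0")
      case True
      then show ?thesis using 3 P0 Q0 by (simp add: lift_kernel_def)
    next
      case False
      then have "\<bar>?Kx - ?Kz\<bar> \<le> A * (t / L) * ?P" using close[OF 3(1)] by blast
      moreover have "\<bar>?Kz\<bar> \<le> A * ?Q" using edge 3 by blast
      moreover have "\<bar>?Kx\<bar> \<le> \<bar>?Kx - ?Kz\<bar> + \<bar>?Kz\<bar>" by simp
      ultimately have "\<bar>?Kx\<bar> \<le> A * (t / L) * ?P + A * ?Q" by linarith
      then show ?thesis using 3 by (simp add: lift_kernel_def)
    qed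
  next
    case 4
    then have "\<bar>?Kz\<bar> \<le> A * ?Q" using edge by blast
    then show ?thesis using 4 P0 by (simp add: lift_kernel_def)
  qed
qed

text \<open>If norm (fst \<theta>) < 1 / T, monotonicity of the logarithm bounds norm (snd \<theta>)
  below by the value of \<psi> at T. Taking T0 \<ge> 1 / r0 brings such \<theta> into the range
  where repellence applies.\<close>

lemma repellent_scaling:
  fixes D :: "((real^'n) \<times> (real^'m)) set"
  assumes rep: "psi_repellent (\<lambda>t. ln (1 + t) powr q) D" and "0 < q"
  shows "\<exists>T0\<ge>1. \<forall>T>T0. \<forall>\<theta>\<in>D. \<theta> \<noteq> 0 \<longrightarrow>
    1 \<le> T * norm (fst \<theta>) \<or> 1 \<le> ln (1 + T) powr (- q) * norm (snd \<theta>)"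
proof -
  obtain r0 where "0 < r0" and r0: "\<And>\<theta>. \<theta> \<in> D \<Longrightarrow> \<theta> \<noteq> 0 \<Longrightarrow> norm (fst \<theta>) < r0 \<Longrightarrow>
      fst \<theta> \<noteq> 0 \<and> ln (1 + 1 / norm (fst \<theta>)) powr q < norm (snd \<theta>)"
    using rep unfolding psi_repellent_def by blast
  show ?thesis
  proof (intro exI[of _ "max 1 (1 / r0)"] conjI allI impI ballI)
    fix T \<theta> assume "max 1 (1 / r0) < T" and \<theta>: "\<theta> \<in> D" "\<theta> \<noteq> 0"
    then have T: "1 < T" "1 / T < r0" using \<open>0 < r0\<close> by (auto simp: field_simps)
    show "1 \<le> T * norm (fst \<theta>) \<or> 1 \<le> ln (1 + T) powr (- q) * norm (snd \<theta>)"
    proof (cases "1 \<le> T * norm (fst \<theta>)")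
      case False
      then have f: "norm (fst \<theta>) < 1 / T" using T by (simp add: field_simps)
      then have n: "fst \<theta> \<noteq> 0" "ln (1 + 1 / norm (fst \<theta>)) powr q < norm (snd \<theta>)"
        using r0[OF \<theta>] T by auto
      have "T \<le> 1 / norm (fst \<theta>)" using f n T by (simp add: field_simps less_imp_le)
      then have "ln (1 + T) powr q \<le> ln (1 + 1 / norm (fst \<theta>)) powr q"
        using T \<open>0 < q\<close> by (intro powr_mono2) auto
      then have "ln (1 + T) powr q \<le> norm (snd \<theta>)" using n by simp
      moreover have "0 < ln (1 + T)" using T by simp
      ultimately show ?thesis by (simp add: powr_minus field_simps)
    qed simp
  qed simp
qed

lemma borel_measurable_of_lipschitz:
  fixes K :: "'a::euclidean_space \<Rightarrow> real"
  assumes "\<And>x y. \<bar>K x - K y\<bar> \<le> C * norm (x - y)" "0 \<le> C"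
  shows "K \<in> borel_measurable borel"
  using assms by (intro borel_measurable_continuous_onI lipschitz_on_continuous_on[of C] lipschitz_onI)
    (auto simp: dist_norm)

text \<open>The tile is a product of closed balls of radii t and u, whose translates cover by
  assumption. The error of the lifted kernel over a tile integrates to two product volumes: a ball
  times a ball, weighted by t / L, and a ball times the boundary layer of the window.\<close>

lemma cut_and_project_estimate:
  fixes G :: "((real^'n) \<times> (real^'m)) set" and K :: "real^'n \<Rightarrow> real"
  assumes G: "is_lattice G" and irr: "G \<inter> {x. fst x = 0} = {0}"
    and V: "0 < V" "\<And>B b. lattice_tile G B b \<Longrightarrow> (\<integral>x. tile G B x \<partial>lborel) = V"
    and W: "open W" "\<And>y. y \<in> W \<Longrightarrow> norm y \<le> R" "0 \<le> R"
    and cover: "\<And>x. \<exists>g\<in>G. norm (fst x - fst g) \<le> t \<and> norm (snd x - snd g) \<le> u"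
    and "0 \<le> c" "0 < L" "0 \<le> A" "t \<le> L" "0 < u" "u \<le> 1" "0 \<le> t"
    and K: "\<And>x. \<bar>K x\<bar> \<le> A" "\<And>x y. \<bar>K x - K y\<bar> \<le> A / L * norm (x - y)" "\<And>x. c * L < norm x \<Longrightarrow> K x = 0"
  shows "\<bar>V * smear (cut_and_project G v W) K p - measure lborel W * (\<integral>x. K x \<partial>lborel)\<bar>
    \<le> A * L ^ CARD('n) * unit_ball_vol CARD('n) *
      ((c + 1) ^ CARD('n) * measure lborel (cball (0 :: real^'m) (R + 1)) * (t / L)
       + c ^ CARD('n) * measure lborel (nbhd (frontier W) (2 * u)))"
proof -
  let ?n = "CARD('n)"
  have [measurable]: "K \<in> borel_measurable borel"
    using K(2) \<open>0 \<le> A\<close> \<open>0 < L\<close> by (intro borel_measurable_of_lipschitz[of K "A / L"]) auto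
  have [measurable]: "W \<in> sets borel" using W by auto
  have bW: "bounded W" using W(2) by (auto intro: boundedI)
  define B where "B = {x :: (real^'n) \<times> (real^'m). norm (fst x) \<le> t \<and> norm (snd x) \<le> u}"
  have "lattice_tile G B (t + u)"
  proof
    have "closed B" unfolding B_def
      by (intro closed_Collect_conj closed_Collect_le continuous_intros)
    then show "B \<in> sets borel" by (rule borel_closed)
    show "norm x \<le> t + u" if "x \<in> B" for x
      using that norm_Pair_le[of "fst x" "snd x"] by (auto simp: B_def)
    show "\<exists>g\<in>G. x - g \<in> B" for x using cover[of x] by (auto simp: B_def)
  qed (rule G)
  then interpret lattice_tile G B "t + u" .
  define P where "P z = (indicator (cball p ((c + 1) * L)) (fst z) * indicator (cball 0 (R + 1)) (snd z) :: real)"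
    for z :: "(real^'n) \<times> (real^'m)"
  define Q where "Q z = (indicator (cball p (c * L)) (fst z) * indicator (nbhd (frontier W) (2 * u)) (snd z) :: real)"
    for z :: "(real^'n) \<times> (real^'m)"
  define h where "h z = A * (t / L) * P z + A * Q z" for z
  have nb: "nbhd (frontier W) (2 * u) \<in> sets borel" "bounded (nbhd (frontier W) (2 * u))"
  proof -
    have "bounded (frontier W)" by (rule bounded_subset[OF bounded_closure[OF bW]]) (auto simp: frontier_def)
    then show "bounded (nbhd (frontier W) (2 * u))" by (rule nbhd_bounded)
  qed (rule borel_open[OF nbhd_open])
  have iP: "integrable lborel P" "(\<integral>z. P z \<partial>lborel) = measure lborel (cball p ((c + 1) * L)) * measure lborel (cball (0 :: real^'m) (R + 1))"
    unfolding P_def by (rule integral_rectangle; simp)+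
  have iQ: "integrable lborel Q" "(\<integral>z. Q z \<partial>lborel) = measure lborel (cball p (c * L)) * measure lborel (nbhd (frontier W) (2 * u))"
    unfolding Q_def by (rule integral_rectangle; simp add: nb)+
  have ih: "integrable lborel h" unfolding h_def using iP iQ by auto
  have "(\<integral>z. h z \<partial>lborel) = A * (t / L) * (\<integral>z. P z \<partial>lborel) + A * (\<integral>z. Q z \<partial>lborel)"
    unfolding h_def using iP iQ by simp
  also have "\<dots> = A * L ^ ?n * unit_ball_vol ?n *
      ((c + 1) ^ ?n * measure lborel (cball (0 :: real^'m) (R + 1)) * (t / L)
       + c ^ ?n * measure lborel (nbhd (frontier W) (2 * u)))"
  proof -
    have vol: "measure lborel (cball p (a * L)) = unit_ball_vol ?n * (a ^ ?n * L ^ ?n)" if "0 \<le> a" for a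
      using that \<open>0 < L\<close> by (simp add: content_cball power_mult_distrib)
    have "0 \<le> c + 1" using \<open>0 \<le> c\<close> by simp
    then show ?thesis
      unfolding iP iQ vol[OF \<open>0 \<le> c\<close>] vol[OF \<open>0 \<le> c + 1\<close>] by (simp add: algebra_simps)
  qed
  finally have Ih: "(\<integral>z. h z \<partial>lborel) = A * L ^ ?n * unit_ball_vol ?n *
      ((c + 1) ^ ?n * measure lborel (cball (0 :: real^'m) (R + 1)) * (t / L)
       + c ^ ?n * measure lborel (nbhd (frontier W) (2 * u)))" .
  have mK: "(\<lambda>x. K (p - x)) \<in> borel_measurable borel" by measurable
  have Ks: "K (p - x) = 0" if "c * L + norm p < norm x" for x
  proof (rule K(3))
    show "c * L < norm (p - x)" using that norm_triangle_ineq2[of x p] by (simp add: norm_minus_commute)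
  qed
  have Wi: "indicator W y = (0::real)" if "R < norm y" for y using W(2)[of y] that by (auto simp: indicator_def)
  have ig: "integrable lborel (lift_kernel W K p)"
    "(\<integral>z. lift_kernel W K p z \<partial>lborel) = (\<integral>x. K x \<partial>lborel) * measure lborel W"
  proof -
    note a = integral_product_bounded_support[of "\<lambda>x. K (p - x)" "indicator W", OF mK _ K(1) Ks _ Wi, where A' = 1]
    show "integrable lborel (lift_kernel W K p)" unfolding lift_kernel_def[abs_def] by (rule a(1)) auto
    show "(\<integral>z. lift_kernel W K p z \<partial>lborel) = (\<integral>x. K x \<partial>lborel) * measure lborel W"
      unfolding lift_kernel_def[abs_def] by (subst a(2)) (auto simp: integral_lborel_reflect indicator_def[of W])
  qed
  have "\<bar>V * (\<Sum>g\<in>{g\<in>G. lift_kernel W K p (g + v) \<noteq> 0}. lift_kernel W K p (g + v)) - (\<integral>z. lift_kernel W K p z \<partial>lborel)\<bar>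
    \<le> (\<integral>z. h z \<partial>lborel)"
    unfolding V(2)[OF \<open>lattice_tile G B (t + u)\<close>, symmetric]
  proof (rule lattice_sum_approx)
    show "lift_kernel W K p \<in> borel_measurable borel" using ig(1) by auto
    show "\<bar>lift_kernel W K p x\<bar> \<le> A" for x
      using K(1) \<open>0 \<le> A\<close> by (auto simp: lift_kernel_def indicator_def)
    show "lift_kernel W K p x = 0" if "\<bar>c * L + norm p\<bar> + \<bar>R\<bar> < norm x" for x
    proof -
      have "norm x \<le> norm (fst x) + norm (snd x)" using norm_Pair_le[of "fst x" "snd x"] by simp
      with that have "c * L + norm p < norm (fst x) \<or> R < norm (snd x)" by linarith
      then show ?thesis using Ks Wi by (auto simp: lift_kernel_def)
    qed
    show "integrable lborel h" by (rule ih)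
    show "0 \<le> h x" for x
      using \<open>0 \<le> A\<close> \<open>0 \<le> t\<close> \<open>0 < L\<close> by (simp add: h_def P_def Q_def)
    show "\<bar>lift_kernel W K p x - lift_kernel W K p z\<bar> \<le> h z" if "z - x \<in> B" for x z
      unfolding h_def P_def Q_def
      by (rule window_smoothing_error[OF W(2) \<open>0 \<le> c\<close> \<open>0 < L\<close> \<open>0 \<le> A\<close> K])
        (use that \<open>t \<le> L\<close> \<open>0 < u\<close> \<open>u \<le> 1\<close> in \<open>auto simp: B_def\<close>)
  qed
  then show ?thesis unfolding smear_cut_and_project[OF G irr] Ih ig(2) by (simp only: mult.commute[of "measure lborel W"])
qed

lemma uniform_discrepancy_cut_and_project:
  fixes G :: "((real^'n) \<times> (real^'m)) set"
  assumes "0 < s" "0 < \<eta>" and G: "is_lattice G" and irr: "G \<inter> {x. fst x = 0} = {0}"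
    and V: "0 < V" "\<And>B b. lattice_tile G B b \<Longrightarrow> (\<integral>x. tile G B x \<partial>lborel) = V"
    and W: "s_regular_window s W"
    and rep: "psi_repellent (\<lambda>t. ln (1 + t) powr ((1 + \<eta>) / s)) (dual_lattice G)"
  shows "uniform_discrepancy (cut_and_project G v W) (measure lborel W / V) (\<lambda>L. ln L powr (- (1 + \<eta>)))"
  unfolding uniform_discrepancy_def
proof
  fix c0 :: real
  let ?n = "CARD('n)"
  \<comment> \<open>c0 may be negative, whereas the volume formulas want a nonnegative
    radius.\<close>
  define c where "c = \<bar>c0\<bar>"
  define q where "q = (1 + \<eta>) / s"
  have q: "0 < q" "q * s = 1 + \<eta>" using \<open>0 < s\<close> \<open>0 < \<eta>\<close> by (auto simp: q_def)
  obtain C where "0 \<le> C" and C: "\<And>T r x. 0 < T \<Longrightarrow> 0 < r \<Longrightarrow>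
     (\<forall>\<theta>\<in>dual_lattice G. \<theta> \<noteq> 0 \<longrightarrow> 1 \<le> T * norm (fst \<theta>) \<or> 1 \<le> r * norm (snd \<theta>)) \<Longrightarrow>
     \<exists>g\<in>G. norm (fst x - fst g) \<le> C * T \<and> norm (snd x - snd g) \<le> C * r"
    using lattice_covering[OF G] by meson
  obtain T0 where "1 \<le> T0" and T0: "\<And>T. T0 < T \<Longrightarrow> \<forall>\<theta>\<in>dual_lattice G. \<theta> \<noteq> 0 \<longrightarrow>
    1 \<le> T * norm (fst \<theta>) \<or> 1 \<le> ln (1 + T) powr (- q) * norm (snd \<theta>)"
    using repellent_scaling[OF rep[folded q_def] q(1)] by meson
  obtain M r1 where "0 \<le> M" "0 < r1" and M: "\<And>r. 0 < r \<Longrightarrow> r < r1 \<Longrightarrow> measure lborel (nbhd (frontier W) r) \<le> M * r powr s"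
    using upper_minkowski_content_finite W unfolding s_regular_window_def by meson
  have "bounded W" and oW: "open W" using W by (auto simp: s_regular_window_def)
  then obtain R where "0 < R" and R: "\<And>y. y \<in> W \<Longrightarrow> norm y \<le> R"
    using bounded_pos by metis
  \<comment> \<open>C may be 0, but the tile needs a positive radius in the second factor.\<close>
  define k where "k = C + 1"
  have k: "0 < k" "C \<le> k" using \<open>0 \<le> C\<close> by (auto simp: k_def)
  define r where "r L = ln (1 + sqrt L) powr (- q)" for L
  have r0: "(r \<longlongrightarrow> 0) at_top"
    unfolding r_def
  proof (rule tendsto_neg_powr)
    show "filterlim (\<lambda>L :: real. ln (1 + sqrt L)) at_top at_top" by real_asymp
  qed (use q in simp)
  \<comment> \<open>The thresholds ensure, in this order, that repellence applies at T = sqrt L,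
    that the tile has radius at most L, that k r < 1 and 2 k r is in the range of the Minkowski
    bound, and that the Lipschitz error is dominated by the power of the logarithm.\<close>
  have ev1: "\<forall>\<^sub>F L in at_top. T0 < sqrt L" by real_asymp
  have ev2: "\<forall>\<^sub>F L in at_top. k * sqrt L \<le> L" using k by real_asymp
  have ev3: "\<forall>\<^sub>F L in at_top. r L < min 1 (r1 / 2) / k"
    using k \<open>0 < r1\<close> by (intro order_tendstoD[OF r0]) auto
  have ev4: "\<forall>\<^sub>F L in at_top. sqrt L / L \<le> ln L powr (- (1 + \<eta>))"
    using \<open>0 < \<eta>\<close> by real_asymp
  have ev5: "\<forall>\<^sub>F L in at_top. (2::real) \<le> L" by (rule eventually_ge_at_top)
  obtain L0 where L0: "\<And>L. L0 \<le> L \<Longrightarrow> T0 < sqrt L \<and> k * sqrt L \<le> L \<and> r L < min 1 (r1 / 2) / k \<and>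
      sqrt L / L \<le> ln L powr (- (1 + \<eta>)) \<and> 2 \<le> L"
    using eventually_conj[OF ev1 eventually_conj[OF ev2 eventually_conj[OF ev3 eventually_conj[OF ev4 ev5]]]]
    unfolding eventually_at_top_linorder by auto
  define X where "X = (c + 1) ^ ?n * measure lborel (cball (0 :: real^'m) (R + 1)) * k"
  define Y where "Y = c ^ ?n * (M * (2 * k) powr s * 2 powr (1 + \<eta>))"
  have c: "0 \<le> c" by (simp add: c_def)
  have XY: "0 \<le> X" "0 \<le> Y" using c k \<open>0 \<le> M\<close> by (auto simp: X_def Y_def)
  define D where "D = unit_ball_vol ?n * (X + Y) / V"
  show "\<exists>D L0. \<forall>L\<ge>L0. \<forall>A\<ge>0. \<forall>K.
        (\<forall>x. \<bar>K x\<bar> \<le> A) \<longrightarrow> (\<forall>x y. \<bar>K x - K y\<bar> \<le> A / L * norm (x - y)) \<longrightarrow>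
        (\<forall>x. c0 * L < norm x \<longrightarrow> K x = 0) \<longrightarrow>
        (\<forall>x. \<bar>smear (cut_and_project G v W) K x - measure lborel W / V * (\<integral>x. K x \<partial>lborel)\<bar>
           \<le> D * A * L ^ ?n * ln L powr (- (1 + \<eta>)))"
  proof (rule exI[of _ D], rule exI[of _ L0], intro allI impI)
    fix L A :: real and K :: "real^'n \<Rightarrow> real" and p
    assume "L0 \<le> L" and A: "0 \<le> A" and K: "\<forall>x. \<bar>K x\<bar> \<le> A" "\<forall>x y. \<bar>K x - K y\<bar> \<le> A / L * norm (x - y)"
      "\<forall>x. c0 * L < norm x \<longrightarrow> K x = 0"
    define e where "e = ln L powr (- (1 + \<eta>))"
    have L: "T0 < sqrt L" "k * sqrt L \<le> L" "r L < min 1 (r1 / 2) / k" "sqrt L / L \<le> e" "2 \<le> L"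
      using L0[OF \<open>L0 \<le> L\<close>] unfolding e_def by blast+
    have e0: "0 \<le> e" by (simp add: e_def)
    have "0 < ln (1 + sqrt L)" using L(5) by (intro ln_gt_zero) simp
    then have rpos: "0 < r L" by (simp add: r_def)
    have kr: "k * r L < 1" "2 * (k * r L) < r1"
      using L(3) k by (auto simp: pos_less_divide_eq mult.commute)
    have cov: "\<exists>g\<in>G. norm (fst x - fst g) \<le> k * sqrt L \<and> norm (snd x - snd g) \<le> k * r L" for x
    proof -
      obtain g where g: "g \<in> G" "norm (fst x - fst g) \<le> C * sqrt L" "norm (snd x - snd g) \<le> C * r L"
        using C[of "sqrt L" "r L" x] T0[OF L(1)] rpos L(5) unfolding r_def by auto
      moreover have "C * sqrt L \<le> k * sqrt L" "C * r L \<le> k * r L"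
        using k rpos L(5) by (auto intro!: mult_right_mono)
      ultimately show ?thesis by force
    qed
    \<comment> \<open>q s = 1 + \<eta> turns \<open>r powr s\<close> into the desired power of the
      logarithm; replacing ln (1 + sqrt L) by ln L / 2 costs the factor 2 powr (1 + \<eta>).\<close>
    have rs: "r L powr s \<le> 2 powr (1 + \<eta>) * e"
    proof -
      have "0 < ln L / 2" using L(5) by simp
      have "ln L / 2 = ln (sqrt L)" using L(5) by (simp add: ln_sqrt)
      also have "\<dots> \<le> ln (1 + sqrt L)" using L(5) by (simp add: add_pos_pos)
      finally have "ln (1 + sqrt L) powr (- (1 + \<eta>)) \<le> (ln L / 2) powr (- (1 + \<eta>))"
        using \<open>0 < ln L / 2\<close> \<open>0 < \<eta>\<close> by (intro powr_mono2') auto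
      also have "\<dots> = 2 powr (1 + \<eta>) * e"
        using L(5) unfolding e_def by (simp add: powr_divide powr_minus_divide[of 2] del: minus_add_distrib)
      finally show ?thesis using q by (simp add: r_def powr_powr)
    qed
    have mN: "measure lborel (nbhd (frontier W) (2 * (k * r L))) \<le> M * (2 * k) powr s * 2 powr (1 + \<eta>) * e"
    proof -
      have "measure lborel (nbhd (frontier W) (2 * (k * r L))) \<le> M * (2 * (k * r L)) powr s"
        using kr k rpos by (intro M) auto
      also have "(2 * (k * r L)) powr s = (2 * k) powr s * r L powr s"
        using k rpos by (simp add: powr_mult mult.assoc)
      also have "M * ((2 * k) powr s * r L powr s) \<le> M * ((2 * k) powr s * (2 powr (1 + \<eta>) * e))"
        using rs \<open>0 \<le> M\<close> by (intro mult_left_mono) auto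
      finally show ?thesis by (simp add: mult.assoc)
    qed
    have "\<bar>V * smear (cut_and_project G v W) K p - measure lborel W * (\<integral>x. K x \<partial>lborel)\<bar>
      \<le> A * L ^ ?n * unit_ball_vol ?n *
      ((c + 1) ^ ?n * measure lborel (cball (0 :: real^'m) (R + 1)) * (k * sqrt L / L)
       + c ^ ?n * measure lborel (nbhd (frontier W) (2 * (k * r L))))"
    proof (rule cut_and_project_estimate[OF G irr V oW R _ cov c _ A])
      show "K x = 0" if "c * L < norm x" for x
      proof -
        have "c0 * L \<le> c * L" using L(5) by (intro mult_right_mono) (auto simp: c_def)
        then show ?thesis using K(3) that by simp
      qed
    qed (use L kr k rpos K \<open>0 < R\<close> in auto)
    also have "\<dots> \<le> A * L ^ ?n * unit_ball_vol ?n * (X * e + Y * e)"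
    proof (intro mult_left_mono add_mono)
      have "X * (sqrt L / L) \<le> X * e" using L(4) XY by (intro mult_left_mono)
      then show "(c + 1) ^ ?n * measure lborel (cball (0 :: real^'m) (R + 1)) * (k * sqrt L / L) \<le> X * e"
        by (simp add: X_def)
      show "c ^ ?n * measure lborel (nbhd (frontier W) (2 * (k * r L))) \<le> Y * e"
        using mult_left_mono[OF mN, of "c ^ ?n"] c by (simp add: Y_def mult.assoc)
      show "0 \<le> A * L ^ ?n * unit_ball_vol ?n" using A L(5) by simp
    qed
    also have "\<dots> = (V * D) * (A * L ^ ?n * e)"
    proof -
      have VD: "V * D = unit_ball_vol ?n * (X + Y)" using V(1) by (simp add: D_def)
      show ?thesis unfolding VD by (simp add: algebra_simps)
    qed
    also have "\<dots> = V * (D * A * L ^ ?n * e)" by (simp add: mult_ac)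
    finally have *: "\<bar>V * smear (cut_and_project G v W) K p - measure lborel W * (\<integral>x. K x \<partial>lborel)\<bar>
      \<le> V * (D * A * L ^ ?n * e)" .
    have "V * smear (cut_and_project G v W) K p - measure lborel W * (\<integral>x. K x \<partial>lborel)
      = V * (smear (cut_and_project G v W) K p - measure lborel W / V * (\<integral>x. K x \<partial>lborel))"
      using V(1) by (simp add: right_diff_distrib)
    then have "V * \<bar>smear (cut_and_project G v W) K p - measure lborel W / V * (\<integral>x. K x \<partial>lborel)\<bar> \<le> V * (D * A * L ^ ?n * e)"
      using * V(1) by (simp add: abs_mult)
    then show "\<bar>smear (cut_and_project G v W) K p - measure lborel W / V * (\<integral>x. K x \<partial>lborel)\<bar>
           \<le> D * A * L ^ ?n * ln L powr (- (1 + \<eta>))"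
      using V(1) unfolding e_def by simp
  qed
qed

theorem theorem1p3:
  fixes s \<eta> :: real
    and \<Gamma> :: "((real^'n) \<times> (real^'m)) set"
    and v :: "(real^'n) \<times> (real^'m)"
    and \<Omega> :: "(real^'m) set"
  assumes "0 < s" "s < 1" "0 < \<eta>"
    and "is_lattice \<Gamma>"
    and "completely_irrational \<Gamma>"
    and "s_regular_window s \<Omega>"
    and "psi_repellent (\<lambda>t. ln (1 + t) powr ((1 + \<eta>) / s)) (dual_lattice \<Gamma>)"
  shows "bilipschitz_equivalent (cut_and_project \<Gamma> v \<Omega>) (integer_lattice :: (real^'n) set)"
proof -
  have irr: "\<Gamma> \<inter> {x. fst x = 0} = {0}"
    using assms(5) by (simp add: completely_irrational_def)
  have \<Omega>: "bounded \<Omega>" "open \<Omega>" "\<Omega> \<noteq> {}"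
    using assms(6) by (auto simp: s_regular_window_def)
  obtain V where V: "0 < V" "\<And>B b. lattice_tile \<Gamma> B b \<Longrightarrow> (\<integral>x. tile \<Gamma> B x \<partial>lborel) = V"
    using covolume[OF assms(4)] by blast
  obtain \<delta> where sep: "separated \<delta> (cut_and_project \<Gamma> v \<Omega>)"
    using separated_cut_and_project[OF assms(4) irr \<Omega>(1)] by blast
  \<comment> \<open>Needed for a positive density; a nonempty open window contains a ball.\<close>
  have "0 < measure lborel \<Omega>"
  proof -
    obtain x d where "0 < d" "ball x d \<subseteq> \<Omega>" using \<Omega> by (meson ex_in_conv openE)
    have "0 < measure lborel (ball x d)" using content_ball_pos[OF \<open>0 < d\<close>] by simp
    also have "\<dots> \<le> measure lborel \<Omega>"
      using \<open>ball x d \<subseteq> \<Omega>\<close> \<Omega> emeasure_bounded_finite by (intro measure_mono_fmeasurable fmeasurableI) auto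
    finally show ?thesis .
  qed
  then have pos: "0 < measure lborel \<Omega> / V" using V(1) by simp
  \<comment> \<open>As ln (2^i) = i ln 2, this is a multiple of the p-series with exponent 1 +
    \<eta> > 1.\<close>
  have "summable (\<lambda>i. ln ((2::real) ^ i) powr (- (1 + \<eta>)))"
  proof -
    have "summable (\<lambda>i. real i powr (- (1 + \<eta>)))"
      using \<open>0 < \<eta>\<close> by (simp add: summable_real_powr_iff)
    then have "summable (\<lambda>i. ln 2 powr (- (1 + \<eta>)) * real i powr (- (1 + \<eta>)))"
      by (rule summable_mult)
    also have "(\<lambda>i. ln 2 powr (- (1 + \<eta>)) * real i powr (- (1 + \<eta>))) = (\<lambda>i. ln ((2::real) ^ i) powr (- (1 + \<eta>)))"
      by (simp add: ln_realpow powr_mult mult.commute)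
    finally show ?thesis .
  qed
  moreover have "uniform_discrepancy (cut_and_project \<Gamma> v \<Omega>) (measure lborel \<Omega> / V) (\<lambda>L. ln L powr (- (1 + \<eta>)))"
    by (rule uniform_discrepancy_cut_and_project[OF assms(1,3,4) irr V(1) _ assms(6,7)]) (rule V(2))
  ultimately show ?thesis
    by (intro bilipschitz_integer_lattice_if_uniform_discrepancy[OF sep pos]) auto
qed

end
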